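(* Let $u=(u_n)_{n\in\mathbb Z}$ be a non-degenerate 3iet word coding the orbit of the point $x_0\in[0,\alpha_1+\alpha_2+\alpha_3)$ under the exchange of three intervals with permutation $(321)$ and parameters $\alpha_1,\alpha_2,\alpha_3>0$. Put $$\varepsilon:=\frac{\alpha_1+\alpha_2}{\alpha_1+2\alpha_2+\alpha_3},\qquad l:=\frac{\alpha_1+\alpha_2+\alpha_3}{\alpha_1+2\alpha_2+\alpha_3},\qquad c:=\frac{-x_0}{\alpha_1+2\alpha_2+\alpha_3}.$$ Then $u$ is invariant under a primitive substitution if and only if the following three conditions hold: 1. $\varepsilon$ is a Sturm number; 2. $c,l\in\mathbb Q(\varepsilon)$; 3. $\min(\varepsilon',1-\varepsilon')\le -c'\le \max(\varepsilon',1-\varepsilon')$ and $\min(\varepsilon',1-\varepsilon')\le c'+l'\le \max(\varepsilon',1-\varepsilon')$, where $x\mapsto x'$ denotes the Galois automorphism of the quadratic field $\mathbb Q(\varepsilon)$.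
   Context: **3iet words.** For positive reals $\alpha_1,\alpha_2,\alpha_3$, the exchange of three intervals with permutation $(321)$ is the map $\widetilde T$ on $I=[0,\alpha_1+\alpha_2+\alpha_3)$ given by $\widetilde T(x)=x+\alpha_2+\alpha_3$ for $x\in I_1=[0,\alpha_1)$, $\widetilde T(x)=x-\alpha_1+\alpha_3$ for $x\in I_2=[\alpha_1,\alpha_1+\alpha_2)$, $\widetilde T(x)=x-\alpha_1-\alpha_2$ for $x\in I_3=[\alpha_1+\alpha_2,\alpha_1+\alpha_2+\alpha_3)$. It is a bijection of $I$. The 3iet word coding the orbit of $x_0\in I$ is the pointed bidirectional infinite word $u=\cdots u_{-2}u_{-1}|u_0u_1u_2\cdots$ over $\{1,2,3\}$ with $u_n=i$ if $\widetilde T^n(x_0)\in I_i$, $n\in\mathbb Z$. The word is non-degenerate if and only if $\alpha_1+\alpha_2$ and $\alpha_2+\alpha_3$ are linearly independent over $\mathbb Q$ and $\alpha_1+\alpha_2+\alpha_3\notin(\alpha_1+\alpha_2)\mathbb Z+(\alpha_2+\alpha_3)\mathbb Z$. **Substitutions.** A substitution over a finite alphabet $\mathcal A$ is a monoid morphism $\varphi:\mathcal A^*\to\mathcal A^*$. It is primitive if there is $n\in\mathbb N$ such that $\varphi^n(a)$ contains $b$ for all letters $a,b\in\mathcal A$. It acts on pointed bidirectional words by $\varphi(\cdots u_{-2}u_{-1}|u_0u_1\cdots)=\cdots\varphi(u_{-2})\varphi(u_{-1})|\varphi(u_0)\varphi(u_1)\cdots$. The word $u$ is invariant under $\varphi$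 if $\varphi(u)=u$ (as pointed words). **Sturm number.** A quadratic irrational number $\varepsilon$ with algebraic conjugate $\varepsilon'$ is a Sturm number if $\varepsilon\in(0,1)$ and $\varepsilon'\notin(0,1)$. *)

theory Defs
  imports Complex_Main "HOL-Computational_Algebra.Polynomial"
begin

section \<open>Words coding the exchange of three intervals\<close>

datatype letter = L1 | L2 | L3

fun iet_interval :: "real \<Rightarrow> real \<Rightarrow> real \<Rightarrow> letter \<Rightarrow> real set" where
  "iet_interval a1 a2 a3 L1 = {0..<a1}"
| "iet_interval a1 a2 a3 L2 = {a1..<a1 + a2}"
| "iet_interval a1 a2 a3 L3 = {a1 + a2..<a1 + a2 + a3}"

definition iet_map :: "real \<Rightarrow> real \<Rightarrow> real \<Rightarrow> real \<Rightarrow> real" where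
  "iet_map a1 a2 a3 x =
    (if x \<in> iet_interval a1 a2 a3 L1 then x + a2 + a3
     else if x \<in> iet_interval a1 a2 a3 L2 then x - a1 + a3
     else x - a1 - a2)"

lemma bij_betw_iet_map:
  assumes "a1 > 0" "a2 > 0" "a3 > 0"
  shows "bij_betw (iet_map a1 a2 a3) {0..<a1 + a2 + a3} {0..<a1 + a2 + a3}"
proof (rule bij_betw_byWitness)
  let ?g = "\<lambda>y. if y < a3 then y + a1 + a2 else if y < a2 + a3 then y + a1 - a3 else y - a2 - a3"
  show "\<forall>x\<in>{0..<a1 + a2 + a3}. ?g (iet_map a1 a2 a3 x) = x"
    "\<forall>y\<in>{0..<a1 + a2 + a3}. iet_map a1 a2 a3 (?g y) = y"
    "iet_map a1 a2 a3 ` {0..<a1 + a2 + a3} \<subseteq> {0..<a1 + a2 + a3}"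
    "?g ` {0..<a1 + a2 + a3} \<subseteq> {0..<a1 + a2 + a3}"
    using assms by (auto simp: iet_map_def)
qed

text \<open>The integer iterates of the exchange, negative ones being taken with the inverse
  of the bijection of the interval onto itself.\<close>

definition iet_iter :: "real \<Rightarrow> real \<Rightarrow> real \<Rightarrow> int \<Rightarrow> real \<Rightarrow> real" where
  "iet_iter a1 a2 a3 n x =
    (if n \<ge> 0 then (iet_map a1 a2 a3 ^^ nat n) x
     else (inv_into {0..<a1 + a2 + a3} (iet_map a1 a2 a3) ^^ nat (- n)) x)"

text \<open>Pointed bidirectional words are functions on the integers; the bar precedes position 0.\<close>

definition codes_3iet_orbit ::
    "real \<Rightarrow> real \<Rightarrow> real \<Rightarrow> real \<Rightarrow> (int \<Rightarrow> letter) \<Rightarrow> bool" where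
  "codes_3iet_orbit a1 a2 a3 x0 u \<longleftrightarrow>
    (\<forall>n. iet_iter a1 a2 a3 n x0 \<in> iet_interval a1 a2 a3 (u n))"

text \<open>The first conjunct is the linear independence over the rationals of the family
  \<open>(a1 + a2, a2 + a3)\<close>. It is spelled out because independence of the set
  \<open>{a1 + a2, a2 + a3}\<close> would hold whenever the two numbers coincide.\<close>

definition nondegenerate_3iet :: "real \<Rightarrow> real \<Rightarrow> real \<Rightarrow> bool" where
  "nondegenerate_3iet a1 a2 a3 \<longleftrightarrow>
    (\<forall>p\<in>\<rat>. \<forall>q\<in>\<rat>. p * (a1 + a2) + q * (a2 + a3) = 0 \<longrightarrow> p = 0 \<and> q = 0) \<and>
    a1 + a2 + a3 \<notin> {(a1 + a2) * of_int m + (a2 + a3) * of_int n | m n. True}"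


section \<open>Substitutions\<close>

text \<open>Preservation of the empty word follows by cancellation.\<close>

definition substitution :: "('a list \<Rightarrow> 'a list) \<Rightarrow> bool" where
  "substitution \<phi> \<longleftrightarrow> (\<forall>v w. \<phi> (v @ w) = \<phi> v @ \<phi> w)"

definition primitive_substitution :: "('a list \<Rightarrow> 'a list) \<Rightarrow> bool" where
  "primitive_substitution \<phi> \<longleftrightarrow>
    substitution \<phi> \<and> (\<exists>n. \<forall>a b. b \<in> set ((\<phi> ^^ n) [a]))"

text \<open>The position at which the block \<open>\<phi> (u\<^sub>n)\<close> starts in
  \<open>\<cdots> \<phi> (u\<^sub>-\<^sub>2) \<phi> (u\<^sub>-\<^sub>1) | \<phi> (u\<^sub>0) \<phi> (u\<^sub>1) \<cdots>\<close>.\<close>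

definition block_start :: "('a list \<Rightarrow> 'a list) \<Rightarrow> (int \<Rightarrow> 'a) \<Rightarrow> int \<Rightarrow> int" where
  "block_start \<phi> u n =
    (if n \<ge> 0 then int (length (\<phi> (map u [0..n - 1])))
     else - int (length (\<phi> (map u [n..-1]))))"

text \<open>\<open>v = \<phi> (u)\<close> as pointed words: every position of \<open>v\<close> lies in one of the blocks
  \<open>\<phi> (u\<^sub>n)\<close> and carries the letter found there. As the blocks are disjoint, \<open>v\<close> is
  uniquely determined. (If \<open>\<phi>\<close> erases letters in such a way that the concatenation is not
  infinite in both directions, there is no such \<open>v\<close>.)\<close>

definition substitution_image ::
    "('a list \<Rightarrow> 'a list) \<Rightarrow> (int \<Rightarrow> 'a) \<Rightarrow> (int \<Rightarrow> 'a) \<Rightarrow> bool" where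
  "substitution_image \<phi> u v \<longleftrightarrow>
    (\<forall>m. \<exists>n j. j < length (\<phi> [u n]) \<and> m = block_start \<phi> u n + int j \<and> v m = \<phi> [u n] ! j)"

definition invariant_under :: "('a list \<Rightarrow> 'a list) \<Rightarrow> (int \<Rightarrow> 'a) \<Rightarrow> bool" where
  "invariant_under \<phi> u \<longleftrightarrow> substitution_image \<phi> u u"


section \<open>Quadratic irrationals and Sturm numbers\<close>

definition quadratic_irrational :: "real \<Rightarrow> bool" where
  "quadratic_irrational e \<longleftrightarrow>
    e \<notin> \<rat> \<and> (\<exists>p :: rat poly. degree p = 2 \<and> poly (map_poly of_rat p) e = 0)"

text \<open>The other root of the minimal polynomial: a rational polynomial of degree 2 vanishing
  at the irrational \<open>e\<close> is a multiple of the minimal polynomial of \<open>e\<close>.\<close>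

definition algebraic_conjugate :: "real \<Rightarrow> real" where
  "algebraic_conjugate e =
    (THE y. y \<noteq> e \<and> (\<exists>p :: rat poly. degree p = 2 \<and>
      poly (map_poly of_rat p) e = 0 \<and> poly (map_poly of_rat p) y = 0))"

definition sturm_number :: "real \<Rightarrow> bool" where
  "sturm_number e \<longleftrightarrow>
    quadratic_irrational e \<and> e \<in> {0<..<1} \<and> algebraic_conjugate e \<notin> {0<..<1}"

definition real_subfield :: "real set \<Rightarrow> bool" where
  "real_subfield K \<longleftrightarrow> 1 \<in> K \<and>
    (\<forall>x\<in>K. \<forall>y\<in>K. x - y \<in> K \<and> x * y \<in> K) \<and> (\<forall>x\<in>K. inverse x \<in> K)"

definition rat_adjoin :: "real \<Rightarrow> real set" where
  "rat_adjoin e = \<Inter>{K. real_subfield K \<and> e \<in> K}"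

definition field_automorphism_on :: "real set \<Rightarrow> (real \<Rightarrow> real) \<Rightarrow> bool" where
  "field_automorphism_on K \<sigma> \<longleftrightarrow> bij_betw \<sigma> K K \<and>
    (\<forall>x\<in>K. \<forall>y\<in>K. \<sigma> (x + y) = \<sigma> x + \<sigma> y \<and> \<sigma> (x * y) = \<sigma> x * \<sigma> y)"

text \<open>The value at \<open>x\<close> of the non-trivial automorphism of \<open>\<rat>(e)\<close>; meaningful for a quadratic
  irrational \<open>e\<close> and \<open>x \<in> \<rat>(e)\<close>, see \<open>galois_conjugate_eq\<close> below.\<close>

definition galois_conjugate :: "real \<Rightarrow> real \<Rightarrow> real" where
  "galois_conjugate e x =
    (THE y. \<exists>\<sigma>. field_automorphism_on (rat_adjoin e) \<sigma> \<and>
      (\<exists>z\<in>rat_adjoin e. \<sigma> z \<noteq> z) \<and> y = \<sigma> x)"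


subsection \<open>Well-definedness of the conjugates\<close>

lemma quadratic_irrational_eq:
  assumes "e \<notin> \<rat>" and "degree (p :: rat poly) = 2" and "poly (map_poly of_rat p) e = 0"
  obtains s t :: real where "s \<in> \<rat>" "t \<in> \<rat>" "e\<^sup>2 = s * e + t"
    "\<And>y. poly (map_poly of_rat p) y = 0 \<longleftrightarrow> y\<^sup>2 = s * y + t"
proof -
  define a b c where "a = coeff p 2" and "b = coeff p 1" and "c = coeff p 0"
  have "a \<noteq> 0"
    using assms(2) unfolding a_def by (metis leading_coeff_0_iff degree_0 zero_neq_numeral)
  have poly: "poly (map_poly of_rat p) y = of_rat a * y\<^sup>2 + of_rat b * y + of_rat c" for y :: real
  proof -
    have "poly (map_poly of_rat p) y = (\<Sum>i\<le>2. of_rat (coeff p i) * y ^ i)"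
      using assms(2) by (simp add: poly_altdef degree_map_poly coeff_map_poly)
    then show ?thesis
      by (simp add: a_def b_def c_def numeral_2_eq_2 algebra_simps)
  qed
  have iff: "poly (map_poly of_rat p) y = 0 \<longleftrightarrow> y\<^sup>2 = of_rat (- b / a) * y + of_rat (- c / a)" for y :: real
    unfolding poly using \<open>a \<noteq> 0\<close>
    by (auto simp: of_rat_divide of_rat_minus field_simps)
  show thesis
    by (rule that[of "of_rat (- b / a)" "of_rat (- c / a)"]) (use iff assms(3) in auto)
qed

lemma rat_lin_unique:
  fixes e :: real
  assumes "e \<notin> \<rat>" "a \<in> \<rat>" "b \<in> \<rat>" "c \<in> \<rat>" "d \<in> \<rat>" "a + b * e = c + d * e"
  shows "a = c \<and> b = d"
proof -
  have "b = d"
  proof (rule ccontr)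
    assume "b \<noteq> d"
    then have "e = (c - a) / (b - d)" using assms(6) by (simp add: field_simps)
    then show False using assms by auto
  qed
  then show ?thesis using assms(6) by simp
qed

lemma algebraic_conjugate_eq:
  assumes "e \<notin> \<rat>" "s \<in> \<rat>" "t \<in> \<rat>" "e\<^sup>2 = s * e + t"
  shows "algebraic_conjugate e = s - e"
  unfolding algebraic_conjugate_def
proof (rule the_equality)
  obtain s' t' where st: "s = of_rat s'" "t = of_rat t'"
    using assms(2,3) by (auto elim!: Rats_cases)
  have "s - e \<noteq> e"
  proof
    assume "s - e = e"
    then have "e = s / 2" by simp
    moreover have "s / 2 \<in> \<rat>" using assms(2) by simp
    ultimately show False using assms(1) by metis
  qed
  moreover have "poly (map_poly of_rat [:- t', - s', 1:]) e = 0"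
    "poly (map_poly of_rat [:- t', - s', 1:]) (s - e) = 0"
    using assms(4)
    by (simp_all add: map_poly_pCons st of_rat_minus power2_eq_square algebra_simps)
  ultimately show "s - e \<noteq> e \<and> (\<exists>p :: rat poly. degree p = 2 \<and>
      poly (map_poly of_rat p) e = 0 \<and> poly (map_poly of_rat p) (s - e) = 0)"
    by (intro conjI exI[of _ "[:- t', - s', 1:]"]) auto
next
  fix y assume y: "y \<noteq> e \<and> (\<exists>p :: rat poly. degree p = 2 \<and>
      poly (map_poly of_rat p) e = 0 \<and> poly (map_poly of_rat p) y = 0)"
  then obtain p :: "rat poly" where p: "degree p = 2" "poly (map_poly of_rat p) e = 0"
    "poly (map_poly of_rat p) y = 0" by blast
  obtain s' t' where q: "s' \<in> \<rat>" "t' \<in> \<rat>" "e\<^sup>2 = s' * e + t'"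
    "y\<^sup>2 = s' * y + t'"
    using quadratic_irrational_eq[OF assms(1) p(1,2)] p(3) by metis
  have "s' = s" "t' = t"
    using rat_lin_unique[of e t s t' s'] assms q by (auto simp: algebra_simps)
  then have "(y - e) * (y + e - s) = 0"
    using q(4) assms(4) by (simp add: power2_eq_square algebra_simps)
  then show "y = s - e" using y by auto
qed

lemma rat_adjoin_eq:
  assumes "e \<notin> \<rat>" "s \<in> \<rat>" "t \<in> \<rat>" "e\<^sup>2 = s * e + t"
  shows "rat_adjoin e = {a + b * e | a b. a \<in> \<rat> \<and> b \<in> \<rat>}" (is "_ = ?F")
proof
  have mem: "a + b * e \<in> ?F" if "a \<in> \<rat>" "b \<in> \<rat>" for a b using that by blast
  have "real_subfield ?F"
    unfolding real_subfield_def
  proof (intro conjI ballI)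
    show "1 \<in> ?F" using mem[of 1 0] by simp
  next
    fix x y assume "x \<in> ?F" "y \<in> ?F"
    then obtain a b c d where *: "x = a + b * e" "y = c + d * e"
      "a \<in> \<rat>" "b \<in> \<rat>" "c \<in> \<rat>" "d \<in> \<rat>" by blast
    show "x - y \<in> ?F" using mem[of "a - c" "b - d"] * by (simp add: algebra_simps)
    have "x * y = (a * c + b * d * t) + (a * d + b * c + b * d * s) * e"
    proof -
      have "x * y = a * c + (a * d + b * c) * e + b * d * e\<^sup>2"
        by (simp add: * power2_eq_square algebra_simps)
      then show ?thesis unfolding assms(4) by (simp add: algebra_simps)
    qed
    then show "x * y \<in> ?F" using mem[of "a * c + b * d * t" "a * d + b * c + b * d * s"] * assms by simp
  next
    fix x assume "x \<in> ?F"
    then obtain a b where *: "x = a + b * e" "a \<in> \<rat>" "b \<in> \<rat>" by blast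
    show "inverse x \<in> ?F"
    proof (cases "x = 0")
      case True then show ?thesis using mem[of 0 0] by simp
    next
      case False
      define y where "y = (a + b * s) + (- b) * e"
      define N where "N = a * a + a * b * s - b * b * t"
      have "x * y = a * a + a * b * s + b * b * s * e - b * b * e\<^sup>2"
        by (simp add: * y_def power2_eq_square algebra_simps)
      then have xy: "x * y = N" unfolding assms(4) by (simp add: N_def algebra_simps)
      have "y \<noteq> 0"
      proof
        assume "y = 0"
        then have "(a + b * s) + (- b) * e = 0 + 0 * e" by (simp add: y_def)
        from rat_lin_unique[OF assms(1) _ _ _ _ this] have "a = 0" "b = 0" using * assms by auto
        then show False using * False by simp
      qed
      then have "N \<noteq> 0" using xy False by auto
      then have "inverse x = y / N" using xy False by (simp add: field_simps)
      also have "\<dots> = (a + b * s) / N + (- b / N) * e" by (simp add: y_def add_divide_distrib diff_divide_distrib)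
      finally show ?thesis using mem[of "(a + b * s) / N" "- b / N"] * assms by (simp add: N_def)
    qed
  qed
  moreover have "e \<in> ?F" using mem[of 0 1] by simp
  ultimately show "rat_adjoin e \<subseteq> ?F" unfolding rat_adjoin_def by blast
next
  show "?F \<subseteq> rat_adjoin e"
    unfolding rat_adjoin_def
  proof (intro subsetI InterI)
    fix x K assume "x \<in> ?F" and "K \<in> {K. real_subfield K \<and> e \<in> K}"
    then obtain a b where *: "x = a + b * e" "a \<in> \<rat>" "b \<in> \<rat>" and K: "real_subfield K" "e \<in> K" by blast
    have one: "1 \<in> K" and diff: "\<And>x y. x \<in> K \<Longrightarrow> y \<in> K \<Longrightarrow> x - y \<in> K"
      and mult: "\<And>x y. x \<in> K \<Longrightarrow> y \<in> K \<Longrightarrow> x * y \<in> K"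
      and inv: "\<And>x. x \<in> K \<Longrightarrow> inverse x \<in> K"
      using K by (auto simp: real_subfield_def)
    have zero: "0 \<in> K" using diff[OF one one] by simp
    have add: "x + y \<in> K" if "x \<in> K" "y \<in> K" for x y
      using diff[OF that(1) diff[OF zero that(2)]] by simp
    have nat: "of_nat n \<in> K" for n by (induction n) (auto intro: zero one add)
    have int: "of_int n \<in> K" for n
      using nat[of "nat n"] diff[OF zero nat[of "nat (- n)"]] by (cases "n \<ge> 0") auto
    have rat: "q \<in> K" if "q \<in> \<rat>" for q
    proof -
      from that obtain i j :: int where "q = of_int i / of_int j" by (auto elim: Rats_cases')
      then show ?thesis using mult[OF int inv[OF int], of i j] by (simp add: divide_inverse)
    qed
    show "x \<in> K" using * rat add mult K(2) by simp
  qed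
qed

lemma field_automorphism_rat:
  assumes "field_automorphism_on K \<sigma>" "\<rat> \<subseteq> K" "q \<in> \<rat>"
  shows "\<sigma> q = q"
proof -
  have inj: "inj_on \<sigma> K" using assms(1) by (auto simp: field_automorphism_on_def bij_betw_def)
  have add: "\<sigma> (x + y) = \<sigma> x + \<sigma> y" and mult: "\<sigma> (x * y) = \<sigma> x * \<sigma> y"
    if "x \<in> \<rat>" "y \<in> \<rat>" for x y
    using assms(1,2) that by (auto simp: field_automorphism_on_def)
  have 0: "\<sigma> 0 = 0" using add[of 0 0] by simp
  have "\<sigma> 1 \<noteq> 0" using inj_onD[OF inj, of 1 0] 0 subsetD[OF assms(2), of 0] subsetD[OF assms(2), of 1] by auto
  then have 1: "\<sigma> 1 = 1" using mult[of 1 1] by simp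
  have nat: "\<sigma> (of_nat n) = of_nat n" for n
    by (induction n) (auto simp: 0 1 add)
  have int: "\<sigma> (of_int n) = of_int n" for n
  proof (cases "n \<ge> 0")
    case True then show ?thesis using nat[of "nat n"] by simp
  next
    case False
    then show ?thesis using add[of "of_int n" "of_nat (nat (- n))"] nat[of "nat (- n)"] 0 by simp
  qed
  obtain i j :: int where ij: "j > 0" "q = of_int i / of_int j"
    using assms(3) by (auto elim: Rats_cases')
  then have "\<sigma> q * of_int j = of_int i" using mult[of q "of_int j"] int assms(3) by simp
  then have "\<sigma> q = of_int i / of_int j" using ij(1) by (simp add: field_simps)
  then show ?thesis using ij(2) by simp
qed

lemma galois_conjugate_lin:
  assumes e: "e \<notin> \<rat>" "s \<in> \<rat>" "t \<in> \<rat>" "e\<^sup>2 = s * e + t" and ab: "a \<in> \<rat>" "b \<in> \<rat>"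
  shows "galois_conjugate e (a + b * e) = a + b * (s - e)"
  unfolding galois_conjugate_def
proof (rule the_equality)
  note Q = rat_adjoin_eq[OF e]
  define \<sigma> where "\<sigma> x = (THE y. \<exists>a b. a \<in> \<rat> \<and> b \<in> \<rat> \<and> x = a + b * e \<and> y = a + b * (s - e))" for x
  have \<sigma>: "\<sigma> (a + b * e) = a + b * (s - e)" if "a \<in> \<rat>" "b \<in> \<rat>" for a b
    unfolding \<sigma>_def
    by (rule the_equality) (use that rat_lin_unique[OF e(1)] in blast)+
  have \<sigma>': "\<sigma> x = a + b * (s - e)" if "x = a + b * e" "a \<in> \<rat>" "b \<in> \<rat>" for x a b
    using \<sigma> that by blast
  have closed: "\<sigma> x \<in> rat_adjoin e \<and> \<sigma> (\<sigma> x) = x" if x: "x \<in> rat_adjoin e" for x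
  proof -
    from x obtain a b where *: "x = a + b * e" "a \<in> \<rat>" "b \<in> \<rat>" unfolding Q by blast
    have eq: "\<sigma> x = (a + b * s) + (- b) * e" using \<sigma>'[OF *] by (simp add: algebra_simps)
    have r: "a + b * s \<in> \<rat>" "- b \<in> \<rat>" using * e by auto
    have "\<sigma> x \<in> rat_adjoin e" unfolding Q using eq r by blast
    moreover have "\<sigma> (\<sigma> x) = x" using \<sigma>'[OF eq r] *(1) by (simp add: algebra_simps)
    ultimately show ?thesis ..
  qed
  have "field_automorphism_on (rat_adjoin e) \<sigma>"
    unfolding field_automorphism_on_def
  proof (intro conjI ballI)
    show "bij_betw \<sigma> (rat_adjoin e) (rat_adjoin e)"
      by (rule bij_betw_byWitness[of _ \<sigma>]) (use closed in auto)
  next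
    fix x y assume "x \<in> rat_adjoin e" "y \<in> rat_adjoin e"
    then obtain a b c d where *: "x = a + b * e" "y = c + d * e"
      "a \<in> \<rat>" "b \<in> \<rat>" "c \<in> \<rat>" "d \<in> \<rat>" unfolding Q by blast
    show "\<sigma> (x + y) = \<sigma> x + \<sigma> y"
      using \<sigma>'[of "x + y" "a + c" "b + d"] \<sigma>[of a b] \<sigma>[of c d] * by (simp add: algebra_simps)
    have "x * y = a * c + (a * d + b * c) * e + b * d * e\<^sup>2"
      by (simp add: * power2_eq_square algebra_simps)
    then have xy: "x * y = (a * c + b * d * t) + (a * d + b * c + b * d * s) * e"
      unfolding e(4) by (simp add: algebra_simps)
    have "\<sigma> (x * y) = (a * c + b * d * t) + (a * d + b * c + b * d * s) * (s - e)"
      by (rule \<sigma>'[OF xy]) (use * e in auto)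
    moreover have "\<sigma> x * \<sigma> y = a * c + (a * d + b * c) * (s - e) + b * d * (s - e)\<^sup>2"
      unfolding *(1,2) \<sigma>[OF *(3,4)] \<sigma>[OF *(5,6)] by (simp add: power2_eq_square algebra_simps)
    moreover have "(s - e)\<^sup>2 = s * (s - e) + t"
      using e(4) by (simp add: power2_eq_square algebra_simps)
    ultimately show "\<sigma> (x * y) = \<sigma> x * \<sigma> y" by (simp add: algebra_simps)
  qed
  moreover have "e \<in> rat_adjoin e" "\<sigma> e \<noteq> e"
  proof -
    show "e \<in> rat_adjoin e" unfolding rat_adjoin_def by blast
    have "\<sigma> e = s - e" using \<sigma>[of 0 1] by simp
    moreover have "s - e \<noteq> e"
    proof
      assume "s - e = e"
      then have "e = s / 2" by simp
    moreover have "s / 2 \<in> \<rat>" using e(2) by simp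
    ultimately show False using e(1) by metis
    qed
    ultimately show "\<sigma> e \<noteq> e" by simp
  qed
  moreover have "a + b * (s - e) = \<sigma> (a + b * e)" using \<sigma> ab by simp
  ultimately show "\<exists>\<sigma>. field_automorphism_on (rat_adjoin e) \<sigma> \<and>
      (\<exists>z\<in>rat_adjoin e. \<sigma> z \<noteq> z) \<and> a + b * (s - e) = \<sigma> (a + b * e)" by blast
next
  note Q = rat_adjoin_eq[OF e]
  fix y assume "\<exists>\<sigma>. field_automorphism_on (rat_adjoin e) \<sigma> \<and>
      (\<exists>z\<in>rat_adjoin e. \<sigma> z \<noteq> z) \<and> y = \<sigma> (a + b * e)"
  then obtain \<sigma> z where \<sigma>: "field_automorphism_on (rat_adjoin e) \<sigma>"
    and z: "z \<in> rat_adjoin e" "\<sigma> z \<noteq> z" and y: "y = \<sigma> (a + b * e)" by blast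
  have sub: "\<rat> \<subseteq> rat_adjoin e"
  proof
    fix q :: real assume "q \<in> \<rat>"
    then have "q = q + 0 * e \<and> q \<in> \<rat> \<and> (0::real) \<in> \<rat>" by simp
    then show "q \<in> rat_adjoin e" unfolding Q by blast
  qed
  have eQ: "e \<in> rat_adjoin e" unfolding rat_adjoin_def by blast
  have add: "\<sigma> (x + y) = \<sigma> x + \<sigma> y" and mult: "\<sigma> (x * y) = \<sigma> x * \<sigma> y"
    if "x \<in> rat_adjoin e" "y \<in> rat_adjoin e" for x y
    using \<sigma> that by (auto simp: field_automorphism_on_def)
  note rat = field_automorphism_rat[OF \<sigma> sub]
  have lin: "\<sigma> (a + b * e) = a + b * \<sigma> e" if "a \<in> \<rat>" "b \<in> \<rat>" for a b
  proof -
    have "b * e \<in> rat_adjoin e"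
    proof -
      have "b * e = 0 + b * e \<and> (0::real) \<in> \<rat> \<and> b \<in> \<rat>" using that by simp
      then show ?thesis unfolding Q by blast
    qed
    then show ?thesis using add[of a "b * e"] mult[of b e] rat[OF that(1)] rat[OF that(2)] eQ subsetD[OF sub that(1)] subsetD[OF sub that(2)] by simp
  qed
  have "\<sigma> e \<noteq> e"
  proof
    assume "\<sigma> e = e"
    then show False using lin z unfolding Q by auto
  qed
  moreover have "\<sigma> e * \<sigma> e = t + s * \<sigma> e"
    using mult[OF eQ eQ] lin[OF e(3,2)] e(4) by (simp add: power2_eq_square add.commute)
  then have "(\<sigma> e - e) * (\<sigma> e + e - s) = 0"
    using e(4) by (simp add: power2_eq_square algebra_simps)
  ultimately have "\<sigma> e = s - e" by auto
  then show "y = a + b * (s - e)" using y lin[OF ab] by simp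
qed

theorem galois_conjugate_eq:
  assumes "quadratic_irrational e"
  shows "rat_adjoin e = {a + b * e | a b. a \<in> \<rat> \<and> b \<in> \<rat>}"
    and "\<And>a b. a \<in> \<rat> \<Longrightarrow> b \<in> \<rat> \<Longrightarrow>
      galois_conjugate e (a + b * e) = a + b * algebraic_conjugate e"
    and "galois_conjugate e e = algebraic_conjugate e"
    and "algebraic_conjugate e \<noteq> e"
proof -
  obtain s t where e: "e \<notin> \<rat>" "s \<in> \<rat>" "t \<in> \<rat>" "e\<^sup>2 = s * e + t"
    using assms unfolding quadratic_irrational_def by (metis quadratic_irrational_eq)
  note c = algebraic_conjugate_eq[OF e]
  show "rat_adjoin e = {a + b * e | a b. a \<in> \<rat> \<and> b \<in> \<rat>}" by (rule rat_adjoin_eq[OF e])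
  show *: "galois_conjugate e (a + b * e) = a + b * algebraic_conjugate e"
    if "a \<in> \<rat>" "b \<in> \<rat>" for a b
    using galois_conjugate_lin[OF e that] c by simp
  show "galois_conjugate e e = algebraic_conjugate e" using *[of 0 1] by simp
  show "algebraic_conjugate e \<noteq> e"
  proof
    assume "algebraic_conjugate e = e"
    then have "s - e = e" using c by simp
    then have "e = s / 2" by simp
    moreover have "s / 2 \<in> \<rat>" using e(2) by simp
    ultimately show False using e(1) by metis
  qed
qed

end

theory Submission
  imports Defs "HOL-Analysis.Kronecker_Approximation_Theorem"
begin

text \<open>All points of an orbit differ by elements of the module \<open>M = \<int> (1 - \<epsilon>) + \<int> \<epsilon>\<close>, and the orbit of
  \<open>x0\<close> is the whole of \<open>(x0 + M) \<inter> [0, l)\<close>, listed in the order of any linear form on \<open>M\<close> that is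
  positive on \<open>1 - \<epsilon>\<close> and \<open>- \<epsilon>\<close>. Up to sign the Galois conjugation is such a form precisely when
  \<open>\<epsilon>'\<close> lies outside \<open>[0, 1]\<close>.

  If the word is invariant, the positions of the blocks are again given by points of the orbit, and
  the map from \<open>x n\<close> to the point at the start of the \<open>n\<close>-th block is an affine contraction
  \<open>h y = x0 + \<kappa> (y - x0)\<close> with \<open>\<kappa> M \<subseteq> M\<close>. Both eigenvalues of \<open>\<kappa>\<close> on \<open>M\<close> are read off a non-negative
  integer matrix, which makes \<open>\<epsilon>\<close> a Sturm number; since the discontinuities must be end points of
  translates of the contracted intervals, \<open>x0\<close> and \<open>l\<close> lie in \<open>\<rat>(\<epsilon>)\<close>. Conversely, for a suitable unit
  \<open>\<kappa>\<close> the contraction \<open>h\<close> maps the orbit into itself, and it defines a substitution if and only if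
  no end point \<open>b \<in> {0, l}\<close> is met inside the block of an inner point of one of the three intervals.
  On the conjugate side, with \<open>f\<close> the conjugation up to sign, this says that \<open>(1 - 1 / \<kappa>') f (x0 - b)\<close>
  lies between the values of \<open>f\<close> at the neighbours of \<open>b\<close> in the order of its orbit, relative to
  \<open>b\<close>; letting \<open>\<kappa>'\<close> tend to infinity gives the third condition.\<close>

text \<open>The exchange is the first return to \<open>[0, l)\<close> of the rotation by
  \<open>- e\<close> on a circle of length 1: letters 1 and 3 are one rotation step, letter 2 is
  two, with its middle point in \<open>[l, 1)\<close>. So \<open>P + Q\<close> is elapsed rotation
  time, and a displacement determines its place in the orbit. The bounds in the third condition are
  conjugates of neighbours: in its orbit 0 stands between \<epsilon> and 1 - \<epsilon>, whose
  conjugates are \<epsilon>' and 1 - \<epsilon>'. Relative to l, the left-limit neighbours of l are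
  -(1 - \<epsilon>) and -\<epsilon>, which gives the same two bounds for the conjugate of l minus
  the base point. A contraction coming from a substitution may have negative ratio and may exchange
  the classes of 0 and l modulo M. Each defect disappears on squaring, hence the passage to the
  fourth iterate. For the converse the unit has norm 1, so that 1 - 1 / \<kappa> has conjugate 1 -
  \<kappa> in (0, 1): it shrinks towards 0, which lies between the bounds, so the closed
  inequalities suffice. A large conjugate makes all blocks long enough for primitivity.\<close>

text \<open>The letter 2 moves by the sum of the translations of the letters 1 and 3, so displacements are
  counted in the steps of 1 and 3 only.\<close>

fun step1 :: "letter \<Rightarrow> int" where "step1 L1 = 1" | "step1 L2 = 1" | "step1 L3 = 0"
fun step3 :: "letter \<Rightarrow> int" where "step3 L1 = 0" | "step3 L2 = 1" | "step3 L3 = 1"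

lemma step_nonneg [simp]: "step1 i \<ge> 0" "step3 i \<ge> 0" "step1 i + step3 i \<ge> 1" "step1 i + step3 i \<le> 2"
  by (cases i; simp)+

lemma step_inject: "step1 i = step1 j \<Longrightarrow> step3 i = step3 j \<Longrightarrow> i = j"
  by (cases i; cases j; simp)

section \<open>Two-sided integer sequences: induction, summation, bracketing\<close>

lemma int_shift_induct [case_names zero up down]:
  fixes P :: "int \<Rightarrow> bool"
  assumes "P 0" "\<And>n. P n \<Longrightarrow> P (n + 1)" "\<And>n. P (n + 1) \<Longrightarrow> P n"
  shows "P n"
proof (induction n rule: int_induct[where k = 0])
  case (step2 i)
  then show ?case using assms(3)[of "i - 1"] by simp
qed (use assms in auto)

lemma int_antidifference:
  fixes f :: "int \<Rightarrow> int"
  obtains F where "F 0 = 0" "\<And>n. F (n + 1) = F n + f n"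
proof -
  let ?F = "\<lambda>n. if n \<ge> 0 then \<Sum>k\<in>{0..<n}. f k else - (\<Sum>k\<in>{n..<0}. f k)"
  have 0: "?F 0 = 0" by simp
  have succ: "?F (n + 1) = ?F n + f n" for n
  proof (cases "n \<ge> 0")
    case True
    then have "{0..<n + 1} = insert n {0..<n}" by auto
    then show ?thesis using True by simp
  next
    case False
    then have "{n..<0} = insert n {n + 1..<0}" by auto
    then show ?thesis using False by (cases "n = -1") auto
  qed
  show thesis by (rule that[OF 0 succ])
qed

lemma increments_lower_bound:
  fixes f :: "int \<Rightarrow> real"
  assumes "\<And>n. f (n + 1) \<ge> f n + d" "n \<le> k"
  shows "f k \<ge> f n + d * of_int (k - n)"
  using assms(2)
proof (induction k rule: int_ge_induct)
  case (step i)
  then show ?case using assms(1)[of i] by (simp add: algebra_simps)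
qed simp

lemma increasing_sequence_bracket:
  fixes f :: "int \<Rightarrow> real"
  assumes "d > 0" and inc: "\<And>n. f (n + 1) \<ge> f n + d"
  obtains k where "f k \<le> r" "r < f (k + 1)"
proof -
  define N where "N = \<lceil>\<bar>r - f 0\<bar> / d\<rceil> + 1"
  have "\<bar>r - f 0\<bar> / d < of_int N" unfolding N_def by linarith
  then have N: "\<bar>r - f 0\<bar> < d * of_int N" using \<open>d > 0\<close> by (simp add: field_simps)
  have "N \<ge> 0" unfolding N_def using \<open>d > 0\<close> by (smt (verit) abs_ge_zero divide_nonneg_pos zero_le_ceiling)
  have hi: "f N > r" using increments_lower_bound[of f d, OF inc, of 0 N] N \<open>N \<ge> 0\<close> by simp
  have lo: "f (-N) \<le> r" using increments_lower_bound[of f d, OF inc, of "-N" 0] N \<open>N \<ge> 0\<close> by simp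
  have "\<exists>k. f k \<le> r \<and> r < f (k + 1)" 
  proof (rule ccontr)
    assume none: "\<not> ?thesis"
    have "f k \<le> r" if "-N \<le> k" for k
      using that
    proof (induction k rule: int_ge_induct)
      case base show ?case by (rule lo)
    next
      case (step i)
      then show ?case using none by (meson not_le)
    qed
    from this[of N] hi \<open>N \<ge> 0\<close> show False by simp
  qed
  then show thesis using that by blast
qed

lemma strict_mono_int_bracket:
  fixes f :: "int \<Rightarrow> int"
  assumes "strict_mono f"
  obtains k where "f k \<le> r" "r < f (k + 1)"
proof -
  have "f n + 1 \<le> f (n + 1)" for n using strict_monoD[OF assms, of n "n + 1"] by simp
  then have "real_of_int (f n) + 1 \<le> of_int (f (n + 1))" for n
    by (metis of_int_1 of_int_add of_int_le_iff)
  from increasing_sequence_bracket[of 1 "\<lambda>n. of_int (f n)" "of_int r", OF _ this] that show thesis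
    by auto
qed

text \<open>Serves the perturbation arguments: a deviation below \<open>d\<close> cannot turn one of
  finitely many nonzero test values into 0 or change its sign, and a test value smaller than
  \<open>d\<close> must vanish.\<close>

lemma finite_reals_separated:
  fixes S :: "real set"
  assumes "finite S"
  obtains d where "d > 0" "\<And>x. x \<in> S \<Longrightarrow> x \<noteq> 0 \<Longrightarrow> \<bar>x\<bar> \<ge> d"
proof (rule that)
  let ?T = "insert 1 (abs ` (S - {0}))"
  have "finite ?T" using assms by simp
  then show "Min ?T > 0" by (subst Min_gr_iff) auto
  show "\<bar>x\<bar> \<ge> Min ?T" if "x \<in> S" "x \<noteq> 0" for x
    using \<open>finite ?T\<close> that by (intro Min_le) auto
qed

section \<open>Orbits of the normalised exchange\<close>

text \<open>Scaled so that \<open>\<alpha>1 + 2 * \<alpha>2 + \<alpha>3 = 1\<close>, the lengths are \<open>\<alpha>1 = e + l - 1\<close>, \<open>\<alpha>2 = 1 - l\<close> and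
  \<open>\<alpha>3 = l - e\<close>.\<close>

locale iet3 =
  fixes e l :: real
  assumes e_pos: "0 < e" and e_less_1: "e < 1"
    and l_less_1: "l < 1" and e_less_l: "e < l" and one_minus_e_less_l: "1 - e < l"
    and irrational: "e \<notin> \<rat>"
    and l_generic: "\<And>i j :: int. l \<noteq> of_int i + of_int j * e"
begin

definition d1 :: real where "d1 = e + l - 1"

definition val :: "int \<Rightarrow> int \<Rightarrow> real" where
  "val P Q = of_int P * (1 - e) - of_int Q * e"

fun J :: "letter \<Rightarrow> real set" where
  "J L1 = {0..<d1}" | "J L2 = {d1..<e}" | "J L3 = {e..<l}"

lemma d1_pos: "0 < d1" and d1_less_e: "d1 < e"
  using l_less_1 one_minus_e_less_l by (auto simp: d1_def)

lemma J_unique: "y \<in> J i \<Longrightarrow> y \<in> J j \<Longrightarrow> i = j"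
  using d1_less_e by (cases i; cases j) auto

lemma J_bounds: "y \<in> J i \<Longrightarrow> 0 \<le> y" "y \<in> J i \<Longrightarrow> y < l"
  using d1_less_e d1_pos e_less_l by (cases i; auto)+

lemma J_convex: "y \<in> J i \<Longrightarrow> z \<in> J i \<Longrightarrow> y \<le> w \<Longrightarrow> w \<le> z \<Longrightarrow> w \<in> J i"
  by (cases i) auto

lemma val_add: "val (P + P') (Q + Q') = val P Q + val P' Q'"
  and val_diff: "val (P - P') (Q - Q') = val P Q - val P' Q'"
  and val_mult: "val (k * P) (k * Q) = of_int k * val P Q"
  and val_0 [simp]: "val 0 0 = 0"
  by (simp_all add: val_def algebra_simps)

lemma val_eq: "val P Q = of_int P + of_int (- P - Q) * e"
  by (simp add: val_def algebra_simps)

lemma int_combination_eq_0: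
  assumes "of_int i + of_int j * e = 0" shows "i = 0 \<and> j = 0"
  using rat_lin_unique[OF irrational, of "of_int i" "of_int j" 0 0] assms by simp

lemma val_eq_0: "val P Q = 0 \<Longrightarrow> P = 0 \<and> Q = 0"
  using int_combination_eq_0[of P "- P - Q"] unfolding val_eq by auto

lemma val_inject: "val P Q = val P' Q' \<Longrightarrow> P = P' \<and> Q = Q'"
  using val_eq_0[of "P - P'" "Q - Q'"] unfolding val_diff by auto

end

text \<open>The base point is arbitrary, so the locale is also instantiated at the orbits through 0
  and \<open>d1\<close>, and everything proved about the given word is available for the singular
  points too. \<open>p\<close> and \<open>q\<close> are the coordinates of \<open>x n - x 0\<close>
  in the module.\<close>

locale iet3_orbit = iet3 +
  fixes x :: "int \<Rightarrow> real" and u :: "int \<Rightarrow> letter" and p q :: "int \<Rightarrow> int"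
  assumes p_0 [simp]: "p 0 = 0" and q_0 [simp]: "q 0 = 0"
    and p_succ: "\<And>n. p (n + 1) = p n + step1 (u n)"
    and q_succ: "\<And>n. q (n + 1) = q n + step3 (u n)"
    and x_eq: "\<And>n. x n = x 0 + val (p n) (q n)"
    and x_in: "\<And>n. x n \<in> J (u n)"
begin

lemma x_bounds: "0 \<le> x n" "x n < l"
  using J_bounds x_in by blast+

lemma x_diff: "x n - x k = val (p n - p k) (q n - q k)"
  using x_eq[of n] x_eq[of k] by (simp add: val_diff)

lemma x_succ: "x (n + 1) = x n + val (step1 (u n)) (step3 (u n))"
  using x_diff[of "n + 1" n] by (simp add: p_succ q_succ)

lemma u_eqI: "x n \<in> J i \<Longrightarrow> u n = i"
  using J_unique x_in by blast

lemma p_mono: "n \<le> k \<Longrightarrow> p n \<le> p k" and q_mono: "n \<le> k \<Longrightarrow> q n \<le> q k"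
  by (induction k rule: int_ge_induct) (auto simp: p_succ q_succ intro: order_trans)

lemma pq_increments:
  assumes "n \<le> k"
  shows "k - n \<le> (p k + q k) - (p n + q n)" "(p k + q k) - (p n + q n) \<le> 2 * (k - n)"
  using assms
proof (induction k rule: int_ge_induct)
  case (step i)
  case 1 then show ?case using step step_nonneg(3)[of "u i"] unfolding p_succ q_succ by linarith
  case 2
  have "2 * (i + 1 - n) = 2 * (i - n) + 2" by simp
  then show ?case using step step_nonneg(4)[of "u i"] unfolding p_succ q_succ by linarith
qed auto

lemma form_succ:
  fixes E1 E2 :: real assumes "E1 > 0" "E2 > 0"
  shows "E1 * p (n + 1) + E2 * q (n + 1) \<ge> E1 * p n + E2 * q n + min E1 E2"
  unfolding p_succ q_succ using assms by (cases "u n") (auto simp: distrib_left)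

text \<open>Neither coordinate ever decreases and each letter raises at least one of them, so every
  positive form sorts the orbit by time. This is what lets the conjugate form replace time
  throughout.\<close>

lemma form_strict_mono:
  fixes E1 E2 :: real assumes "E1 > 0" "E2 > 0"
  shows "E1 * p n + E2 * q n < E1 * p k + E2 * q k \<longleftrightarrow> n < k"
    and "E1 * p n + E2 * q n \<le> E1 * p k + E2 * q k \<longleftrightarrow> n \<le> k"
proof -
  have *: "E1 * p n + E2 * q n < E1 * p k + E2 * q k" if "n < k" for n k
  proof -
    have "0 < min E1 E2 * of_int (k - n)" using that assms by (intro mult_pos_pos) auto
    then show ?thesis
      using increments_lower_bound[of "\<lambda>n. E1 * p n + E2 * q n" "min E1 E2" n k, OF form_succ[OF assms]] that by simp
  qed
  show "E1 * p n + E2 * q n < E1 * p k + E2 * q k \<longleftrightarrow> n < k"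
    "E1 * p n + E2 * q n \<le> E1 * p k + E2 * q k \<longleftrightarrow> n \<le> k"
    using *[of n k] *[of k n] by (cases n k rule: linorder_cases; force)+
qed

lemma coordinates_inject: "p n = p k \<Longrightarrow> q n = q k \<Longrightarrow> n = k"
  using form_strict_mono(2)[of 1 1 n k] form_strict_mono(2)[of 1 1 k n] by simp

lemma x_inject: "x n = x k \<Longrightarrow> n = k"
  using val_eq_0[of "p n - p k" "q n - q k"] x_diff[of n k] coordinates_inject[of n k] by simp

text \<open>Choosing \<open>k\<close> by rotation time leaves a displacement with
  \<open>P' + Q'\<close> equal to 0 or 1. In the first case it is an integer translation, hence none
  as \<open>l < 1\<close>. The second happens only in the middle of a letter 2, where the point
  reached lies outside \<open>[0, l)\<close>.\<close>

lemma visits: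
  assumes "0 \<le> x n + val P Q" "x n + val P Q < l"
  obtains k where "p k = p n + P" "q k = q n + Q" "x k = x n + val P Q"
proof -
  define w where "w n = p n + q n" for n
  have "strict_mono w"
    by (rule strict_monoI) (use form_strict_mono(1)[of 1 1] in \<open>auto simp: w_def simp flip: of_int_add\<close>)
  then obtain k where k: "w k \<le> w n + P + Q" "w n + P + Q < w (k + 1)"
    using strict_mono_int_bracket[of w "w n + P + Q"] by (metis add.assoc)
  define P' Q' where "P' = p n + P - p k" and "Q' = q n + Q - q k"
  have eq: "x k + val P' Q' = x n + val P Q"
    using x_eq[of k] x_eq[of n] by (simp add: P'_def Q'_def val_add val_diff)
  have in01: "0 \<le> x k + val P' Q'" "x k + val P' Q' < l" using assms eq by auto
  have "0 \<le> P' + Q'" "P' + Q' < step1 (u k) + step3 (u k)"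
    using k by (auto simp: w_def P'_def Q'_def p_succ q_succ)
  then have "P' + Q' = 0 \<or> P' + Q' = 1 \<and> u k = L2"
    by (cases "u k") auto
  then consider "P' + Q' = 0" | "P' + Q' = 1" "u k = L2" by blast
  then have "P' = 0 \<and> Q' = 0"
  proof cases
    case 1
    then have "Q' = - P'" by simp
    then have "val P' Q' = of_int P'" by (simp add: val_def algebra_simps)
    then have "\<bar>real_of_int P'\<bar> < 1" using in01 x_bounds[of k] l_less_1 by auto
    then show ?thesis using \<open>Q' = - P'\<close> by auto
  next
    case 2
    then have "Q' = 1 - P'" by simp
    then have v: "val P' Q' = of_int P' - e" unfolding \<open>Q' = 1 - P'\<close> by (simp add: val_def algebra_simps)
    have xk: "d1 \<le> x k" "x k < e" using x_in[of k] 2 by auto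
    have "P' > 0"
    proof (rule ccontr)
      assume "\<not> P' > 0"
      then have "real_of_int P' \<le> 0" by simp
      then show False using v in01 xk by linarith
    qed
    then have "real_of_int P' \<ge> 1" by simp
    then show ?thesis using v in01(2) xk(1) by (auto simp: d1_def)
  qed
  then show thesis using that[of k] eq by (simp add: P'_def Q'_def)
qed

lemma same_displacement:
  assumes "\<And>i. i < j \<Longrightarrow> u (n + int i) = u (k + int i)"
  shows "p (n + int j) - p n = p (k + int j) - p k \<and> q (n + int j) - q n = q (k + int j) - q k"
  using assms
proof (induction j)
  case (Suc j)
  have "u (n + int j) = u (k + int j)" using Suc.prems by simp
  then show ?case using Suc p_succ[of "n + int j"] p_succ[of "k + int j"]
    q_succ[of "n + int j"] q_succ[of "k + int j"] by (simp add: algebra_simps)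
qed simp

lemma same_x_displacement:
  assumes "\<And>i. i < j \<Longrightarrow> u (n + int i) = u (k + int i)"
  shows "x (n + int j) - x n = x (k + int j) - x k"
  using same_displacement[OF assms] x_diff by simp

text \<open>The cut points are the discontinuities of the inverse exchange, which finds the images
  of the intervals in the order 3, 2, 1.\<close>

lemma u_pred:
  "u (n - 1) = (if x n < l - e then L3 else if x n < 1 - e then L2 else L1)"
proof -
  have "x n = x (n - 1) + val (step1 (u (n - 1))) (step3 (u (n - 1)))"
    using x_succ[of "n - 1"] by simp
  then show ?thesis using x_in[of "n - 1"] l_less_1 by (cases "u (n - 1)") (auto simp: val_def d1_def)
qed

section \<open>Density, uniform recurrence and cylinders\<close>

lemma close_points:
  assumes "\<eta> > 0"
  obtains n k where "n < k" "\<bar>x k - x n\<bar> < \<eta>"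
proof -
  define N where "N = \<lceil>1 / \<eta>\<rceil> + 1"
  have fl: "(\<lambda>n. \<lfloor>x n / \<eta>\<rfloor>) ` {0..N} \<subseteq> {0..<N}"
  proof (clarsimp)
    fix n
    have "x n / \<eta> < 1 / \<eta>" using x_bounds[of n] l_less_1 assms by (intro divide_strict_right_mono) auto
    then show "0 \<le> x n / \<eta> \<and> \<lfloor>x n / \<eta>\<rfloor> < N" unfolding N_def using x_bounds[of n] assms
      by (auto simp: floor_less_iff) linarith
  qed
  have "card {0..<N} < card {0..N}" if "N \<ge> 0" using that by simp
  moreover have "N \<ge> 0" unfolding N_def using assms by (smt (verit) divide_pos_pos zero_le_ceiling)
  ultimately have "\<not> inj_on (\<lambda>n. \<lfloor>x n / \<eta>\<rfloor>) {0..N}"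
    using card_inj_on_le[OF _ fl] by fastforce
  then obtain n k where nk: "n \<noteq> k" "\<lfloor>x n / \<eta>\<rfloor> = \<lfloor>x k / \<eta>\<rfloor>" unfolding inj_on_def by blast
  have "\<bar>x k / \<eta> - x n / \<eta>\<bar> < 1" using nk(2) by linarith
  then have "\<bar>(x k - x n) / \<eta>\<bar> < 1" by (simp add: diff_divide_distrib)
  then have "\<bar>x k - x n\<bar> < \<eta>" "\<bar>x n - x k\<bar> < \<eta>" using assms by (auto simp: abs_divide field_simps)
  then show thesis using nk(1) that[of n k] that[of k n] by (cases "n < k") auto
qed

text \<open>Pigeonhole yields a short displacement of uncontrolled sign. If it is negative, one
  Euclidean division of \<open>1 - e\<close> by its length produces a positive remainder no longer
  than it, and the coordinates stay non-negative.\<close>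

lemma small_pos:
  assumes "\<eta> > 0"
  obtains P Q where "P \<ge> 0" "Q \<ge> 0" "0 < val P Q" "val P Q < \<eta>"
proof -
  obtain n k where nk: "n < k" "\<bar>x k - x n\<bar> < \<eta>" using close_points[OF assms] .
  define P Q where "P = p k - p n" and "Q = q k - q n"
  have PQ: "P \<ge> 0" "Q \<ge> 0" using p_mono[of n k] q_mono[of n k] nk by (auto simp: P_def Q_def)
  have eq: "val P Q = x k - x n" unfolding P_def Q_def using x_diff by simp
  show thesis
  proof (cases "val P Q > 0")
    case True then show thesis using that[OF PQ] eq nk by simp
  next
    case False
    define v where "v = - val P Q"
    have "x k \<noteq> x n" using x_inject[of k n] nk(1) by auto
    then have v: "0 < v" "v < \<eta>" using False eq nk by (auto simp: v_def)
    \<comment> \<open>Ceiling minus one, rather than floor: the largest integer with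
      \<open>k * v\<close> strictly below \<open>1 - e\<close>, so that the remainder cannot be
      0.\<close>
    define k where "k = \<lceil>(1 - e) / v\<rceil> - 1"
    have "of_int k < (1 - e) / v" "(1 - e) / v \<le> of_int k + 1" unfolding k_def by linarith+
    then have k: "of_int k * v < 1 - e" "1 - e \<le> of_int k * v + v"
      using v by (auto simp: field_simps)
    have "k \<ge> 0" unfolding k_def using v e_less_1
      by (smt (verit) divide_pos_pos zero_less_ceiling)
    have "val (1 + k * P) (0 + k * Q) = 1 - e - of_int k * v"
      unfolding val_add val_mult v_def by (simp add: val_def[of 1] val_def[of 0])
    then show thesis
      using that[of "1 + k * P" "0 + k * Q"] k v \<open>k \<ge> 0\<close> PQ by simp
  qed
qed

lemma small_neg:
  assumes "\<eta> > 0"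
  obtains P Q where "P \<ge> 0" "Q \<ge> 0" "val P Q < 0" "- \<eta> < val P Q"
proof -
  obtain P Q where PQ: "P \<ge> 0" "Q \<ge> 0" "0 < val P Q" "val P Q < \<eta>" using small_pos[OF assms] .
  define v where "v = val P Q"
  have v: "0 < v" "v < \<eta>" using PQ by (auto simp: v_def)
  define k where "k = \<lceil>e / v\<rceil> - 1"
  have "of_int k < e / v" "e / v \<le> of_int k + 1" unfolding k_def by linarith+
  then have k: "of_int k * v < e" "e \<le> of_int k * v + v"
    using v by (auto simp: field_simps)
  have "k \<ge> 0" unfolding k_def using v e_pos
    by (smt (verit) divide_pos_pos zero_less_ceiling)
  have "val (0 + k * P) (1 + k * Q) = of_int k * v - e"
    unfolding val_add val_mult v_def by (simp add: val_def[of 1] val_def[of 0])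
  then show thesis
    using that[of "0 + k * P" "1 + k * Q"] k v \<open>k \<ge> 0\<close> PQ by simp
qed

lemma later_visit:
  assumes "P \<ge> 0" "Q \<ge> 0" "0 \<le> x n + val P Q" "x n + val P Q < l"
  obtains j where "j \<le> nat (P + Q)" "x (n + int j) = x n + val P Q"
proof -
  obtain k where k: "p k = p n + P" "q k = q n + Q" "x k = x n + val P Q"
    using visits[OF assms(3,4)] .
  have "n \<le> k" using form_strict_mono(2)[of 1 1 n k] k assms by simp
  then have "k - n \<le> P + Q" using pq_increments(1)[of n k] k by simp
  then show thesis using that[of "nat (k - n)"] k \<open>n \<le> k\<close> by simp
qed

text \<open>Repeating a displacement shorter than \<open>b - a\<close> cannot jump over the target
  interval, and non-negative coordinates make every repetition a move into the future. At most
  \<open>K\<close> repetitions are needed wherever one starts, which makes the waiting time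
  uniform.\<close>

lemma hits:
  assumes "0 \<le> a" "a < b" "b \<le> l"
  obtains N :: nat where "\<And>n. \<exists>j\<le>N. a \<le> x (n + int j) \<and> x (n + int j) < b"
proof -
  obtain P1 Q1 where 1: "P1 \<ge> 0" "Q1 \<ge> 0" "0 < val P1 Q1" "val P1 Q1 < b - a"
    using small_pos[of "b - a"] assms by auto
  obtain P2 Q2 where 2: "P2 \<ge> 0" "Q2 \<ge> 0" "val P2 Q2 < 0" "- (b - a) < val P2 Q2"
    using small_neg[of "b - a"] assms by auto
  define m where "m = min (val P1 Q1) (- val P2 Q2)"
  define K where "K = \<lceil>1 / m\<rceil> + 1"
  have "m > 0" using 1 2 by (simp add: m_def)
  define N where "N = nat (K * (P1 + Q1 + P2 + Q2))"
  have bound: "\<exists>j\<le>N. x (n + int j) = x n + of_int k * val P Q"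
    if as: "0 \<le> k" "k \<le> K" "0 \<le> P" "0 \<le> Q" "P + Q \<le> P1 + Q1 + P2 + Q2"
      "0 \<le> x n + of_int k * val P Q" "x n + of_int k * val P Q < l" for n k P Q
  proof -
    obtain j where j: "j \<le> nat (k * P + k * Q)" "x (n + int j) = x n + val (k * P) (k * Q)"
      using later_visit[of "k * P" "k * Q" n, OF mult_nonneg_nonneg mult_nonneg_nonneg] as
      unfolding val_mult by metis
    have "k * (P + Q) \<le> K * (P1 + Q1 + P2 + Q2)" using that by (intro mult_mono) auto
    then have "nat (k * P + k * Q) \<le> N" unfolding N_def by (simp add: distrib_left nat_mono)
    then show ?thesis using j by (auto simp: val_mult intro!: exI[of _ j])
  qed
  have small: "\<lfloor>t / r\<rfloor> + 1 \<le> K" "\<lceil>t / r\<rceil> \<le> K" if "t \<le> 1" "0 \<le> t" "m \<le> r" for t r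
  proof -
    have "t / r \<le> 1 / m" using that \<open>m > 0\<close> by (intro frac_le) auto
    then show "\<lfloor>t / r\<rfloor> + 1 \<le> K" "\<lceil>t / r\<rceil> \<le> K" unfolding K_def by linarith+
  qed
  show thesis
  proof (rule that)
    fix n
    consider "x n < a" | "x n \<ge> b" | "a \<le> x n" "x n < b" by linarith
    then show "\<exists>j\<le>N. a \<le> x (n + int j) \<and> x (n + int j) < b"
    proof cases
      case 1
      define v where "v = val P1 Q1"
      have v: "v > 0" "v < b - a" using \<open>0 < val P1 Q1\<close> \<open>val P1 Q1 < b - a\<close> by (auto simp: v_def)
      define k where "k = \<lceil>(a - x n) / v\<rceil>"
      have "of_int k \<ge> (a - x n) / v" "of_int k < (a - x n) / v + 1" unfolding k_def by linarith+
      then have k: "of_int k * v \<ge> a - x n" "of_int k * v < a - x n + v" using v by (auto simp: field_simps)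
      have "(a - x n) / v > 0" using 1 v by simp
      then have "0 \<le> k" unfolding k_def by linarith
      moreover have "k \<le> K" using small(2)[of "a - x n" v] 1 v assms l_less_1 x_bounds[of n]
        by (auto simp: k_def v_def m_def)
      ultimately have "0 \<le> k" "k \<le> K" .
      with bound[of k P1 Q1 n] \<open>P1 \<ge> 0\<close> \<open>Q1 \<ge> 0\<close> 2 k v assms show ?thesis
        by (fastforce simp: v_def)
    next
      case 2
      define v where "v = - val P2 Q2"
      have v: "v > 0" "v < b - a" using \<open>0 > val P2 Q2\<close> \<open>- (b - a) < val P2 Q2\<close> by (auto simp: v_def)
      define k where "k = \<lfloor>(x n - b) / v\<rfloor> + 1"
      have "of_int k > (x n - b) / v" "of_int k \<le> (x n - b) / v + 1" unfolding k_def by linarith+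
      then have k: "of_int k * v > x n - b" "of_int k * v \<le> x n - b + v" using v by (auto simp: field_simps)
      have kK: "k \<le> K" using small(1)[of "x n - b" v] 2 v assms l_less_1 x_bounds[of n]
        by (auto simp: k_def v_def m_def)
      have k0: "0 \<le> k" using 2 v by (auto simp: k_def)
      with kK bound[of k P2 Q2 n] \<open>P2 \<ge> 0\<close> \<open>Q2 \<ge> 0\<close> 1 k v assms show ?thesis
        by (fastforce simp: v_def)
    next
      case 3 then show ?thesis by (intro exI[of _ 0]) auto
    qed
  qed
qed

lemma dense: assumes "0 \<le> a" "a < b" "b \<le> l" obtains n where "a \<le> x n" "x n < b"
  using hits[OF assms] by metis

lemma letter_exists: obtains n where "u n = i"
proof (cases i)
  case L1
  then show thesis using dense[of 0 d1] d1_pos d1_less_e e_less_l that u_eqI[of _ L1] by auto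
next
  case L2
  then show thesis using dense[of d1 e] d1_pos d1_less_e e_less_l that u_eqI[of _ L2] by auto
next
  case L3
  then show thesis using dense[of e l] e_pos e_less_l that u_eqI[of _ L3] by auto
qed

lemma recurrent_letters:
  obtains N :: nat where "\<And>n i. \<exists>j\<le>N. u (n + int j) = i"
proof -
  have "\<exists>N. \<forall>n. \<exists>j\<le>N. u (n + int j) = i" for i
  proof (cases i)
    case L1
    obtain N where N: "\<And>n. \<exists>j\<le>N. 0 \<le> x (n + int j) \<and> x (n + int j) < d1"
      using hits[of 0 d1] d1_pos d1_less_e e_less_l by auto
    show ?thesis unfolding L1 by (intro exI[of _ N]) (use N u_eqI[of _ L1] in fastforce)
  next
    case L2
    obtain N where N: "\<And>n. \<exists>j\<le>N. d1 \<le> x (n + int j) \<and> x (n + int j) < e"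
      using hits[of d1 e] d1_pos d1_less_e e_less_l by auto
    show ?thesis unfolding L2 by (intro exI[of _ N]) (use N u_eqI[of _ L2] in fastforce)
  next
    case L3
    obtain N where N: "\<And>n. \<exists>j\<le>N. e \<le> x (n + int j) \<and> x (n + int j) < l"
      using hits[of e l] e_pos e_less_l by auto
    show ?thesis unfolding L3 by (intro exI[of _ N]) (use N u_eqI[of _ L3] in fastforce)
  qed
  then obtain N where N: "\<And>i n. \<exists>j\<le>N i. u (n + int j) = i" by metis
  show thesis
  proof (rule that)
    fix n i
    have "N i \<le> N L1 + N L2 + N L3" by (cases i) auto
    moreover obtain j where "j \<le> N i" "u (n + int j) = i" using N by blast
    ultimately show "\<exists>j\<le>N L1 + N L2 + N L3. u (n + int j) = i" by (intro exI[of _ j]) simp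
  qed
qed

text \<open>If \<open>x k\<close> were ahead of \<open>x n\<close> by at least \<theta>, it would
  stay ahead by the same amount as long as the letters agree. When the orbit of \<open>x n\<close>
  enters the strip of width \<theta> to the left of \<open>d1\<close>, the other point is already
  beyond \<open>d1\<close> and the letters differ.\<close>

lemma cylinder:
  assumes "\<eta> > 0"
  obtains N :: nat where "\<And>n k. (\<And>j. j \<le> N \<Longrightarrow> u (n + int j) = u (k + int j)) \<Longrightarrow> \<bar>x n - x k\<bar> < \<eta>"
proof -
  define \<theta> where "\<theta> = min \<eta> d1"
  have \<theta>: "0 < \<theta>" "\<theta> \<le> \<eta>" "\<theta> \<le> d1" using assms d1_pos by (auto simp: \<theta>_def)
  obtain N where N: "\<And>n. \<exists>j\<le>N. d1 - \<theta> \<le> x (n + int j) \<and> x (n + int j) < d1"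
    using hits[of "d1 - \<theta>" d1] \<theta> d1_less_e e_less_l by auto
  have main: "x k - x n < \<theta>" if agree: "\<And>j. j \<le> N \<Longrightarrow> u (n + int j) = u (k + int j)" for n k
  proof (rule ccontr)
    assume "\<not> x k - x n < \<theta>"
    obtain j where j: "j \<le> N" "d1 - \<theta> \<le> x (n + int j)" "x (n + int j) < d1" using N by blast
    have "x (n + int j) - x n = x (k + int j) - x k"
      by (rule same_x_displacement) (use agree j in auto)
    then have "x (k + int j) \<ge> d1" using j \<open>\<not> x k - x n < \<theta>\<close> by simp
    moreover have "u (n + int j) = L1" using j x_bounds by (intro u_eqI) auto
    then have "u (k + int j) = L1" using agree j by simp
    ultimately show False using x_in[of "k + int j"] by simp
  qed
  show thesis
  proof (rule that)
    fix n k assume "\<And>j. j \<le> N \<Longrightarrow> u (n + int j) = u (k + int j)"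
    from main[of n k, OF this] main[of k n, OF this[symmetric]] \<theta> show "\<bar>x n - x k\<bar> < \<eta>" by auto
  qed
qed

text \<open>The point \<open>c\<close> need not belong to the orbit, and the two nearby points may
  lie on opposite sides of it. The hypothesis therefore speaks of all non-negative displacements
  instead of a forward orbit of \<open>c\<close>.\<close>

lemma agree_forward:
  assumes reg: "\<And>P Q. P \<ge> 0 \<Longrightarrow> Q \<ge> 0 \<Longrightarrow> c + val P Q \<noteq> d1 \<and> c + val P Q \<noteq> e"
  obtains \<theta> where "\<theta> > 0"
    "\<And>n k j. \<bar>x n - c\<bar> < \<theta> \<Longrightarrow> \<bar>x k - c\<bar> < \<theta> \<Longrightarrow> j \<le> (N :: nat) \<Longrightarrow> u (n + int j) = u (k + int j)"
proof -
  \<comment> \<open>Up to \<open>N\<close> letters raise \<open>P + Q\<close> by at most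
    \<open>2 * N\<close>, so these are all the distances to a discontinuity that can matter.\<close>
  define S where "S = (\<lambda>(P, Q, b). c + val P Q - b) ` ({0..2 * int N} \<times> {0..2 * int N} \<times> {d1, e})"
  have "finite S" by (simp add: S_def)
  then obtain \<theta> where \<theta>: "\<theta> > 0" "\<And>y. y \<in> S \<Longrightarrow> y \<noteq> 0 \<Longrightarrow> \<bar>y\<bar> \<ge> \<theta>"
    using finite_reals_separated by metis
  show thesis
  proof (rule that[OF \<theta>(1)])
    fix n k j assume close: "\<bar>x n - c\<bar> < \<theta>" "\<bar>x k - c\<bar> < \<theta>" and "j \<le> N"
    from \<open>j \<le> N\<close> show "u (n + int j) = u (k + int j)"
    proof (induction j rule: less_induct)
      case (less j)
      define P Q where "P = p (n + int j) - p n" and "Q = q (n + int j) - q n"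
      have same: "P = p (k + int j) - p k" "Q = q (k + int j) - q k"
        using same_displacement[of j n k] less by (auto simp: P_def Q_def)
      have PQ: "P \<ge> 0" "Q \<ge> 0" "P + Q \<le> 2 * int N"
        using p_mono[of n "n + int j"] q_mono[of n "n + int j"] pq_increments(2)[of n "n + int j"] less.prems
        by (auto simp: P_def Q_def)
      have far: "\<bar>c + val P Q - b\<bar> \<ge> \<theta>" if "b \<in> {d1, e}" for b
      proof (rule \<theta>(2))
        show "c + val P Q - b \<in> S" unfolding S_def using that PQ by (intro image_eqI[of _ _ "(P, Q, b)"]) auto
        show "c + val P Q - b \<noteq> 0" using reg[OF PQ(1,2)] that by auto
      qed
      have xn: "x (n + int j) = x n + val P Q" and xk: "x (k + int j) = x k + val P Q"
        using x_diff[of "n + int j" n] x_diff[of "k + int j" k] same by (auto simp: P_def Q_def)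
      have side: "x (n + int j) < b \<longleftrightarrow> x (k + int j) < b" if "b \<in> {d1, e}" for b
        unfolding xn xk using far[OF that] close by linarith
      show ?case
        using x_in[of "n + int j"] x_in[of "k + int j"] side d1_less_e
        by (cases "u (n + int j)"; cases "u (k + int j)") force+
    qed
  qed
qed

lemma agree_backward:
  assumes reg: "\<And>P Q. P \<ge> 0 \<Longrightarrow> Q \<ge> 0 \<Longrightarrow> c - val P Q \<noteq> l - e \<and> c - val P Q \<noteq> 1 - e"
  obtains \<theta> where "\<theta> > 0"
    "\<And>n k j. \<bar>x n - c\<bar> < \<theta> \<Longrightarrow> \<bar>x k - c\<bar> < \<theta> \<Longrightarrow> j \<le> (N :: nat) \<Longrightarrow> u (n - 1 - int j) = u (k - 1 - int j)"
proof -
  define S where "S = (\<lambda>(P, Q, b). c - val P Q - b) ` ({0..2 * int N} \<times> {0..2 * int N} \<times> {l - e, 1 - e})"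
  have "finite S" by (simp add: S_def)
  then obtain \<theta> where \<theta>: "\<theta> > 0" "\<And>y. y \<in> S \<Longrightarrow> y \<noteq> 0 \<Longrightarrow> \<bar>y\<bar> \<ge> \<theta>"
    using finite_reals_separated by metis
  show thesis
  proof (rule that[OF \<theta>(1)])
    fix n k j assume close: "\<bar>x n - c\<bar> < \<theta>" "\<bar>x k - c\<bar> < \<theta>" and "j \<le> N"
    from \<open>j \<le> N\<close> show "u (n - 1 - int j) = u (k - 1 - int j)"
    proof (induction j rule: less_induct)
      case (less j)
      define P Q where "P = p n - p (n - int j)" and "Q = q n - q (n - int j)"
      have "u (n - int j + int i) = u (k - int j + int i)" if "i < j" for i
        using less.IH[of "j - 1 - i"] less.prems that by (simp add: algebra_simps)
      from same_displacement[of j "n - int j" "k - int j", OF this]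
      have same: "P = p k - p (k - int j)" "Q = q k - q (k - int j)" by (auto simp: P_def Q_def)
      have PQ: "P \<ge> 0" "Q \<ge> 0" "P + Q \<le> 2 * int N"
        using p_mono[of "n - int j" n] q_mono[of "n - int j" n] pq_increments(2)[of "n - int j" n] less.prems
        by (auto simp: P_def Q_def)
      have far: "\<bar>c - val P Q - b\<bar> \<ge> \<theta>" if "b \<in> {l - e, 1 - e}" for b
      proof (rule \<theta>(2))
        show "c - val P Q - b \<in> S" unfolding S_def using that PQ by (intro image_eqI[of _ _ "(P, Q, b)"]) auto
        show "c - val P Q - b \<noteq> 0" using reg[OF PQ(1,2)] that by auto
      qed
      have xn: "x (n - int j) = x n - val P Q" and xk: "x (k - int j) = x k - val P Q"
        using x_diff[of n "n - int j"] x_diff[of k "k - int j"] same by (auto simp: P_def Q_def)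
      have side: "x (n - int j) < b \<longleftrightarrow> x (k - int j) < b" if "b \<in> {l - e, 1 - e}" for b
        unfolding xn xk using far[OF that] close by linarith
      have eq: "n - 1 - int j = n - int j - 1" "k - 1 - int j = k - int j - 1" by auto
      show ?case unfolding eq u_pred using side by simp
    qed
  qed
qed

section \<open>Self-codings\<close>

text \<open>\<open>s n\<close> is the starting position of the image of the \<open>n\<close>-th letter.\<close>

definition self_coding :: "(int \<Rightarrow> int) \<Rightarrow> bool" where
  "self_coding s \<longleftrightarrow> s 0 = 0 \<and> strict_mono s \<and>
    (\<forall>n k. u n = u k \<longrightarrow> s (n + 1) - s n = s (k + 1) - s k \<and>
      (\<forall>i. 0 \<le> i \<and> i < s (n + 1) - s n \<longrightarrow> u (s n + i) = u (s k + i)))"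

lemma self_codingD:
  assumes "self_coding s"
  shows "s 0 = 0" "strict_mono s"
    and "u n = u k \<Longrightarrow> s (n + 1) - s n = s (k + 1) - s k"
    and "u n = u k \<Longrightarrow> 0 \<le> i \<Longrightarrow> i < s (n + 1) - s n \<Longrightarrow> u (s n + i) = u (s k + i)"
  using assms unfolding self_coding_def by blast+

lemma self_coding_ge:
  assumes "self_coding s" "n \<le> k" shows "s k - s n \<ge> k - n"
  using assms(2)
proof (induction k rule: int_ge_induct)
  case (step i)
  then show ?case using strict_monoD[OF self_codingD(2)[OF assms(1)], of i "i + 1"] by simp
qed simp

lemma self_coding_blocks:
  assumes s: "self_coding s" and agree: "\<And>j. j < N \<Longrightarrow> u (n + int j) = u (k + int j)"
  shows "s (n + int N) - s n = s (k + int N) - s k \<and>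
    (\<forall>i. 0 \<le> i \<and> i < s (n + int N) - s n \<longrightarrow> u (s n + i) = u (s k + i))"
  using agree
proof (induction N)
  case (Suc N)
  let ?n = "n + int N" and ?k = "k + int N"
  have IH: "s ?n - s n = s ?k - s k" "\<And>i. 0 \<le> i \<Longrightarrow> i < s ?n - s n \<Longrightarrow> u (s n + i) = u (s k + i)"
    using Suc by auto
  have last: "s (?n + 1) - s ?n = s (?k + 1) - s ?k"
    "\<And>i. 0 \<le> i \<Longrightarrow> i < s (?n + 1) - s ?n \<Longrightarrow> u (s ?n + i) = u (s ?k + i)"
    using self_codingD(3,4)[OF s, of ?n ?k] Suc.prems[of N] by auto
  have "u (s n + i) = u (s k + i)" if "0 \<le> i" "i < s (?n + 1) - s n" for i
  proof (cases "i < s ?n - s n")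
    case True then show ?thesis using IH that by simp
  next
    case False
    then have "u (s ?n + (i - (s ?n - s n))) = u (s ?k + (i - (s ?n - s n)))" using that by (intro last) auto
    then show ?thesis using IH(1) by (simp add: algebra_simps)
  qed
  then show ?case using IH(1) last(1) by (simp add: algebra_simps)
qed auto

lemma self_coding_compose:
  assumes r: "self_coding r" and s: "self_coding s"
  shows "self_coding (\<lambda>n. s (r n))"
  unfolding self_coding_def
proof (intro conjI allI impI strict_monoI)
  show "s (r 0) = 0" using self_codingD(1)[OF r] self_codingD(1)[OF s] by simp
  show "s (r n) < s (r k)" if "n < k" for n k
    using that strict_monoD self_codingD(2) r s by metis
  fix n k assume nk: "u n = u k"
  define N where "N = nat (r (n + 1) - r n)"
  have less: "r n < r (n + 1)" using strict_monoD[OF self_codingD(2)[OF r], of n "n + 1"] by simp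
  have len: "r (n + 1) = r n + int N" using less by (simp add: N_def)
  have len': "r (k + 1) = r k + int N" using len self_codingD(3)[OF r nk] by simp
  have agree: "u (r n + int j) = u (r k + int j)" if "j < N" for j
    using self_codingD(4)[OF r nk, of "int j"] that len by simp
  have B: "s (r n + int N) - s (r n) = s (r k + int N) - s (r k) \<and>
    (\<forall>i. 0 \<le> i \<and> i < s (r n + int N) - s (r n) \<longrightarrow> u (s (r n) + i) = u (s (r k) + i))"
    by (rule self_coding_blocks[OF s agree])
  show "s (r (n + 1)) - s (r n) = s (r (k + 1)) - s (r k)" using B len len' by simp
  show "u (s (r n) + i) = u (s (r k) + i)" if "0 \<le> i \<and> i < s (r (n + 1)) - s (r n)" for i
    using B len that by simp
qed

lemma self_coding_funpow:
  assumes "self_coding s" shows "self_coding (s ^^ N)"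
proof (induction N)
  case 0
  have "u (n + i) = u (k + i)" if "u n = u k" "0 \<le> i \<and> i < n + 1 - n" for n k i
  proof -
    have "i = 0" using that(2) by linarith
    then show ?thesis using that(1) by simp
  qed
  then have "\<forall>n k. u n = u k \<longrightarrow> (n + 1 - n = k + 1 - k \<and>
      (\<forall>i. 0 \<le> i \<and> i < n + 1 - n \<longrightarrow> u (n + i) = u (k + i)))" by (metis add_diff_cancel_left')
  then show ?case unfolding self_coding_def strict_mono_def funpow_0 by fast
next
  case (Suc N)
  then show ?case using self_coding_compose[OF Suc assms] by (simp add: comp_def)
qed

lemma self_coding_agree:
  assumes s: "self_coding s" and nk: "u n = u k" and j: "s n \<le> j" "j \<le> s (n + 1)"
  shows "p j - p (s n) = p (s k + (j - s n)) - p (s k)"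
    and "q j - q (s n) = q (s k + (j - s n)) - q (s k)"
    and "x j - x (s n) = x (s k + (j - s n)) - x (s k)"
proof -
  have "u (s n + int i) = u (s k + int i)" if "i < nat (j - s n)" for i
    using self_codingD(4)[OF s nk, of "int i"] that j by auto
  note agree = this
  from same_displacement[of "nat (j - s n)" "s n" "s k", OF agree]
    same_x_displacement[of "nat (j - s n)" "s n" "s k", OF agree] j
  show "p j - p (s n) = p (s k + (j - s n)) - p (s k)" "q j - q (s n) = q (s k + (j - s n)) - q (s k)"
    "x j - x (s n) = x (s k + (j - s n)) - x (s k)" by simp_all
qed

lemma self_coding_displacement:
  assumes s: "self_coding s" and nk: "u n = u k"
  shows "p (s (n + 1)) - p (s n) = p (s (k + 1)) - p (s k)"
    and "q (s (n + 1)) - q (s n) = q (s (k + 1)) - q (s k)"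
    and "x (s (n + 1)) - x (s n) = x (s (k + 1)) - x (s k)"
proof -
  have "s n \<le> s (n + 1)" using self_coding_ge[OF s, of n "n + 1"] by simp
  moreover have "s k + (s (n + 1) - s n) = s (k + 1)" using self_codingD(3)[OF s nk] by simp
  ultimately show "p (s (n + 1)) - p (s n) = p (s (k + 1)) - p (s k)"
    "q (s (n + 1)) - q (s n) = q (s (k + 1)) - q (s k)"
    "x (s (n + 1)) - x (s n) = x (s (k + 1)) - x (s k)"
    using self_coding_agree[OF s nk, of "s (n + 1)"] by simp_all
qed

text \<open>Images of agreeing futures agree at least as long, so the first bound is
  \<open>cylinder\<close> at the block starts. For the second, apply the first at the beginning of
  the common past; the images of that past are identical and carry both points by the same
  displacement.\<close>

lemma self_coding_close:
  assumes s: "self_coding s" and "\<eta> > 0"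
  obtains N :: nat
  where "\<And>n k. (\<And>j. j \<le> N \<Longrightarrow> u (n + int j) = u (k + int j)) \<Longrightarrow> \<bar>x (s n) - x (s k)\<bar> < \<eta>"
    and "\<And>n k. (\<And>j. j \<le> N \<Longrightarrow> u (n - 1 - int j) = u (k - 1 - int j)) \<Longrightarrow> \<bar>x (s n) - x (s k)\<bar> < \<eta>"
proof -
  obtain N where N: "\<And>n k. (\<And>j. j \<le> N \<Longrightarrow> u (n + int j) = u (k + int j)) \<Longrightarrow> \<bar>x n - x k\<bar> < \<eta>"
    using cylinder[OF \<open>\<eta> > 0\<close>] by blast
  have forward: "\<bar>x (s n) - x (s k)\<bar> < \<eta>" if agree: "\<And>j. j \<le> N \<Longrightarrow> u (n + int j) = u (k + int j)" for n k
  proof (rule N)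
    fix j assume "j \<le> N"
    have "\<And>j. j < Suc N \<Longrightarrow> u (n + int j) = u (k + int j)" using agree by simp
    note B = self_coding_blocks[of s "Suc N" n k, OF s this]
    have "int N + 1 \<le> s (n + int (Suc N)) - s n"
      using self_coding_ge[OF s, of n "n + int (Suc N)"] by simp
    then show "u (s n + int j) = u (s k + int j)" using B \<open>j \<le> N\<close> by simp
  qed
  have backward: "\<bar>x (s n) - x (s k)\<bar> < \<eta>"
    if agree: "\<And>j. j \<le> N \<Longrightarrow> u (n - 1 - int j) = u (k - 1 - int j)" for n k
  proof -
    define n' k' where "n' = n - 1 - int N" and "k' = k - 1 - int N"
    have shifted: "u (n' + int j) = u (k' + int j)" if "j < Suc N" for j
      using agree[of "N - j"] that by (simp add: n'_def k'_def of_nat_diff algebra_simps)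
    have nk: "n' + int (Suc N) = n" "k' + int (Suc N) = k" by (auto simp: n'_def k'_def)
    have close: "\<bar>x (s n') - x (s k')\<bar> < \<eta>"
      by (rule forward) (use shifted in auto)
    from self_coding_blocks[of s "Suc N" n' k', OF s shifted] have B: "s n - s n' = s k - s k'"
      "\<And>i. 0 \<le> i \<Longrightarrow> i < s n - s n' \<Longrightarrow> u (s n' + i) = u (s k' + i)" unfolding nk by auto
    have ge: "s n' \<le> s n" using self_coding_ge[OF s, of n' n] by (simp add: n'_def)
    have "u (s n' + int i) = u (s k' + int i)" if "i < nat (s n - s n')" for i
      using B(2)[of "int i"] that by simp
    note agree' = this
    have ends: "s n' + int (nat (s n - s n')) = s n" "s k' + int (nat (s n - s n')) = s k"
      using ge B(1) by auto
    from same_x_displacement[of "nat (s n - s n')" "s n'" "s k'", OF agree'] have "x (s n) - x (s n') = x (s k) - x (s k')"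
      unfolding ends .
    then show ?thesis using close by simp
  qed
  show thesis using that[of N] forward backward by blast
qed

text \<open>Just left of the discontinuity \<open>d1\<close> the orbit reads the letters 1, 3 and just right of it
  it reads 2; long pasts and long futures on the two sides agree. Hence the images of the
  points before and after are arbitrarily close, which forces equal displacements.\<close>

lemma self_coding_13_eq_2:
  assumes s: "self_coding s" and letters: "u a = L1" "u b = L2" "u c = L3"
  shows "p (s (a + 1)) - p (s a) + (p (s (c + 1)) - p (s c)) = p (s (b + 1)) - p (s b)"
    and "q (s (a + 1)) - q (s a) + (q (s (c + 1)) - q (s c)) = q (s (b + 1)) - q (s b)"
proof -
  define D where "D = x (s (a + 1)) - x (s a) + (x (s (c + 1)) - x (s c)) - (x (s (b + 1)) - x (s b))"
  have "D = 0"
  proof (rule ccontr)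
    assume "D \<noteq> 0"
    then obtain N where N:
      "\<And>n k. (\<And>j. j \<le> N \<Longrightarrow> u (n + int j) = u (k + int j)) \<Longrightarrow> \<bar>x (s n) - x (s k)\<bar> < \<bar>D\<bar> / 2"
      "\<And>n k. (\<And>j. j \<le> N \<Longrightarrow> u (n - 1 - int j) = u (k - 1 - int j)) \<Longrightarrow> \<bar>x (s n) - x (s k)\<bar> < \<bar>D\<bar> / 2"
      using self_coding_close[OF s, of "\<bar>D\<bar> / 2"] by auto
    \<comment> \<open>The number \<open>l - e\<close> is where both sides of \<open>d1\<close> meet
      again, after the letters 1, 3 and after the letter 2. Returning from it to \<open>d1\<close>
      would require the coordinates -1, -1, and reaching \<open>e\<close> would put \<open>l\<close>
      into the module.\<close>
    have regF: "l - e + val P Q \<noteq> d1 \<and> l - e + val P Q \<noteq> e" if "P \<ge> 0" "Q \<ge> 0" for P Q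
    proof
      show "l - e + val P Q \<noteq> d1"
      proof
        assume "l - e + val P Q = d1"
        then have "val P Q = val (-1) (-1)" by (simp add: d1_def val_def)
        then show False using val_inject[of P Q "-1" "-1"] that by simp
      qed
      show "l - e + val P Q \<noteq> e"
        using l_generic[of "- P" "P + Q + 2"] by (auto simp: val_def algebra_simps)
    qed
    have regB: "d1 - val P Q \<noteq> l - e \<and> d1 - val P Q \<noteq> 1 - e" if "P \<ge> 0" "Q \<ge> 0" for P Q
    proof
      show "d1 - val P Q \<noteq> l - e"
      proof
        assume "d1 - val P Q = l - e"
        then have "val P Q = val (-1) (-1)" by (simp add: d1_def val_def)
        then show False using val_inject[of P Q "-1" "-1"] that by simp
      qed
      show "d1 - val P Q \<noteq> 1 - e"
        using l_generic[of "2 + P" "- P - Q - 2"] by (auto simp: val_def d1_def algebra_simps)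
    qed
    obtain \<theta>1 where \<theta>1: "\<theta>1 > 0"
      "\<And>n k j. \<bar>x n - (l - e)\<bar> < \<theta>1 \<Longrightarrow> \<bar>x k - (l - e)\<bar> < \<theta>1 \<Longrightarrow> j \<le> N \<Longrightarrow> u (n + int j) = u (k + int j)"
      using agree_forward[OF regF] by blast
    obtain \<theta>2 where \<theta>2: "\<theta>2 > 0"
      "\<And>n k j. \<bar>x n - d1\<bar> < \<theta>2 \<Longrightarrow> \<bar>x k - d1\<bar> < \<theta>2 \<Longrightarrow> j \<le> N \<Longrightarrow> u (n - 1 - int j) = u (k - 1 - int j)"
      using agree_backward[OF regB] by blast
    define \<theta> where "\<theta> = min (min \<theta>1 \<theta>2) (min d1 (min (e - d1) (l - e)))"
    have \<theta>: "\<theta> > 0" "\<theta> \<le> \<theta>1" "\<theta> \<le> \<theta>2" "\<theta> \<le> d1" "\<theta> \<le> e - d1" "\<theta> \<le> l - e"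
      using \<theta>1(1) \<theta>2(1) d1_pos d1_less_e e_less_l by (auto simp: \<theta>_def)
    obtain n' where n': "d1 - \<theta> / 2 \<le> x n'" "x n' < d1"
      using dense[of "d1 - \<theta> / 2" d1] \<theta> d1_less_e e_less_l by auto
    obtain k where k: "d1 \<le> x k" "x k < d1 + \<theta>"
      using dense[of d1 "d1 + \<theta>"] \<theta> d1_pos d1_less_e e_less_l by auto
    have un: "u n' = L1" and uk: "u k = L2"
      using n' k \<theta> d1_pos d1_less_e e_less_l by (auto intro!: u_eqI)
    have xn1: "x (n' + 1) = x n' + 1 - e" using x_succ[of n'] un by (simp add: val_def)
    then have un1: "u (n' + 1) = L3"
      using n' \<theta> d1_pos l_less_1 by (intro u_eqI) (auto simp: d1_def)
    have xn2: "x (n' + 2) = x n' + 1 - 2 * e"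
      using x_succ[of "n' + 1"] un1 xn1 by (simp add: val_def add.assoc)
    have xk1: "x (k + 1) = x k + 1 - 2 * e" using x_succ[of k] uk by (simp add: val_def)
    have "\<bar>x (s (n' + 2)) - x (s (k + 1))\<bar> < \<bar>D\<bar> / 2"
    proof (rule N(1))
      fix j assume "j \<le> N"
      then show "u (n' + 2 + int j) = u (k + 1 + int j)"
        by (intro \<theta>1(2)) (use xn2 xk1 n' k \<theta> in \<open>auto simp: d1_def\<close>)
    qed
    moreover have "\<bar>x (s n') - x (s k)\<bar> < \<bar>D\<bar> / 2"
    proof (rule N(2))
      fix j assume "j \<le> N"
      then show "u (n' - 1 - int j) = u (k - 1 - int j)"
        by (intro \<theta>2(2)) (use n' k \<theta> in auto)
    qed
    moreover have "D = (x (s (n' + 2)) - x (s (k + 1))) - (x (s n') - x (s k))"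
      using self_coding_displacement(3)[OF s, of a n'] self_coding_displacement(3)[OF s, of b k]
        self_coding_displacement(3)[OF s, of c "n' + 1"] letters un uk un1
      by (simp add: D_def add.assoc)
    ultimately show False by linarith
  qed
  then have "val (p (s (a + 1)) - p (s a) + (p (s (c + 1)) - p (s c)))
      (q (s (a + 1)) - q (s a) + (q (s (c + 1)) - q (s c)))
    = val (p (s (b + 1)) - p (s b)) (q (s (b + 1)) - q (s b))"
    unfolding D_def x_diff val_add by simp
  from val_inject[OF this]
  show "p (s (a + 1)) - p (s a) + (p (s (c + 1)) - p (s c)) = p (s (b + 1)) - p (s b)"
    "q (s (a + 1)) - q (s a) + (q (s (c + 1)) - q (s c)) = q (s (b + 1)) - q (s b)" by auto
qed

text \<open>The matrix records the displacements of the images of letters 1 and 3. It must have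
  \<open>(1 - e, - e)\<close> as an eigenvector, because otherwise images of orbit points would have
  unbounded distance from \<open>x 0\<close>; \<kappa> is the eigenvalue.\<close>

lemma self_coding_linear:
  assumes s: "self_coding s"
  obtains \<kappa> :: real and a b c d :: int
  where "a \<ge> 0" "b \<ge> 0" "c \<ge> 0" "d \<ge> 0"
    "\<And>n. p (s n) = a * p n + b * q n" "\<And>n. q (s n) = c * p n + d * q n"
    "\<kappa> * (1 - e) = val a c" "- \<kappa> * e = val b d"
    "\<And>n. x (s n) = x 0 + \<kappa> * (x n - x 0)"
proof -
  obtain n1 n2 n3 where n: "u n1 = L1" "u n2 = L2" "u n3 = L3" using letter_exists by metis
  define a b c d where "a = p (s (n1 + 1)) - p (s n1)" and "b = p (s (n3 + 1)) - p (s n3)"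
    and "c = q (s (n1 + 1)) - q (s n1)" and "d = q (s (n3 + 1)) - q (s n3)"
  note defs = a_def b_def c_def d_def
  have mono: "s k \<le> s (k + 1)" for k using self_coding_ge[OF s, of k "k + 1"] by simp
  have nonneg: "a \<ge> 0" "b \<ge> 0" "c \<ge> 0" "d \<ge> 0"
    using p_mono[OF mono] q_mono[OF mono] by (auto simp: defs)
  note two = self_coding_13_eq_2[OF s n]
  have stepp: "p (s (k + 1)) = p (s k) + a * step1 (u k) + b * step3 (u k)" for k
    using self_coding_displacement(1)[OF s, of k n1] self_coding_displacement(1)[OF s, of k n2]
      self_coding_displacement(1)[OF s, of k n3] two n by (cases "u k") (auto simp: defs)
  have stepq: "q (s (k + 1)) = q (s k) + c * step1 (u k) + d * step3 (u k)" for k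
    using self_coding_displacement(2)[OF s, of k n1] self_coding_displacement(2)[OF s, of k n2]
      self_coding_displacement(2)[OF s, of k n3] two n by (cases "u k") (auto simp: defs)
  have s0: "s 0 = 0" using self_codingD(1)[OF s] .
  have pq: "p (s k) = a * p k + b * q k \<and> q (s k) = c * p k + d * q k" for k
  proof (induction k rule: int_shift_induct)
    case zero then show ?case using s0 by simp
  qed (auto simp: stepp stepq p_succ q_succ algebra_simps)
  define g1 g3 where "g1 = val a c" and "g3 = val b d"
  have xs: "x (s k) - x 0 = p k * g1 + q k * g3" for k
  proof -
    have "x (s k) - x 0 = val (p k * a + q k * b) (p k * c + q k * d)"
      using x_diff[of "s k" 0] pq[of k] by (simp add: mult.commute)
    then show ?thesis by (simp add: val_add val_mult g1_def g3_def)
  qed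
  \<comment> \<open>The determinant of the rows \<open>(1 - e, - e)\<close> and
    \<open>(g1, g3)\<close>. Eliminating \<open>p k\<close> from the bounded quantities
    \<open>x k - x 0\<close> and \<open>x (s k) - x 0\<close> leaves \<open>q k * Z\<close>. A
    nonzero \<open>Z\<close> would bound \<open>q\<close> and then \<open>p\<close> from above,
    although their sum grows with each letter.\<close>
  define Z where "Z = (1 - e) * g3 + e * g1"
  have bound: "\<bar>of_int (q k) * Z\<bar> \<le> 1 + \<bar>g1\<bar>" for k
  proof -
    have 1: "\<bar>x (s k) - x 0\<bar> \<le> 1" "\<bar>x k - x 0\<bar> \<le> 1"
      using x_bounds[of "s k"] x_bounds[of 0] x_bounds[of k] l_less_1 by auto
    have "of_int (q k) * Z = (1 - e) * (x (s k) - x 0) - g1 * (x k - x 0)"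
    proof -
      have "x k - x 0 = of_int (p k) * (1 - e) - of_int (q k) * e" using x_diff[of k 0] by (simp add: val_def)
      then show ?thesis unfolding xs by (simp only: Z_def) (simp add: algebra_simps)
    qed
    also have "\<bar>\<dots>\<bar> \<le> \<bar>1 - e\<bar> * \<bar>x (s k) - x 0\<bar> + \<bar>g1\<bar> * \<bar>x k - x 0\<bar>"
      by (metis abs_mult abs_triangle_ineq4)
    also have "\<dots> \<le> 1 * 1 + \<bar>g1\<bar> * 1"
      using 1 e_pos e_less_1 by (intro add_mono mult_mono) auto
    finally show ?thesis by simp
  qed
  have "Z = 0"
  proof (rule ccontr)
    assume "Z \<noteq> 0"
    define B where "B = (1 + \<bar>g1\<bar>) / \<bar>Z\<bar>"
    have qB: "\<bar>of_int (q k)\<bar> \<le> B" for k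
      using bound[of k] \<open>Z \<noteq> 0\<close> by (simp add: B_def abs_mult field_simps)
    define C where "C = (1 + B) / (1 - e)"
    have pC: "of_int (p k) \<le> C" for k
    proof -
      have "of_int (p k) * (1 - e) - of_int (q k) * e \<le> 1"
        using x_diff[of k 0] x_bounds[of k] x_bounds[of 0] l_less_1 by (simp add: val_def)
      moreover have "of_int (q k) * e \<le> B"
        using qB[of k] mult_left_le[of e "\<bar>of_int (q k)\<bar>"] e_pos e_less_1
        by (smt (verit) abs_ge_self mult_right_mono)
      ultimately have "of_int (p k) * (1 - e) \<le> 1 + B" by linarith
      then show ?thesis using e_less_1 by (simp add: C_def field_simps)
    qed
    define k where "k = \<lceil>B + C\<rceil> + 1"
    have "0 \<le> B" using qB[of 0] by simp
    moreover have "0 \<le> C" using pC[of 0] by simp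
    ultimately have "k \<ge> 0" unfolding k_def by linarith
    then have "of_int k \<le> real_of_int (p k + q k)" using pq_increments(1)[of 0 k] by simp
    also have "\<dots> \<le> B + C" using qB[of k] pC[of k] by simp
    finally show False unfolding k_def by linarith
  qed
  define \<kappa> where "\<kappa> = g1 / (1 - e)"
  have k1: "\<kappa> * (1 - e) = g1" using e_less_1 by (simp add: \<kappa>_def)
  have "(1 - e) * (g3 + \<kappa> * e) = (1 - e) * g3 + e * (\<kappa> * (1 - e))" by (simp add: algebra_simps)
  then have "(1 - e) * (g3 + \<kappa> * e) = 0" using \<open>Z = 0\<close> unfolding k1 Z_def by simp
  then have "g3 + \<kappa> * e = 0" using e_less_1 unfolding mult_eq_0_iff by linarith
  then have k3: "- \<kappa> * e = g3" by simp
  show thesis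
  proof (rule that[OF nonneg])
    show "x (s k) = x 0 + \<kappa> * (x k - x 0)" for k
    proof -
      have d: "x k - x 0 = of_int (p k) * (1 - e) - of_int (q k) * e" using x_diff[of k 0] by (simp add: val_def)
      have "\<kappa> * (x k - x 0) = of_int (p k) * (\<kappa> * (1 - e)) + of_int (q k) * (- \<kappa> * e)"
        unfolding d by (simp add: algebra_simps)
      then show ?thesis using xs[of k] unfolding k1 k3 by simp
    qed
  qed (use pq k1 k3 in \<open>auto simp: g1_def g3_def\<close>)
qed

end

section \<open>Orbits of the singular points\<close>

lemma iet_iter_step:
  assumes a: "a1 > 0" "a2 > 0" "a3 > 0" and y: "y \<in> {0..<a1 + a2 + a3}"
  shows "iet_iter a1 a2 a3 n y \<in> {0..<a1 + a2 + a3}"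
    and "iet_iter a1 a2 a3 (n + 1) y = iet_map a1 a2 a3 (iet_iter a1 a2 a3 n y)"
proof -
  let ?A = "{0..<a1 + a2 + a3}" and ?T = "iet_map a1 a2 a3"
  let ?S = "inv_into ?A ?T"
  have bij: "bij_betw ?T ?A ?A" by (rule bij_betw_iet_map[OF a])
  have TA: "?T z \<in> ?A" if "z \<in> ?A" for z using bij_betwE[OF bij] that by blast
  have SA: "?S z \<in> ?A" if "z \<in> ?A" for z
    using bij_betwE[OF bij_betw_inv_into[OF bij]] that by blast
  have TS: "?T (?S z) = z" if "z \<in> ?A" for z
    using bij_betw_inv_into_right[OF bij that] .
  have pos: "(?T ^^ N) y \<in> ?A" for N by (induction N) (use y TA in auto)
  have neg: "(?S ^^ N) y \<in> ?A" for N by (induction N) (use y SA in auto)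
  show "iet_iter a1 a2 a3 n y \<in> ?A" using pos neg by (simp add: iet_iter_def)
  show "iet_iter a1 a2 a3 (n + 1) y = ?T (iet_iter a1 a2 a3 n y)"
  proof (cases "n \<ge> 0")
    case True
    then show ?thesis by (simp add: iet_iter_def nat_add_distrib)
  next
    case False
    define N where "N = nat (- n - 1)"
    have N: "nat (- n) = Suc N" "nat (- (n + 1)) = N" using False by (auto simp: N_def)
    have "iet_iter a1 a2 a3 (n + 1) y = (?S ^^ N) y"
    proof (cases "n = -1")
      case True then show ?thesis by (simp add: iet_iter_def N_def)
    next
      case False
      then show ?thesis using \<open>\<not> n \<ge> 0\<close> N by (simp add: iet_iter_def)
    qed
    moreover have "iet_iter a1 a2 a3 n y = ?S ((?S ^^ N) y)" using False N by (simp add: iet_iter_def)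
    ultimately show ?thesis using TS[OF neg] by simp
  qed
qed

lemma (in iet3) orbit_of_coding:
  assumes a: "a1 > 0" "a2 > 0" "a3 > 0" and y: "y \<in> {0..<a1 + a2 + a3}"
    and codes: "codes_3iet_orbit a1 a2 a3 y u"
    and e: "e = (a1 + a2) / (a1 + 2 * a2 + a3)" and l: "l = (a1 + a2 + a3) / (a1 + 2 * a2 + a3)"
  obtains x p q where "iet3_orbit e l x u p q" "x 0 = y / (a1 + 2 * a2 + a3)"
proof -
  define \<sigma> where "\<sigma> = a1 + 2 * a2 + a3"
  have \<sigma>: "\<sigma> > 0" using a by (simp add: \<sigma>_def)
  define x where "x n = iet_iter a1 a2 a3 n y / \<sigma>" for n
  obtain p where p: "p 0 = 0" "\<And>n. p (n + 1) = p n + step1 (u n)"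
    using int_antidifference[of "\<lambda>n. step1 (u n)"] by blast
  obtain q where q: "q 0 = 0" "\<And>n. q (n + 1) = q n + step3 (u n)"
    using int_antidifference[of "\<lambda>n. step3 (u n)"] by blast
  have iter: "iet_iter a1 a2 a3 n y \<in> iet_interval a1 a2 a3 (u n)" for n
    using codes by (simp add: codes_3iet_orbit_def)
  have e\<sigma>: "e * \<sigma> = a1 + a2" and l\<sigma>: "l * \<sigma> = a1 + a2 + a3"
    using \<sigma> by (auto simp: e l \<sigma>_def[symmetric])
  have d\<sigma>: "d1 * \<sigma> = a1"
    using e\<sigma> l\<sigma> unfolding d1_def by (simp add: algebra_simps) (simp add: \<sigma>_def)
  have xin: "x n \<in> J (u n)" for n
  proof -
    have "x n * \<sigma> \<in> iet_interval a1 a2 a3 (u n)" using iter \<sigma> by (simp add: x_def)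
    moreover have "c \<le> x n \<longleftrightarrow> c * \<sigma> \<le> x n * \<sigma>" "x n < c \<longleftrightarrow> x n * \<sigma> < c * \<sigma>" for c
      using \<sigma> by simp_all
    ultimately show ?thesis using e\<sigma> l\<sigma> d\<sigma> by (cases "u n") simp_all
  qed
  have xstep: "x (n + 1) = x n + val (step1 (u n)) (step3 (u n))" for n
  proof -
    have "x (n + 1) * \<sigma> = iet_map a1 a2 a3 (iet_iter a1 a2 a3 n y)"
      using iet_iter_step(2)[OF a y] \<sigma> by (simp add: x_def)
    also have "\<dots> = iet_iter a1 a2 a3 n y +
        (case u n of L1 \<Rightarrow> a2 + a3 | L2 \<Rightarrow> a3 - a1 | L3 \<Rightarrow> - a1 - a2)"
      using iter[of n] a by (cases "u n") (auto simp: iet_map_def)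
    also have "\<dots> = x n * \<sigma> + val (step1 (u n)) (step3 (u n)) * \<sigma>"
      using \<sigma> e\<sigma> by (cases "u n") (auto simp: x_def val_def algebra_simps, auto simp: \<sigma>_def)
    finally have "x (n + 1) * \<sigma> = (x n + val (step1 (u n)) (step3 (u n))) * \<sigma>" by (simp add: algebra_simps)
    then show ?thesis using \<sigma> by simp
  qed
  have xeq: "x n = x 0 + val (p n) (q n)" for n
  proof (induction n rule: int_shift_induct)
    case zero show ?case by (simp add: p q)
  next
    case (up n) show ?case unfolding p(2) q(2) val_add xstep using up by linarith
  next
    case (down n) then show ?case unfolding p(2) q(2) val_add xstep by linarith
  qed
  have "iet3_orbit e l x u p q"
    by (intro iet3_orbit.intro iet3_orbit_axioms.intro iet3_axioms) (fact p q xeq xin)+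
  moreover have "x 0 = y / \<sigma>" by (simp add: x_def iet_iter_def)
  ultimately show thesis using that unfolding \<sigma>_def by blast
qed

context iet3
begin

lemma orbit_exists:
  assumes "0 \<le> y" "y < l"
  obtains x u p q where "iet3_orbit e l x u p q" "x 0 = y"
proof -
  have a: "0 < d1" "0 < 1 - l" "0 < l - e" using d1_pos l_less_1 e_less_l by auto
  have sum: "d1 + (1 - l) + (l - e) = l" "d1 + 2 * (1 - l) + (l - e) = 1" by (auto simp: d1_def)
  have y: "y \<in> {0..<d1 + (1 - l) + (l - e)}" using assms by (simp add: sum)
  have "\<exists>i. z \<in> iet_interval d1 (1 - l) (l - e) i" if "z \<in> {0..<d1 + (1 - l) + (l - e)}" for z
  proof -
    consider "z < d1" | "d1 \<le> z" "z < d1 + (1 - l)" | "d1 + (1 - l) \<le> z" by linarith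
    then show ?thesis
    proof cases
      case 1 then show ?thesis using that by (intro exI[of _ L1]) simp
    next
      case 2 then show ?thesis by (intro exI[of _ L2]) simp
    next
      case 3 then show ?thesis using that by (intro exI[of _ L3]) simp
    qed
  qed
  then have "\<exists>i. iet_iter d1 (1 - l) (l - e) n y \<in> iet_interval d1 (1 - l) (l - e) i" for n
    using iet_iter_step(1)[OF a y] by blast
  then obtain u where u: "codes_3iet_orbit d1 (1 - l) (l - e) y u"
    unfolding codes_3iet_orbit_def by metis
  show thesis
  proof (rule orbit_of_coding[OF a y u])
    fix x p q assume "iet3_orbit e l x u p q" "x 0 = y / (d1 + 2 * (1 - l) + (l - e))"
    then show thesis using that unfolding sum by simp
  qed (unfold sum, auto simp: d1_def)
qed

text \<open>The values \<open>lo\<close> and \<open>hi\<close> are those of the linear form at the predecessor and successor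
  of the singular point \<open>b\<close>; for \<open>b = l\<close> the left limits are meant.\<close>

lemma singular_orbit:
  fixes E1 E2 :: real
  assumes b: "b = 0 \<and> lo = - E2 \<and> hi = E1 \<or> b = l \<and> lo = - E1 \<and> hi = E2"
  obtains v w p q P0 K0 K1 where "iet3_orbit e l v w p q"
    "\<And>n. v n = b + val (p n - P0) (q n)"
    "E1 * (p K0 - P0) + E2 * q K0 = lo" "E1 * (p K1 - P0) + E2 * q K1 = hi"
    "\<And>n. v n \<in> {0, d1, e} \<longleftrightarrow> K0 \<le> n \<and> n < K1"
  using b
proof (elim disjE conjE)
  assume b: "b = 0" "lo = - E2" "hi = E1"
  obtain v w p q where orb: "iet3_orbit e l v w p q" and v0: "v 0 = 0"
    using orbit_exists[of 0] e_pos e_less_l by (metis less_trans order_refl)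
  interpret v: iet3_orbit e l v w p q by (rule orb)
  \<comment> \<open>Around 0 the orbit passes through \<open>e\<close>, 0, \<open>1 - e\<close>, so
    the singular positions are -1 and 0. The third discontinuity \<open>d1\<close> is absent, being
    congruent to \<open>l\<close> modulo M.\<close>
  have w0: "w 0 = L1" using v.u_eqI[of 0 L1] v0 d1_pos by simp
  have wm: "w (-1) = L3" using v.u_pred[of 0] v0 e_less_l by simp
  have p1: "p 1 = 1" "q 1 = 0" using v.p_succ[of 0] v.q_succ[of 0] w0 by auto
  have pm: "p (-1) = 0" "q (-1) = -1" using v.p_succ[of "-1"] v.q_succ[of "-1"] wm by auto
  have vm: "v (-1) = e" using v.x_eq[of "-1"] pm v0 by (simp add: val_def)
  have "v n \<noteq> d1" for n
    using v.x_eq[of n] v0 l_generic[of "p n + 1" "- p n - q n - 1"]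
    by (auto simp: val_eq d1_def algebra_simps)
  then have "v n \<in> {0, d1, e} \<longleftrightarrow> n = 0 \<or> n = -1" for n
    using v0 vm v.x_inject[of n 0] v.x_inject[of n "-1"] by auto
  moreover have "n = 0 \<or> n = -1 \<longleftrightarrow> -1 \<le> n \<and> n < 1" for n :: int by auto
  ultimately have sing: "v n \<in> {0, d1, e} \<longleftrightarrow> -1 \<le> n \<and> n < 1" for n by (simp only:)
  have veq: "v n = b + val (p n - 0) (q n)" for n using v.x_eq[of n] v0 b(1) by simp
  have ends: "E1 * (p (- 1) - 0) + E2 * q (- 1) = lo" "E1 * (p 1 - 0) + E2 * q 1 = hi"
    by (simp_all only: b p1 pm) simp_all
  show thesis by (rule that[of v w p q 0 "-1" 1]) (fact orb veq ends sing)+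
next
  assume b: "b = l" "lo = - E1" "hi = E2"
  \<comment> \<open>Since \<open>l\<close> is not a point of the interval, the orbit of
    \<open>d1 = l - (1 - e)\<close> stands in for it: \<open>l\<close> is the left limit of the
    exchange at \<open>d1\<close>. This accounts for the offset \<open>P0 = 1\<close>.\<close>
  obtain v w p q where orb: "iet3_orbit e l v w p q" and v0: "v 0 = d1"
    using orbit_exists[of d1] d1_pos d1_less_e e_less_l by (metis less_trans less_imp_le)
  interpret v: iet3_orbit e l v w p q by (rule orb)
  have w0: "w 0 = L2" using v.u_eqI[of 0 L2] v0 d1_less_e by simp
  have p1: "p 1 = 1" "q 1 = 1" using v.p_succ[of 0] v.q_succ[of 0] w0 by auto
  have "v n \<noteq> 0" for n
    using v.x_eq[of n] v0 l_generic[of "1 - p n" "p n + q n - 1"]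
    by (auto simp: val_eq d1_def algebra_simps)
  moreover have "v n \<noteq> e" for n
    using v.x_eq[of n] v0 l_generic[of "1 - p n" "p n + q n"]
    by (auto simp: val_eq d1_def algebra_simps)
  ultimately have "v n \<in> {0, d1, e} \<longleftrightarrow> n = 0" for n
    using v0 v.x_inject[of n 0] by auto
  moreover have "n = 0 \<longleftrightarrow> 0 \<le> n \<and> n < 1" for n :: int by auto
  ultimately have sing: "v n \<in> {0, d1, e} \<longleftrightarrow> 0 \<le> n \<and> n < 1" for n by (simp only:)
  have veq: "v n = b + val (p n - 1) (q n)" for n
    using v.x_eq[of n] v0 b(1) by (simp add: val_def d1_def algebra_simps)
  have ends: "E1 * (p 0 - 1) + E2 * q 0 = lo" "E1 * (p 1 - 1) + E2 * q 1 = hi"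
    by (simp_all only: b p1 v.p_0 v.q_0) simp_all
  show thesis by (rule that[of v w p q 1 0 1]) (fact orb veq ends sing)+
qed

text \<open>Along the orbit attached to \<open>b\<close> the form divides the line into half-open
  gaps. Those starting at singular positions fill exactly \<open>[lo, hi)\<close>, so any other
  \<open>r\<close> falls into a gap that starts at an interior point of one of the
  intervals.\<close>

lemma singular_gap_exists:
  fixes E1 E2 :: real
  assumes E: "E1 > 0" "E2 > 0"
    and b: "b = 0 \<and> lo = - E2 \<and> hi = E1 \<or> b = l \<and> lo = - E1 \<and> hi = E2"
    and r: "r < lo \<or> hi \<le> r"
  obtains i P Q where "b + val P Q \<in> J i" "b + val P Q \<notin> {0, d1, e}"
    "E1 * P + E2 * Q \<le> r" "r < E1 * (P + step1 i) + E2 * (Q + step3 i)"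
proof -
  obtain v w p q P0 K0 K1 where orb: "iet3_orbit e l v w p q"
    and v: "\<And>n. v n = b + val (p n - P0) (q n)"
    and K: "E1 * (p K0 - P0) + E2 * q K0 = lo" "E1 * (p K1 - P0) + E2 * q K1 = hi"
    "\<And>n. v n \<in> {0, d1, e} \<longleftrightarrow> K0 \<le> n \<and> n < K1"
    using singular_orbit[OF b] by blast
  interpret v: iet3_orbit e l v w p q by (rule orb)
  obtain k where k: "E1 * p k + E2 * q k \<le> r + E1 * P0" "r + E1 * P0 < E1 * p (k + 1) + E2 * q (k + 1)"
    using increasing_sequence_bracket[of "min E1 E2" "\<lambda>n. E1 * p n + E2 * q n" "r + E1 * P0"] E v.form_succ[OF E]
    by auto
  have "\<not> (K0 \<le> k \<and> k < K1)"
  proof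
    assume "K0 \<le> k \<and> k < K1"
    then have "E1 * p K0 + E2 * q K0 \<le> E1 * p k + E2 * q k" "E1 * p (k + 1) + E2 * q (k + 1) \<le> E1 * p K1 + E2 * q K1"
      unfolding v.form_strict_mono(2)[OF E] by auto
    then show False using k K(1,2) r by (auto simp: algebra_simps)
  qed
  then have "v k \<notin> {0, d1, e}" using K(3) by blast
  then show thesis using that[of "p k - P0" "q k" "w k"] v.x_in[of k] k unfolding v[of k] v.p_succ v.q_succ
    by (auto simp: algebra_simps)
qed

text \<open>The gap after a non-singular point of the same orbit lies entirely on one side of
  \<open>[lo, hi]\<close>. Strictness at both ends of the gap is what admits the boundary values
  \<open>r = lo\<close> and \<open>r = hi\<close>, and hence the closed inequalities of the
  theorem.\<close>

lemma singular_gap_unique: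
  fixes E1 E2 :: real
  assumes E: "E1 > 0" "E2 > 0"
    and b: "b = 0 \<and> lo = - E2 \<and> hi = E1 \<or> b = l \<and> lo = - E1 \<and> hi = E2"
    and r: "lo \<le> r" "r \<le> hi"
    and y: "b + val P Q \<in> J i" "b + val P Q \<notin> {0, d1, e}"
  shows "\<not> (E1 * P + E2 * Q < r \<and> r < E1 * (P + step1 i) + E2 * (Q + step3 i))"
proof
  assume PQ: "E1 * P + E2 * Q < r \<and> r < E1 * (P + step1 i) + E2 * (Q + step3 i)"
  obtain v w p q P0 K0 K1 where orb: "iet3_orbit e l v w p q"
    and v: "\<And>n. v n = b + val (p n - P0) (q n)"
    and K: "E1 * (p K0 - P0) + E2 * q K0 = lo" "E1 * (p K1 - P0) + E2 * q K1 = hi"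
    "\<And>n. v n \<in> {0, d1, e} \<longleftrightarrow> K0 \<le> n \<and> n < K1"
    using singular_orbit[OF b] by blast
  interpret v: iet3_orbit e l v w p q by (rule orb)
  have "v 0 + val (P + P0) Q = b + val P Q" using v[of 0] by (simp add: val_def algebra_simps)
  then obtain k where k: "p k = P + P0" "q k = Q" "v k = b + val P Q"
    using v.visits[of 0 "P + P0" Q] J_bounds[OF y(1)] v.p_0 v.q_0 by auto
  have "w k = i" using y k by (intro v.u_eqI) simp
  have "E1 * p k + E2 * q k < E1 * p K1 + E2 * q K1" "E1 * p K0 + E2 * q K0 < E1 * p (k + 1) + E2 * q (k + 1)"
    using PQ K(1,2) r k v.p_succ[of k] v.q_succ[of k] \<open>w k = i\<close> by (auto simp: algebra_simps)
  then have "k < K1" "K0 < k + 1" unfolding v.form_strict_mono(1)[OF E] by auto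
  then show False using K(3)[of k] k y(2) by auto
qed

lemma J_interior:
  assumes "v \<in> J i" "v \<notin> {0, d1, e}"
  obtains \<theta> where "\<theta> > 0" "\<And>w. v - \<theta> \<le> w \<Longrightarrow> w < v + \<theta> \<Longrightarrow> w \<in> J i"
proof (cases i)
  case L1
  then show thesis using assms by (intro that[of "min v (d1 - v)"]) auto
next
  case L2
  then show thesis using assms by (intro that[of "min (v - d1) (e - v)"]) auto
next
  case L3
  then show thesis using assms by (intro that[of "min (v - e) (l - v)"]) auto
qed

end

context iet3_orbit
begin

section \<open>Constraints on displacements inside a block\<close>

lemma self_coding_window:
  fixes E1 E2 :: real
  assumes s: "self_coding s" and nk: "u n = u k" and E: "E1 > 0" "E2 > 0"
    and vis: "0 \<le> x (s n) + val P Q" "x (s n) + val P Q < l"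
    and F: "0 \<le> E1 * P + E2 * Q"
      "E1 * P + E2 * Q < E1 * (p (s (n + 1)) - p (s n)) + E2 * (q (s (n + 1)) - q (s n))"
  shows "0 \<le> x (s k) + val P Q \<and> x (s k) + val P Q < l"
proof -
  obtain j where j: "p j = p (s n) + P" "q j = q (s n) + Q" "x j = x (s n) + val P Q"
    using visits[OF vis] .
  have "E1 * p (s n) + E2 * q (s n) \<le> E1 * p j + E2 * q j"
    "E1 * p j + E2 * q j < E1 * p (s (n + 1)) + E2 * q (s (n + 1))"
    using F j by (auto simp: algebra_simps)
  then have "s n \<le> j" "j < s (n + 1)" unfolding form_strict_mono[OF E] by auto
  then have "x (s k) + val P Q = x (s k + (j - s n))"
    using self_coding_agree(3)[OF s nk, of j] j by simp
  then show ?thesis using x_bounds by simp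
qed

text \<open>Orbit points just left and just right of \<open>v\<close> carry the same letter, so
  their blocks contain the same displacements. But \<open>(P, Q)\<close> leads from their contracted
  images to opposite sides of the end point \<open>b\<close>, and only one of these sides belongs to
  \<open>[0, l)\<close>.\<close>

lemma self_coding_no_cut:
  fixes E1 E2 :: real
  assumes s: "self_coding s" and \<kappa>: "\<kappa> > 0" and xs: "\<And>n. x (s n) = x 0 + \<kappa> * (x n - x 0)"
    and E: "E1 > 0" "E2 > 0" and b: "b = 0 \<or> b = l"
    and v: "v \<in> J i" "v \<notin> {0, d1, e}"
    and eq: "x 0 + \<kappa> * (v - x 0) + val P Q = b"
    and F: "0 \<le> E1 * P + E2 * Q"
      "\<And>n. u n = i \<Longrightarrow> E1 * P + E2 * Q < E1 * (p (s (n + 1)) - p (s n)) + E2 * (q (s (n + 1)) - q (s n))"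
  shows False
proof -
  obtain \<theta>0 where \<theta>0: "\<theta>0 > 0" "\<And>w. v - \<theta>0 \<le> w \<Longrightarrow> w < v + \<theta>0 \<Longrightarrow> w \<in> J i" using J_interior[OF v] by blast
  \<comment> \<open>The second bound keeps the displaced point on the inner side of \<open>b\<close>
    from crossing the whole interval and leaving it at the other end.\<close>
  define \<theta> where "\<theta> = min \<theta>0 (l / \<kappa>)"
  have \<theta>: "\<theta> > 0" "\<theta> \<le> \<theta>0" "\<kappa> * \<theta> \<le> l" using \<theta>0 \<kappa> e_pos e_less_l by (auto simp: \<theta>_def min_def field_simps)
  have lo: "0 \<le> v - \<theta>"
    using \<theta>0(2)[of "v - \<theta>"] \<theta> J_bounds(1)[of "v - \<theta>" i] by auto
  have hi: "v + \<theta> / 2 < l" using \<theta>0(2)[of "v + \<theta> / 2"] \<theta> J_bounds(2)[of "v + \<theta> / 2" i] by auto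
  obtain n where n: "v - \<theta> \<le> x n" "x n < v" using dense[of "v - \<theta>" v] lo hi \<theta> by auto
  obtain k where k: "v \<le> x k" "x k < v + \<theta> / 2" using dense[of v "v + \<theta> / 2"] lo hi \<theta> by auto
  have un: "u n = i" and uk: "u k = i" using n k \<theta>0 \<theta> by (auto intro!: u_eqI)
  have xn: "x (s n) + val P Q = b - \<kappa> * (v - x n)" and xk: "x (s k) + val P Q = b + \<kappa> * (x k - v)"
    using eq xs[of n] xs[of k] by (simp_all add: algebra_simps)
  have "\<kappa> * (v - x n) \<le> \<kappa> * \<theta>" "\<kappa> * (x k - v) \<le> \<kappa> * (\<theta> / 2)" using n k \<kappa> by (auto intro!: mult_left_mono)
  moreover have "0 < \<kappa> * (v - x n)" "0 \<le> \<kappa> * (x k - v)" "\<kappa> * (\<theta> / 2) < \<kappa> * \<theta>" using n k \<kappa> \<theta> by auto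
  ultimately have "0 < \<kappa> * (v - x n)" "\<kappa> * (v - x n) \<le> l" "0 \<le> \<kappa> * (x k - v)" "\<kappa> * (x k - v) < l"
    using \<theta>(3) by linarith+
  then show False
    using b self_coding_window[OF s _ E _ _ F(1) F(2), of k n] self_coding_window[OF s _ E _ _ F(1) F(2), of n k]
    unfolding xn xk using un uk by auto
qed

section \<open>Renormalization\<close>

text \<open>The window condition says that between \<open>s n\<close> and \<open>s (n + 1)\<close> the same displacements occur
  for all \<open>n\<close> with the same letter; listing them in the order of the linear form recovers the block.\<close>

lemma self_coding_of_window:
  fixes E1 E2 :: real
  assumes E: "E1 > 0" "E2 > 0" and s0: "s 0 = 0" and mono: "strict_mono s"
    and pq: "\<And>n k. u n = u k \<Longrightarrow> E1 * (p (s (n + 1)) - p (s n)) + E2 * (q (s (n + 1)) - q (s n))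
      = E1 * (p (s (k + 1)) - p (s k)) + E2 * (q (s (k + 1)) - q (s k))"
    and window: "\<And>n k P Q. u n = u k \<Longrightarrow> 0 \<le> x (s n) + val P Q \<Longrightarrow> x (s n) + val P Q < l \<Longrightarrow>
      0 \<le> E1 * P + E2 * Q \<Longrightarrow>
      E1 * P + E2 * Q \<le> E1 * (p (s (n + 1)) - p (s n)) + E2 * (q (s (n + 1)) - q (s n)) \<Longrightarrow>
      0 \<le> x (s k) + val P Q \<and> x (s k) + val P Q < l"
  shows "self_coding s"
proof -
  define F where "F n = E1 * p n + E2 * q n" for n
  have Fless: "F n < F k \<longleftrightarrow> n < k" and Fle: "F n \<le> F k \<longleftrightarrow> n \<le> k" for n k
    unfolding F_def by (rule form_strict_mono[OF E])+
  have Fgap: "F (s (n + 1)) - F (s n) = F (s (k + 1)) - F (s k)" if "u n = u k" for n k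
    using pq[OF that] by (simp add: F_def algebra_simps)
  \<comment> \<open>Of the two next points, take the one nearer in the form. The window condition
    makes its displacement visible in the other block, where no orbit point can precede it, so it is
    the next point there as well.\<close>
  have next_pos: "p (s n + j + 1) - p (s n) = p (s k + j + 1) - p (s k) \<and>
      q (s n + j + 1) - q (s n) = q (s k + j + 1) - q (s k)"
    if nk: "u n = u k" and eq: "p (s n + j) - p (s n) = p (s k + j) - p (s k)"
      "q (s n + j) - q (s n) = q (s k + j) - q (s k)"
      and j: "0 \<le> j" "s n + j < s (n + 1)"
      and le: "F (s n + j + 1) - F (s n) \<le> F (s k + j + 1) - F (s k)" for n k j
  proof -
    define P Q where "P = p (s n + j + 1) - p (s n)" and "Q = q (s n + j + 1) - q (s n)"
    have FPQ: "E1 * P + E2 * Q = F (s n + j + 1) - F (s n)"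
      by (simp add: P_def Q_def F_def algebra_simps)
    have xn: "x (s n) + val P Q = x (s n + j + 1)"
      using x_diff[of "s n + j + 1" "s n"] by (simp add: P_def Q_def)
    have "F (s n) \<le> F (s n + j + 1)" "F (s n + j + 1) \<le> F (s (n + 1))" using j by (auto simp: Fle)
    then have PQ: "0 \<le> E1 * P + E2 * Q"
      "E1 * P + E2 * Q \<le> E1 * (p (s (n + 1)) - p (s n)) + E2 * (q (s (n + 1)) - q (s n))"
      unfolding FPQ by (auto simp: F_def algebra_simps)
    have "0 \<le> x (s k) + val P Q" "x (s k) + val P Q < l"
      using window[OF nk _ _ PQ] x_bounds[of "s n + j + 1"] unfolding xn by auto
    then obtain i where i: "p i = p (s k) + P" "q i = q (s k) + Q" using visits by blast
    have Fi: "F i = F (s k) + (F (s n + j + 1) - F (s n))"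
      using i FPQ by (simp add: F_def algebra_simps)
    have "F (s n + j) - F (s n) = F (s k + j) - F (s k)"
    proof -
      have "F (s n + j) - F (s n) = E1 * (p (s n + j) - p (s n)) + E2 * (q (s n + j) - q (s n))"
        by (simp add: F_def algebra_simps)
      also have "\<dots> = F (s k + j) - F (s k)" unfolding eq by (simp add: F_def algebra_simps)
      finally show ?thesis .
    qed
    moreover have "F (s n + j) < F (s n + j + 1)" by (simp add: Fless)
    ultimately have "F (s k + j) < F i" using Fi by simp
    moreover have "F i \<le> F (s k + j + 1)" using Fi le by simp
    ultimately have "i = s k + j + 1" unfolding Fless Fle by simp
    then show ?thesis using i by (simp add: P_def Q_def)
  qed
  have agree: "p (s n + int j) - p (s n) = p (s k + int j) - p (s k) \<and>
      q (s n + int j) - q (s n) = q (s k + int j) - q (s k) \<and> s k + int j \<le> s (k + 1)"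
    if nk: "u n = u k" and "s n + int j \<le> s (n + 1)" for n k j
    using that(2)
  proof (induction j)
    case 0
    then show ?case using strict_monoD[OF mono, of k "k + 1"] by simp
  next
    case (Suc j)
    let ?j = "int j"
    have IH: "p (s n + ?j) - p (s n) = p (s k + ?j) - p (s k)"
      "q (s n + ?j) - q (s n) = q (s k + ?j) - q (s k)" using Suc by auto
    have Feq: "F (s n + ?j) - F (s n) = F (s k + ?j) - F (s k)"
    proof -
      have "F (s n + ?j) - F (s n) = E1 * (p (s n + ?j) - p (s n)) + E2 * (q (s n + ?j) - q (s n))"
        by (simp add: F_def algebra_simps)
      also have "\<dots> = F (s k + ?j) - F (s k)" unfolding IH by (simp add: F_def algebra_simps)
      finally show ?thesis .
    qed
    have jn: "s n + ?j < s (n + 1)" using Suc.prems by simp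
    then have "F (s n + ?j) < F (s (n + 1))" by (simp add: Fless)
    then have "F (s k + ?j) < F (s (k + 1))" using Feq Fgap[OF nk] by linarith
    then have jk: "s k + ?j < s (k + 1)" by (simp add: Fless)
    have "p (s n + ?j + 1) - p (s n) = p (s k + ?j + 1) - p (s k) \<and>
      q (s n + ?j + 1) - q (s n) = q (s k + ?j + 1) - q (s k)"
    proof (cases "F (s n + ?j + 1) - F (s n) \<le> F (s k + ?j + 1) - F (s k)")
      case True
      then show ?thesis using next_pos[OF nk IH _ jn] by simp
    next
      case False
      then show ?thesis using next_pos[OF nk[symmetric] IH[symmetric] _ jk] by simp
    qed
    then show ?case using jk by (simp add: add.assoc add.commute[of 1])
  qed
  have step: "s n < s (n + 1)" for n using strict_monoD[OF mono, of n "n + 1"] by simp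
  have le: "s (n + 1) - s n \<le> s (k + 1) - s k" if "u n = u k" for n k
    using agree[OF that, of "nat (s (n + 1) - s n)"] step[of n] by simp
  have "u (s n + i) = u (s k + i)" if nk: "u n = u k" and i: "0 \<le> i" "i < s (n + 1) - s n" for n k i
  proof (rule step_inject)
    define j where "j = nat i"
    have j: "i = int j" "s n + int j \<le> s (n + 1)" "s n + int (Suc j) \<le> s (n + 1)" using i by (auto simp: j_def)
    note A = agree[OF nk j(2)] agree[OF nk j(3)]
    have Suc: "s m + int (Suc j) = s m + int j + 1" for m by simp
    show "step1 (u (s n + i)) = step1 (u (s k + i))"
      using A unfolding Suc p_succ j(1) by linarith
    show "step3 (u (s n + i)) = step3 (u (s k + i))"
      using A unfolding Suc q_succ j(1) by linarith
  qed
  moreover have "s (n + 1) - s n = s (k + 1) - s k" if "u n = u k" for n k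
    using le[OF that] le[OF that[symmetric]] by simp
  ultimately show ?thesis unfolding self_coding_def using s0 mono by blast
qed

text \<open>By \<open>mult\<close> and \<open>div\<close>, \<kappa> acts invertibly on the module
  and scales the form by \<kappa>'. Convexity keeps the contracted orbit in \<open>[0, l)\<close>,
  so \<open>s\<close> exists and is increasing; \<open>sing\<close> enters only to exclude that a
  block is cut by an end point of the interval.\<close>

lemma renormalization:
  fixes E1 E2 \<kappa> \<kappa>' :: real
  assumes E: "E1 > 0" "E2 > 0" and \<kappa>: "0 < \<kappa>" "\<kappa> < 1" and \<kappa>': "\<kappa>' > 0"
    and mult: "\<And>P Q. \<exists>P' Q'. \<kappa> * val P Q = val P' Q' \<and> E1 * P' + E2 * Q' = \<kappa>' * (E1 * P + E2 * Q)"
    and div: "\<And>P Q. \<exists>P' Q'. val P Q = \<kappa> * val P' Q' \<and> E1 * P + E2 * Q = \<kappa>' * (E1 * P' + E2 * Q')"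
    and sing: "\<And>b lo hi. b = 0 \<and> lo = - E2 \<and> hi = E1 \<or> b = l \<and> lo = - E1 \<and> hi = E2 \<Longrightarrow>
      \<exists>A B. (1 - 1 / \<kappa>) * (x 0 - b) = val A B \<and> lo \<le> E1 * A + E2 * B \<and> E1 * A + E2 * B \<le> hi"
  obtains s where "self_coding s"
    "\<And>n. E1 * p (s n) + E2 * q (s n) = \<kappa>' * (E1 * p n + E2 * q n)"
proof -
  have "\<exists>k. x k = x 0 + \<kappa> * (x n - x 0) \<and> E1 * p k + E2 * q k = \<kappa>' * (E1 * p n + E2 * q n)" for n
  proof -
    obtain P Q where PQ: "\<kappa> * val (p n) (q n) = val P Q" "E1 * P + E2 * Q = \<kappa>' * (E1 * p n + E2 * q n)"
      using mult by blast
    have eq: "x 0 + val P Q = x 0 + \<kappa> * (x n - x 0)" using x_diff[of n 0] PQ(1) by simp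
    have "x 0 + \<kappa> * (x n - x 0) = (1 - \<kappa>) * x 0 + \<kappa> * x n" by (simp add: algebra_simps)
    moreover have "0 \<le> (1 - \<kappa>) * x 0" "0 \<le> \<kappa> * x n" "(1 - \<kappa>) * x 0 < (1 - \<kappa>) * l" "\<kappa> * x n \<le> \<kappa> * l"
      using \<kappa> x_bounds[of 0] x_bounds[of n] by auto
    moreover have "(1 - \<kappa>) * l + \<kappa> * l = l" by (simp add: algebra_simps)
    ultimately have "0 \<le> x 0 + val P Q" "x 0 + val P Q < l" unfolding eq by linarith+
    then obtain k where "p k = p 0 + P" "q k = q 0 + Q" "x k = x 0 + val P Q" using visits by blast
    then show ?thesis using eq PQ(2) by (intro exI[of _ k]) simp
  qed
  then obtain s where xs: "\<And>n. x (s n) = x 0 + \<kappa> * (x n - x 0)"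
    and Fs: "\<And>n. E1 * p (s n) + E2 * q (s n) = \<kappa>' * (E1 * p n + E2 * q n)" by metis
  have s0: "s 0 = 0" using x_inject[of "s 0" 0] xs[of 0] by simp
  have mono: "strict_mono s"
  proof (rule strict_monoI)
    fix n k :: int assume "n < k"
    then have "E1 * p n + E2 * q n < E1 * p k + E2 * q k" unfolding form_strict_mono(1)[OF E] .
    then have "E1 * p (s n) + E2 * q (s n) < E1 * p (s k) + E2 * q (s k)"
      unfolding Fs using \<kappa>' by simp
    then show "s n < s k" unfolding form_strict_mono(1)[OF E] .
  qed
  have gap: "E1 * (p (s (n + 1)) - p (s n)) + E2 * (q (s (n + 1)) - q (s n))
      = \<kappa>' * (E1 * step1 (u n) + E2 * step3 (u n))" for n
    using Fs[of n] Fs[of "n + 1"] unfolding p_succ q_succ by (simp add: algebra_simps)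
  have "self_coding s"
  proof (rule self_coding_of_window[where ?E1.0 = E1 and ?E2.0 = E2, OF E s0 mono])
    show "E1 * (p (s (n + 1)) - p (s n)) + E2 * (q (s (n + 1)) - q (s n))
      = E1 * (p (s (k + 1)) - p (s k)) + E2 * (q (s (k + 1)) - q (s k))" if "u n = u k" for n k
      unfolding gap that ..
    fix n k P Q
    assume nk: "u n = u k" and vis: "0 \<le> x (s n) + val P Q" "x (s n) + val P Q < l"
      and F: "0 \<le> E1 * P + E2 * Q"
        "E1 * P + E2 * Q \<le> E1 * (p (s (n + 1)) - p (s n)) + E2 * (q (s (n + 1)) - q (s n))"
    define \<Delta> where "\<Delta> = E1 * step1 (u n) + E2 * step3 (u n)"
    obtain P1 Q1 where 1: "val P Q = \<kappa> * val P1 Q1" "E1 * P + E2 * Q = \<kappa>' * (E1 * P1 + E2 * Q1)"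
      using div by blast
    have F1: "0 \<le> E1 * P1 + E2 * Q1" "E1 * P1 + E2 * Q1 \<le> \<Delta>"
      using F \<kappa>' unfolding gap 1(2) \<Delta>_def[symmetric] by (auto simp: zero_le_mult_iff)
    obtain j where j: "p j = p (s n) + P" "q j = q (s n) + Q" "x j = x (s n) + val P Q"
      using visits[OF vis] .
    have Fj: "E1 * p j + E2 * q j = E1 * p (s n) + E2 * q (s n) + \<kappa>' * (E1 * P1 + E2 * Q1)"
      using j 1(2) by (simp add: algebra_simps)
    show "0 \<le> x (s k) + val P Q \<and> x (s k) + val P Q < l"
    proof (rule ccontr)
      assume out: "\<not> (0 \<le> x (s k) + val P Q \<and> x (s k) + val P Q < l)"
      \<comment> \<open>The two extreme displacements, none and that of the whole block, occur in
        each block of the letter. The offending one is therefore strictly between, as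
        \<open>singular_gap_unique\<close> demands.\<close>
      have "E1 * P1 + E2 * Q1 \<noteq> 0"
      proof
        assume "E1 * P1 + E2 * Q1 = 0"
        then have "j = s n" using Fj form_strict_mono(2)[OF E, of j "s n"] form_strict_mono(2)[OF E, of "s n" j] by simp
        then show False using j out x_bounds[of "s k"] by simp
      qed
      moreover have "E1 * P1 + E2 * Q1 \<noteq> \<Delta>"
      proof
        assume "E1 * P1 + E2 * Q1 = \<Delta>"
        then have "E1 * p j + E2 * q j = E1 * p (s (n + 1)) + E2 * q (s (n + 1))"
          using Fj gap[of n] unfolding \<Delta>_def by (simp add: algebra_simps)
        then have "j = s (n + 1)"
          using form_strict_mono(2)[OF E, of j "s (n + 1)"] form_strict_mono(2)[OF E, of "s (n + 1)" j] by simp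
        then have "val P Q = \<kappa> * (x (n + 1) - x n)" using j(3) xs[of n] xs[of "n + 1"] by (simp add: algebra_simps)
        also have "x (n + 1) - x n = x (k + 1) - x k" using x_succ[of n] x_succ[of k] nk by simp
        finally have "x (s k) + val P Q = x (s (k + 1))" using xs[of k] xs[of "k + 1"] by (simp add: algebra_simps)
        then show False using out x_bounds[of "s (k + 1)"] by simp
      qed
      ultimately have F2: "0 < E1 * P1 + E2 * Q1" "E1 * P1 + E2 * Q1 < \<Delta>" using F1 by auto
      obtain b lo hi where b: "b = 0 \<and> lo = - E2 \<and> hi = E1 \<or> b = l \<and> lo = - E1 \<and> hi = E2"
        and sep: "x (s k) + val P Q < b \<and> b \<le> x (s n) + val P Q \<or> x (s n) + val P Q < b \<and> b \<le> x (s k) + val P Q"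
      proof (cases "x (s k) + val P Q < 0")
        case True then show thesis using that[of 0 "- E2" E1] vis by simp
      next
        case False then show thesis using that[of l "- E1" E2] vis out by simp
      qed
      obtain A B where AB: "(1 - 1 / \<kappa>) * (x 0 - b) = val A B" "lo \<le> E1 * A + E2 * B" "E1 * A + E2 * B \<le> hi"
        using sing[OF b] by blast
      \<comment> \<open>The solution of \<open>x 0 + \<kappa> * (y - x 0) + val P Q = b\<close>, the
        point at which the window condition switches. It separates two orbit points with the letter
        \<open>u n\<close>, hence is interior to that interval, and the form value of
        \<open>(A, B)\<close> falls into the gap following it.\<close>
      define y where "y = b + val (A - P1) (B - Q1)"
      have ky: "\<kappa> * (y - x 0) = b - val P Q - x 0"
      proof -
        have "y - x 0 = (1 - 1 / \<kappa>) * (x 0 - b) - val P1 Q1 - (x 0 - b)"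
          unfolding y_def val_diff AB(1)[symmetric] by simp
        moreover have "\<kappa> * (t * w - v - w) = \<kappa> * t * w - \<kappa> * v - \<kappa> * w" for t v w :: real
          by (simp add: algebra_simps)
        ultimately have "\<kappa> * (y - x 0) = \<kappa> * (1 - 1 / \<kappa>) * (x 0 - b) - \<kappa> * val P1 Q1 - \<kappa> * (x 0 - b)"
          by (simp only:)
        moreover have "\<kappa> * (1 - 1 / \<kappa>) = \<kappa> - 1" using \<kappa> by (simp add: field_simps)
        ultimately show ?thesis unfolding 1(1) by (simp add: algebra_simps)
      qed
      have cmp: "x m < y \<longleftrightarrow> x (s m) + val P Q < b" for m
      proof -
        have "x m < y \<longleftrightarrow> \<kappa> * (x m - x 0) < \<kappa> * (y - x 0)" using \<kappa> by simp
        then show ?thesis unfolding ky xs by auto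
      qed
      obtain m m' where m: "u m = u n" "u m' = u n" "x m < y" "y \<le> x m'"
        using sep cmp[of n] cmp[of k] nk by (metis not_less)
      have yJ: "y \<in> J (u n)" using J_convex[of "x m" "u n" "x m'" y] x_in[of m] x_in[of m'] m by simp
      have "y \<notin> {0, d1, e}"
        using m x_in[of m] d1_less_e d1_pos yJ by (cases "u n") auto
      then have "\<not> (E1 * (A - P1) + E2 * (B - Q1) < E1 * A + E2 * B \<and>
          E1 * A + E2 * B < E1 * (A - P1 + step1 (u n)) + E2 * (B - Q1 + step3 (u n)))"
        using singular_gap_unique[OF E b AB(2,3), of "A - P1" "B - Q1" "u n"] yJ unfolding y_def by simp
      then show False using F2 unfolding \<Delta>_def by (simp add: algebra_simps)
    qed
  qed
  then show thesis using that Fs by blast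
qed

end

section \<open>Arithmetic of self-codings\<close>

text \<open>The quadratic form has opposite signs at 0 and 1, hence exactly one root between them.\<close>

lemma quadratic_conjugate_outside:
  fixes e e' :: real and a b c d :: int
  assumes e: "e \<notin> \<rat>" "0 < e" "e < 1" and bc: "b > 0" "c > 0"
    and eq: "(d - a) * e * (1 - e) + c * e\<^sup>2 - b * (1 - e)\<^sup>2 = 0"
  defines "e' \<equiv> algebraic_conjugate e"
  shows "quadratic_irrational e" "e' < 0 \<or> 1 < e'"
    "(d - a) * e' * (1 - e') + c * e'\<^sup>2 - b * (1 - e')\<^sup>2 = 0"
proof -
  define A B where "A = a - d + c - b" and "B = d - a + 2 * b"
  have Q: "(d - a) * y * (1 - y) + c * y\<^sup>2 - b * (1 - y)\<^sup>2 = A * y\<^sup>2 + B * y - b" for y :: real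
    by (simp add: A_def B_def power2_eq_square algebra_simps)
  have "A \<noteq> 0"
  proof
    assume "A = 0"
    then have "b + (- B) * e = 0 + 0 * e" using eq unfolding Q by simp
    with rat_lin_unique[OF e(1), of b "- B" 0 0] bc show False by simp
  qed
  define s t where "s = - B / real_of_int A" and "t = b / real_of_int A"
  have st: "s \<in> \<rat>" "t \<in> \<rat>" by (auto simp: s_def t_def)
  have e2: "y\<^sup>2 = s * y + t \<longleftrightarrow> A * y\<^sup>2 + B * y - b = 0" for y :: real
    using \<open>A \<noteq> 0\<close> by (auto simp: s_def t_def field_simps)
  have es: "e\<^sup>2 = s * e + t" using eq unfolding e2 Q by simp
  have e': "e' = s - e" unfolding e'_def by (rule algebraic_conjugate_eq[OF e(1) st es])
  obtain s' t' where rat: "s = of_rat s'" "t = of_rat t'" using st by (auto elim!: Rats_cases)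
  have "poly (map_poly of_rat [:- t', - s', 1:]) e = 0"
    using es by (simp add: map_poly_pCons rat of_rat_minus power2_eq_square algebra_simps)
  then show "quadratic_irrational e" unfolding quadratic_irrational_def using e(1)
    by (intro conjI exI[of _ "[:- t', - s', 1:]"]) auto
  have "e'\<^sup>2 = s * e' + t" using es unfolding e' by (simp add: power2_eq_square algebra_simps)
  then show "(d - a) * e' * (1 - e') + c * e'\<^sup>2 - b * (1 - e')\<^sup>2 = 0" unfolding e2 Q by simp
  have "e * e' = - t" unfolding e' using es by (simp add: power2_eq_square algebra_simps)
  \<comment> \<open>This product and \<open>A * ((1 - e) * (1 - e'))\<close> are the values at 0 and
    1 of the polynomial with roots \<open>e\<close> and \<open>e'\<close>, namely \<open>- b\<close>
    and \<open>c\<close>.\<close>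
  then have 1: "A * (e * e') = - b" using \<open>A \<noteq> 0\<close> by (simp add: t_def)
  have "A * ((1 - e) * (1 - e')) = A - A * (e + e') + A * (e * e')" by (simp add: algebra_simps)
  also have "\<dots> = A + B - b" unfolding 1 unfolding e' using \<open>A \<noteq> 0\<close> by (simp add: s_def)
  also have "\<dots> = c" by (simp add: A_def B_def)
  finally have 2: "A * ((1 - e) * (1 - e')) = c" .
  show "e' < 0 \<or> 1 < e'"
  proof (rule ccontr)
    assume "\<not> (e' < 0 \<or> 1 < e')"
    then have "0 \<le> e * e'" "0 \<le> (1 - e) * (1 - e')" using e by auto
    then have "A \<ge> 0 \<longrightarrow> 0 \<le> A * (e * e')" "A \<le> 0 \<longrightarrow> A * ((1 - e) * (1 - e')) \<le> 0"
      by (auto simp: mult_nonpos_nonneg)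
    then show False using 1 2 bc by linarith
  qed
qed

context iet3
begin

definition M :: "real set" where "M = {y. \<exists>P Q. y = val P Q}"

lemma M_add: "y \<in> M \<Longrightarrow> z \<in> M \<Longrightarrow> y + z \<in> M" and M_diff: "y \<in> M \<Longrightarrow> z \<in> M \<Longrightarrow> y - z \<in> M"
  unfolding M_def using val_add val_diff by (auto, metis+)

lemma l_notin_M: "l \<notin> M"
proof
  assume "l \<in> M"
  then obtain P Q where "l = val P Q" by (auto simp: M_def)
  then show False using l_generic[of P "- P - Q"] by (simp add: val_eq)
qed

lemma val_in_M: "val P Q \<in> M"
  by (auto simp: M_def)

lemma e_in_M: "e \<in> M" and one_in_M: "1 \<in> M"
  using val_in_M[of 0 "-1"] val_in_M[of 1 "-1"] by (simp_all add: val_def)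

end

context iet3_orbit
begin

text \<open>An expanding \<kappa> would spread the images of points near the two ends beyond the
  length \<open>l\<close>. The values 0 and 1 would make \<open>s\<close> non-injective or the
  identity. If \<open>b\<close> or \<open>c\<close> were 0, then \<kappa> would be a non-negative
  integer; with both nonzero it is not an integer at all, which also excludes -1.\<close>

lemma self_coding_contraction:
  assumes s: "self_coding s" and nontriv: "\<exists>n. s n \<noteq> n"
    and nonneg: "a \<ge> 0" "b \<ge> 0" "c \<ge> 0" "d \<ge> 0"
    and \<kappa>1: "\<kappa> * (1 - e) = val a c" and \<kappa>2: "- \<kappa> * e = val b d"
    and xs: "\<And>n. x (s n) = x 0 + \<kappa> * (x n - x 0)"
  shows "b > 0" "c > 0" "\<kappa> \<noteq> 0" "\<bar>\<kappa>\<bar> < 1"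
proof -
  have "\<bar>\<kappa>\<bar> \<le> 1"
  proof (rule ccontr)
    assume "\<not> \<bar>\<kappa>\<bar> \<le> 1"
    then have k: "\<bar>\<kappa>\<bar> > 1" by simp
    define \<eta> where "\<eta> = (l - l / \<bar>\<kappa>\<bar>) / 2"
    have "l > 0" using e_pos e_less_l by simp
    have "l / \<bar>\<kappa>\<bar> < l" using k \<open>l > 0\<close> by (simp add: field_simps)
    then have \<eta>: "0 < \<eta>" "\<eta> < l" using \<open>l > 0\<close> k unfolding \<eta>_def by (auto simp: field_simps) (smt (verit) mult_pos_pos)
    obtain n where n: "0 \<le> x n" "x n < \<eta>" using dense[of 0 \<eta>] \<eta> by auto
    obtain k where k': "l - \<eta> \<le> x k" "x k < l" using dense[of "l - \<eta>" l] \<eta> by auto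
    have "x k - x n > l / \<bar>\<kappa>\<bar>" using n k' unfolding \<eta>_def by argo
    then have "\<bar>\<kappa>\<bar> * (x k - x n) > l" using k by (simp add: field_simps)
    moreover have "0 \<le> x k - x n" using \<open>x k - x n > l / \<bar>\<kappa>\<bar>\<close> \<open>l > 0\<close> k by (smt (verit) divide_pos_pos)
    ultimately have "\<bar>\<kappa> * (x k - x n)\<bar> > l" by (simp add: abs_mult)
    moreover have "\<kappa> * (x k - x n) = x (s k) - x (s n)" unfolding xs by (simp add: algebra_simps)
    ultimately show False using x_bounds[of "s k"] x_bounds[of "s n"] by auto
  qed
  have not_nat: "\<kappa> \<noteq> of_int m" if "m \<ge> 0" for m
  proof
    assume m: "\<kappa> = of_int m"
    then have "m = 0 \<or> m = 1" using \<open>\<bar>\<kappa>\<bar> \<le> 1\<close> that by auto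
    then show False
    proof
      assume "m = 0"
      then have "s 1 = s 0" using x_inject[of "s 1" "s 0"] xs[of 1] xs[of 0] m by simp
      then show False using strict_monoD[OF self_codingD(2)[OF s], of 0 1] by simp
    next
      assume "m = 1"
      have "s n = n" for n
      proof (rule x_inject)
        show "x (s n) = x n" using xs[of n] m \<open>m = 1\<close> by simp
      qed
      then show False using nontriv by blast
    qed
  qed
  have "c \<noteq> 0"
  proof
    assume "c = 0"
    then have "\<kappa> = of_int a" using \<kappa>1 e_less_1 by (simp add: val_def)
    then show False using not_nat nonneg by blast
  qed
  then show "c > 0" using nonneg by simp
  have "b \<noteq> 0"
  proof
    assume "b = 0"
    then have "\<kappa> = of_int d" using \<kappa>2 e_pos by (simp add: val_def)
    then show False using not_nat nonneg by blast
  qed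
  then show "b > 0" using nonneg by simp
  have not_int: "\<kappa> \<noteq> of_int m" for m
  proof
    assume "\<kappa> = of_int m"
    then have "val a c = val m 0" using \<kappa>1 by (simp add: val_def)
    then show False using val_inject \<open>c \<noteq> 0\<close> by blast
  qed
  show "\<kappa> \<noteq> 0" "\<bar>\<kappa>\<bar> < 1" using not_int[of 0] not_int[of 1] not_int[of "-1"] \<open>\<bar>\<kappa>\<bar> \<le> 1\<close> by auto
qed

lemma J_nonempty_below:
  assumes "y < Sup (J i)" obtains n where "u n = i" "y \<le> x n"
proof -
  have *: "\<exists>n. u n = i \<and> y \<le> x n" if J: "J i = {lo..<hi}" and b: "0 \<le> lo" "lo < hi" "hi \<le> l" for lo hi
  proof -
    have "Sup (J i) = hi" using J b by (simp add: cSup_atLeastLessThan)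
    have "0 \<le> max lo y" "max lo y < hi" using assms b \<open>Sup (J i) = hi\<close> by auto
    then obtain n where "max lo y \<le> x n" "x n < hi" using dense[of "max lo y" hi] b by blast
    then show ?thesis using u_eqI[of n i] J by auto
  qed
  have "\<exists>n. u n = i \<and> y \<le> x n"
    using *[of 0 d1] *[of d1 e] *[of e l] d1_pos d1_less_e e_pos e_less_l by (cases i) auto
  then show thesis using that by blast
qed

lemma Sup_J: "Sup (J L1) = d1" "Sup (J L2) = e" "Sup (J L3) = l"
  using d1_pos d1_less_e e_less_l by (auto simp: cSup_atLeastLessThan)

lemma J_less_Sup: "y \<in> J i \<Longrightarrow> y < Sup (J i)"
  using Sup_J by (cases i) auto

lemma block_length_bounded:
  assumes s: "self_coding s"
  obtains N :: int where "\<And>n. s (n + 1) - s n \<le> N"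
proof -
  define len where "len i = s ((SOME n. u n = i) + 1) - s (SOME n. u n = i)" for i
  have len: "s (n + 1) - s n = len (u n)" for n
    unfolding len_def by (rule self_codingD(3)[OF s]) (metis (mono_tags) someI)
  have "s (n + 1) - s n \<le> max (len L1) (max (len L2) (len L3))" for n
    unfolding len by (cases "u n") auto
  then show thesis using that by blast
qed

text \<open>The orbit is the union of the finitely many translates of the contracted pieces; the
  discontinuity at the right end of \<open>J i\<close> cannot be interior to a translate, and so is one of
  their right end points.\<close>

lemma self_coding_endpoints:
  assumes s: "self_coding s" and \<kappa>: "\<kappa> > 0" and xs: "\<And>n. x (s n) = x 0 + \<kappa> * (x n - x 0)"
  obtains j P Q where "Sup (J i) = x 0 + \<kappa> * (Sup (J j) - x 0) + val P Q"
proof -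
  obtain N where N: "\<And>n. s (n + 1) - s n \<le> N" using block_length_bounded[OF s] by blast
  \<comment> \<open>Block lengths are bounded, so only finitely many translates exist. With
    \<open>x n\<close> closer than \<theta> to the right end of \<open>J i\<close>, the right end of
    the translate containing \<open>x n\<close> is trapped in between and must coincide with that of
    \<open>J i\<close>.\<close>
  define S where "S = (\<lambda>(P, Q, j). Sup (J i) - (x 0 + \<kappa> * (Sup (J j) - x 0) + val P Q)) ` ({0..2 * N} \<times> {0..2 * N} \<times> {L1, L2, L3})"
  have "finite S" by (simp add: S_def)
  then obtain \<theta> where \<theta>: "\<theta> > 0" "\<And>y. y \<in> S \<Longrightarrow> y \<noteq> 0 \<Longrightarrow> \<bar>y\<bar> \<ge> \<theta>"
    using finite_reals_separated by metis
  obtain n where n: "u n = i" "Sup (J i) - \<theta> / 2 \<le> x n" using J_nonempty_below[of "Sup (J i) - \<theta> / 2" i] \<theta> by auto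
  obtain k where k: "s k \<le> n" "n < s (k + 1)" using strict_mono_int_bracket[OF self_codingD(2)[OF s]] .
  define P Q j where "P = p n - p (s k)" and "Q = q n - q (s k)" and "j = u k"
  have "P \<ge> 0" "Q \<ge> 0" "P + Q \<le> 2 * N"
    using p_mono[OF k(1)] q_mono[OF k(1)] pq_increments(2)[OF k(1)] N[of k] k by (auto simp: P_def Q_def)
  moreover have "j \<in> {L1, L2, L3}" by (cases j) auto
  ultimately have inS: "Sup (J i) - (x 0 + \<kappa> * (Sup (J j) - x 0) + val P Q) \<in> S"
    unfolding S_def by (intro image_eqI[of _ _ "(P, Q, j)"]) auto
  have xn: "x n = x (s k) + val P Q" using x_diff[of n "s k"] by (simp add: P_def Q_def)
  have "\<kappa> * (x k - x 0) < \<kappa> * (Sup (J j) - x 0)" using J_less_Sup[OF x_in[of k]] \<kappa> by (simp add: j_def)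
  then have "x n < x 0 + \<kappa> * (Sup (J j) - x 0) + val P Q" unfolding xn xs by simp
  moreover have "x 0 + \<kappa> * (Sup (J j) - x 0) + val P Q \<le> Sup (J i)"
  proof (rule ccontr)
    assume "\<not> ?thesis"
    then have "(Sup (J i) - val P Q - x 0) / \<kappa> + x 0 < Sup (J j)" using \<kappa> by (simp add: field_simps)
    then obtain m where m: "u m = j" "(Sup (J i) - val P Q - x 0) / \<kappa> + x 0 \<le> x m" using J_nonempty_below by blast
    have "u (s m + (n - s k)) = u (s k + (n - s k))"
      using self_codingD(4)[OF s, of k m "n - s k"] m k by (simp add: j_def)
    then have "x (s m + (n - s k)) < Sup (J i)"
      using J_less_Sup[OF x_in[of "s m + (n - s k)"]] n by simp
    moreover have "x (s m + (n - s k)) = x (s m) + val P Q"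
      using self_coding_agree(3)[OF s, of k m n] m k xn by (simp add: j_def)
    moreover have "\<kappa> * (x m - x 0) \<ge> Sup (J i) - val P Q - x 0" using m(2) \<kappa> by (simp add: field_simps)
    ultimately show False using xs[of m] by linarith
  qed
  ultimately have "Sup (J i) - (x 0 + \<kappa> * (Sup (J j) - x 0) + val P Q) = 0"
    using \<theta>(2)[OF inS] \<theta>(1) n(2) by linarith
  then show thesis using that[of j P Q] by simp
qed

text \<open>Modulo M each right end point is congruent to 0 or \<open>l\<close>, and
  \<open>self_coding_endpoints\<close> shows that both classes are hit when the contraction
  \<open>Y + \<kappa> * t\<close> is applied to 0 and \<open>l\<close>. Since the classes differ, it
  fixes or exchanges them, and its square fixes both; this is the origin of the factor with \<kappa>
  squared.\<close>

lemma self_coding_square_in_M: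
  assumes s: "self_coding s" and \<kappa>: "\<kappa> > 0" and xs: "\<And>n. x (s n) = x 0 + \<kappa> * (x n - x 0)"
    and \<kappa>M: "\<And>y. y \<in> M \<Longrightarrow> \<kappa> * y \<in> M"
  shows "(1 - \<kappa>\<^sup>2) * x 0 \<in> M" "(1 - \<kappa>\<^sup>2) * l \<in> M"
proof -
  define Y where "Y = (1 - \<kappa>) * x 0"
  have ends: "\<exists>t\<in>{0, l}. Y + \<kappa> * t - t0 \<in> M" if "t0 = 0 \<and> i = L2 \<or> t0 = l \<and> i = L1" for i t0
  proof -
    obtain j P Q where j: "Sup (J i) = x 0 + \<kappa> * (Sup (J j) - x 0) + val P Q"
      using self_coding_endpoints[OF s \<kappa> xs] .
    have "d1 - l \<in> M" "e - 0 \<in> M" "l - l \<in> M"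
      using e_in_M M_diff[OF e_in_M one_in_M] M_diff[OF one_in_M one_in_M] by (auto simp: d1_def)
    note M = this
    have i: "Sup (J i) - t0 \<in> M"
      using that M by (auto simp only: Sup_J)
    obtain t where t: "t \<in> {0, l}" "Sup (J j) - t \<in> M"
      using M Sup_J by (cases j) (metis insertI1 insertI2)+
    have "(Sup (J i) - t0) - \<kappa> * (Sup (J j) - t) - val P Q \<in> M"
      by (intro M_diff i \<kappa>M t val_in_M)
    moreover have "(Sup (J i) - t0) - \<kappa> * (Sup (J j) - t) - val P Q = Y + \<kappa> * t - t0"
      unfolding j Y_def by (simp add: algebra_simps)
    ultimately show ?thesis using t by auto
  qed
  obtain t where t0: "t \<in> {0, l}" "Y + \<kappa> * t - 0 \<in> M" using ends[of 0 L2] by blast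
  then have t: "t \<in> {0, l}" "Y + \<kappa> * t \<in> M" by simp_all
  obtain t' where t': "t' \<in> {0, l}" "Y + \<kappa> * t' - l \<in> M" using ends[of l L1] by blast
  have "t \<noteq> t'" using M_diff[OF t(2) t'(2)] l_notin_M by auto
  have sq: "(1 - \<kappa>\<^sup>2) * x 0 = Y + \<kappa> * Y" by (simp add: Y_def power2_eq_square algebra_simps)
  have "Y + \<kappa> * Y \<in> M \<and> (1 - \<kappa>\<^sup>2) * l \<in> M"
  proof (cases "t = 0")
    case True
    then have Y: "Y \<in> M" using t by simp
    have "Y + \<kappa> * l - l \<in> M" using True t' \<open>t \<noteq> t'\<close> by auto
    then have l1: "(1 - \<kappa>) * l \<in> M" using M_diff[OF Y] by (simp add: algebra_simps) (metis add_diff_cancel_left' diff_diff_eq2)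
    have "(1 - \<kappa>\<^sup>2) * l = (1 - \<kappa>) * l + \<kappa> * ((1 - \<kappa>) * l)" by (simp add: power2_eq_square algebra_simps)
    then show ?thesis using M_add[OF Y \<kappa>M[OF Y]] M_add[OF l1 \<kappa>M[OF l1]] by simp
  next
    case False
    then have 1: "Y + \<kappa> * l \<in> M" and 2: "Y - l \<in> M" using t t' \<open>t \<noteq> t'\<close> by auto
    have l1: "l + \<kappa> * l \<in> M" using M_diff[OF 1 2] by (simp add: algebra_simps)
    have "(1 - \<kappa>\<^sup>2) * l = (l + \<kappa> * l) - \<kappa> * (l + \<kappa> * l)" by (simp add: power2_eq_square algebra_simps)
    then have "(1 - \<kappa>\<^sup>2) * l \<in> M" using M_diff[OF l1 \<kappa>M[OF l1]] by simp
    moreover have "Y + \<kappa> * Y = (Y + \<kappa> * l) + \<kappa> * (Y - l)" by (simp add: algebra_simps)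
    then have "Y + \<kappa> * Y \<in> M" using M_add[OF 1 \<kappa>M[OF 2]] by (simp only:)
    ultimately show ?thesis by blast
  qed
  then show "(1 - \<kappa>\<^sup>2) * x 0 \<in> M" "(1 - \<kappa>\<^sup>2) * l \<in> M" unfolding sq by auto
qed

text \<open>Raising the substitution to the power \<open>N\<close> makes \<open>(1 - 1 / \<kappa>' ^ N) * \<phi>\<close> tend to \<open>\<phi>\<close>.\<close>

lemma self_coding_bounds:
  fixes E1 E2 \<kappa> \<kappa>' \<phi> :: real
  assumes s: "self_coding s" and \<kappa>: "\<kappa> > 0" and \<kappa>': "\<kappa>' > 1"
    and xs: "\<And>n. x (s n) = x 0 + \<kappa> * (x n - x 0)"
    and E: "E1 > 0" "E2 > 0"
    and Fs: "\<And>n. E1 * p (s n) + E2 * q (s n) = \<kappa>' * (E1 * p n + E2 * q n)"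
    and mult: "\<And>P Q. \<exists>P' Q'. \<kappa> * val P Q = val P' Q' \<and> E1 * P' + E2 * Q' = \<kappa>' * (E1 * P + E2 * Q)"
    and b: "b = 0 \<and> lo = - E2 \<and> hi = E1 \<or> b = l \<and> lo = - E1 \<and> hi = E2"
    and base: "\<exists>A B. (1 - \<kappa>) * (x 0 - b) = val A B \<and> E1 * A + E2 * B = (1 - \<kappa>') * \<phi>"
  shows "lo \<le> \<phi> \<and> \<phi> \<le> hi"
proof -
  have S: "self_coding (s ^^ N)" for N by (rule self_coding_funpow[OF s])
  have xS: "x ((s ^^ N) n) = x 0 + \<kappa> ^ N * (x n - x 0)" for N n
    by (induction N arbitrary: n) (simp_all add: xs)
  have FS: "E1 * p ((s ^^ N) n) + E2 * q ((s ^^ N) n) = \<kappa>' ^ N * (E1 * p n + E2 * q n)" for N n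
    by (induction N arbitrary: n) (simp_all add: Fs)
  have multN: "\<exists>P' Q'. \<kappa> ^ N * val P Q = val P' Q' \<and> E1 * P' + E2 * Q' = \<kappa>' ^ N * (E1 * P + E2 * Q)" for N P Q
  proof (induction N)
    case 0 show ?case by (intro exI[of _ P] exI[of _ Q]) simp
  next
    case (Suc N)
    then obtain P' Q' where *: "\<kappa> ^ N * val P Q = val P' Q'" "E1 * P' + E2 * Q' = \<kappa>' ^ N * (E1 * P + E2 * Q)" by blast
    show ?case using mult[of P' Q'] unfolding *(2) *(1)[symmetric] by (simp add: mult.assoc)
  qed
  have baseN: "\<exists>A B. (1 - \<kappa> ^ N) * (x 0 - b) = val A B \<and> E1 * A + E2 * B = (1 - \<kappa>' ^ N) * \<phi>" for N
  proof (induction N)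
    case 0 show ?case by (intro exI[of _ 0]) simp
  next
    case (Suc N)
    then obtain A B where AB: "(1 - \<kappa> ^ N) * (x 0 - b) = val A B" "E1 * A + E2 * B = (1 - \<kappa>' ^ N) * \<phi>" by blast
    obtain A' B' where AB': "(1 - \<kappa>) * (x 0 - b) = val A' B'" "E1 * A' + E2 * B' = (1 - \<kappa>') * \<phi>" using base by blast
    obtain P Q where PQ: "\<kappa> * val A B = val P Q" "E1 * P + E2 * Q = \<kappa>' * (E1 * A + E2 * B)" using mult by blast
    have "(1 - \<kappa> ^ Suc N) * (x 0 - b) = (1 - \<kappa>) * (x 0 - b) + \<kappa> * ((1 - \<kappa> ^ N) * (x 0 - b))"
      by (simp add: algebra_simps)
    then have "(1 - \<kappa> ^ Suc N) * (x 0 - b) = val (A' + P) (B' + Q)" unfolding AB AB' PQ val_add .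
    moreover have "E1 * (A' + P) + E2 * (B' + Q) = (1 - \<kappa>' ^ Suc N) * \<phi>"
    proof -
      have "E1 * (A' + P) + E2 * (B' + Q) = (E1 * A' + E2 * B') + (E1 * P + E2 * Q)" by (simp add: algebra_simps)
      also have "\<dots> = (1 - \<kappa>' ^ Suc N) * \<phi>" unfolding PQ AB AB' by (simp add: algebra_simps)
      finally show ?thesis .
    qed
    ultimately show ?case by (intro exI[of _ "A' + P"] exI[of _ "B' + Q"]) simp
  qed
  have bounds: "lo \<le> (1 - 1 / \<kappa>' ^ N) * \<phi> \<and> (1 - 1 / \<kappa>' ^ N) * \<phi> \<le> hi" for N
  proof (rule ccontr)
    define r where "r = (1 - 1 / \<kappa>' ^ N) * \<phi>"
    define c c' where "c = \<kappa> ^ N" and "c' = \<kappa>' ^ N"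
    have c: "c > 0" "c' > 0" using \<kappa> \<kappa>' by (auto simp: c_def c'_def)
    assume "\<not> ?thesis"
    then have "r < lo \<or> hi \<le> r" unfolding r_def by auto
    then obtain i P Q where y: "b + val P Q \<in> J i" "b + val P Q \<notin> {0, d1, e}"
      and PQ: "E1 * P + E2 * Q \<le> r" "r < E1 * (P + step1 i) + E2 * (Q + step3 i)"
      using singular_gap_exists[OF E b] by blast
    obtain P' Q' where PQ': "c * val P Q = val P' Q'" "E1 * P' + E2 * Q' = c' * (E1 * P + E2 * Q)"
      using multN unfolding c_def c'_def by blast
    obtain A B where AB: "(1 - c) * (x 0 - b) = val A B" "E1 * A + E2 * B = (1 - c') * \<phi>"
      using baseN unfolding c_def c'_def by blast
    have "E1 * (- A - P') + E2 * (- B - Q') = - (E1 * A + E2 * B) - (E1 * P' + E2 * Q')"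
      by (simp add: algebra_simps)
    also have "\<dots> = c' * (r - (E1 * P + E2 * Q))"
      unfolding AB PQ' r_def using c by (simp add: c'_def[symmetric] field_simps)
    finally have form: "E1 * (- A - P') + E2 * (- B - Q') = c' * (r - (E1 * P + E2 * Q))" .
    \<comment> \<open>The interior point \<open>b + val P Q\<close> is contracted to a point from
      which \<open>(- A - P', - B - Q')\<close> leads exactly to \<open>b\<close>. The form value of
      this displacement is \<open>c' * (r - (E1 * P + E2 * Q))\<close>, which the choice of the gap
      places inside the block.\<close>
    show False
    proof (rule self_coding_no_cut[OF S[of N], of c E1 E2 b "b + val P Q" i "- A - P'" "- B - Q'"])
      show "x 0 + c * (b + val P Q - x 0) + val (- A - P') (- B - Q') = b"
      proof -
        have "val (- A - P') (- B - Q') = - val A B - val P' Q'" by (simp add: val_def algebra_simps)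
        then show ?thesis unfolding AB(1)[symmetric] PQ'(1)[symmetric] by (simp add: algebra_simps)
      qed
      show "0 \<le> E1 * real_of_int (- A - P') + E2 * real_of_int (- B - Q')"
        using form PQ c by simp
      fix n assume n: "u n = i"
      let ?S = "s ^^ N"
      have "E1 * real_of_int (p (?S (n + 1)) - p (?S n)) + E2 * real_of_int (q (?S (n + 1)) - q (?S n))
        = (E1 * p (?S (n + 1)) + E2 * q (?S (n + 1))) - (E1 * p (?S n) + E2 * q (?S n))"
        by (simp add: algebra_simps)
      also have "\<dots> = c' * (E1 * step1 i + E2 * step3 i)"
        unfolding FS p_succ q_succ n c'_def by (simp add: algebra_simps)
      finally have gap: "E1 * real_of_int (p (?S (n + 1)) - p (?S n)) + E2 * real_of_int (q (?S (n + 1)) - q (?S n))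
        = c' * (E1 * step1 i + E2 * step3 i)" .
      have "r - (E1 * P + E2 * Q) < E1 * step1 i + E2 * step3 i" using PQ(2) by (simp add: algebra_simps)
      then have "c' * (r - (E1 * P + E2 * Q)) < c' * (E1 * step1 i + E2 * step3 i)" using c by simp
      then show "E1 * real_of_int (- A - P') + E2 * real_of_int (- B - Q')
        < E1 * real_of_int (p (?S (n + 1)) - p (?S n)) + E2 * real_of_int (q (?S (n + 1)) - q (?S n))"
        unfolding gap using form by simp
    qed (use c E y b xS in \<open>auto simp: c_def\<close>)
  qed
  have "(\<lambda>N. (1 - 1 / \<kappa>' ^ N) * \<phi>) \<longlonglongrightarrow> (1 - 0) * \<phi>"
    using LIMSEQ_inverse_realpow_zero[OF \<kappa>'] by (intro tendsto_intros) (simp add: inverse_eq_divide)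
  then have lim: "(\<lambda>N. (1 - 1 / \<kappa>' ^ N) * \<phi>) \<longlonglongrightarrow> \<phi>" by simp
  have "lo \<le> \<phi>" by (rule LIMSEQ_le_const[OF lim]) (use bounds in blast)
  moreover have "\<phi> \<le> hi" by (rule LIMSEQ_le_const2[OF lim]) (use bounds in blast)
  ultimately show ?thesis ..
qed

end

section \<open>Pell's equation\<close>

text \<open>Infinitely many good approximations \<open>h / k\<close> of the root have norms bounded
  by \<open>B\<close>. Two of them share their norm \<open>n\<close> and their residues modulo
  \<open>n\<close>, and the quotient of the corresponding quadratic integers is then integral of
  norm 1.\<close>

lemma pell_solution:
  fixes D :: int
  assumes "D > 0" and irr: "sqrt D \<notin> \<rat>"
  obtains X Y where "X\<^sup>2 - D * Y\<^sup>2 = 1" "Y \<noteq> 0"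
proof -
  define \<theta> where "\<theta> = sqrt D"
  have \<theta>2: "\<theta>\<^sup>2 = D" using \<open>D > 0\<close> by (simp add: \<theta>_def)
  have "D \<noteq> 1" using irr by auto
  then have "1 < \<theta>" using \<open>D > 0\<close> by (simp add: \<theta>_def)
  define A where "A = approx_set \<theta>"
  have infA: "infinite A" using irr rational_iff_finite_approx_set unfolding A_def \<theta>_def by blast
  define norm where "norm = (\<lambda>(h, k). h\<^sup>2 - D * k\<^sup>2)"
  define B where "B = \<lceil>2 * \<theta> + 1\<rceil>"
  have A: "k > 0 \<and> h > 0 \<and> norm (h, k) \<noteq> 0 \<and> \<bar>norm (h, k)\<bar> \<le> B" if "(h, k) \<in> A" for h k
  proof -
    from that have k: "k > 0" "\<bar>\<theta> - h / k\<bar> < 1 / (real_of_int k)\<^sup>2" by (auto simp: A_def approx_set_def)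
    have "\<bar>k * \<theta> - h\<bar> = k * \<bar>\<theta> - h / k\<bar>" using k by (simp add: abs_mult[symmetric] field_simps flip: abs_of_pos)
    also have "\<dots> < k * (1 / (real_of_int k)\<^sup>2)" using k by (intro mult_strict_left_mono) auto
    also have "\<dots> = 1 / k" using k by (simp add: power2_eq_square)
    finally have d: "\<bar>k * \<theta> - h\<bar> < 1 / k" .
    have k1: "real_of_int k \<ge> 1" using k by simp
    then have "1 / real_of_int k \<le> 1" by simp
    moreover have "k * \<theta> > 1" using k1 \<open>1 < \<theta>\<close> by (smt (verit) mult_le_cancel_right1)
    ultimately have "real_of_int h > 0" using d by linarith
    then have h: "h > 0" by simp
    have eq: "real_of_int (norm (h, k)) = (h - k * \<theta>) * (h + k * \<theta>)"
      using \<theta>2 by (simp add: norm_def power2_eq_square algebra_simps)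
    have "h - k * \<theta> \<noteq> 0"
    proof
      assume "h - k * \<theta> = 0"
      then have "\<theta> = h / k" using k by (simp add: field_simps)
      then have "\<theta> \<in> \<rat>" by simp
      then show False using irr by (simp add: \<theta>_def)
    qed
    moreover have pos: "h + k * \<theta> > 0" using h k \<open>1 < \<theta>\<close> by (intro add_pos_pos mult_pos_pos) auto
    ultimately have "real_of_int (norm (h, k)) \<noteq> 0" unfolding eq by simp
    then have "norm (h, k) \<noteq> 0" by simp
    have "h + k * \<theta> \<le> k * (2 * \<theta> + 1)" 
    proof -
      have "h < k * \<theta> + k" using d \<open>1 / real_of_int k \<le> 1\<close> k1 by linarith
      then show ?thesis by (simp add: algebra_simps)
    qed
    have "\<bar>real_of_int (norm (h, k))\<bar> = \<bar>k * \<theta> - h\<bar> * (h + k * \<theta>)"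
      unfolding eq abs_mult using pos by (simp add: abs_minus_commute)
    also have "\<dots> \<le> (1 / k) * (k * (2 * \<theta> + 1))"
      using d pos k1 \<open>h + k * \<theta> \<le> k * (2 * \<theta> + 1)\<close> by (intro mult_mono) auto
    also have "\<dots> = 2 * \<theta> + 1" using k1 by simp
    finally have "real_of_int \<bar>norm (h, k)\<bar> \<le> 2 * \<theta> + 1" by simp
    then have "\<bar>norm (h, k)\<bar> \<le> B" unfolding B_def by linarith
    then show ?thesis using k h \<open>norm (h, k) \<noteq> 0\<close> by simp
  qed
  define f where "f = (\<lambda>(h, k). (norm (h, k), h mod norm (h, k), k mod norm (h, k)))"
  have "f ` A \<subseteq> {-B..B} \<times> {-B..B} \<times> {-B..B}"
  proof
    fix y assume "y \<in> f ` A"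
    then obtain h k where hk: "(h, k) \<in> A" "y = f (h, k)" by auto
    have "\<bar>i mod n\<bar> \<le> \<bar>n\<bar>" if "n \<noteq> 0" for i n :: int using abs_mod_less[OF that, of i] by simp
    then have m: "\<bar>i mod norm (h, k)\<bar> \<le> B" for i using A[OF hk(1)] by (meson order_trans)
    have "norm (h, k) \<in> {-B..B}" using A[OF hk(1)] by (simp add: abs_le_iff)
    moreover have "i mod norm (h, k) \<in> {-B..B}" for i using m[of i] unfolding abs_le_iff atLeastAtMost_iff by linarith
    ultimately show "y \<in> {-B..B} \<times> {-B..B} \<times> {-B..B}"
      unfolding hk(2) f_def prod.case by blast
  qed
  then have "finite (f ` A)" by (rule finite_subset) auto
  from pigeonhole_infinite[OF infA this] obtain a0 where inf: "infinite {a \<in> A. f a = f a0}" by blast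
  obtain a1 where a1: "a1 \<in> A" "f a1 = f a0" using infinite_imp_nonempty[OF inf] by blast
  have "infinite ({a \<in> A. f a = f a0} - {a1})" using inf by simp
  from infinite_imp_nonempty[OF this] obtain a2 where a2: "a2 \<in> A" "f a2 = f a0" "a2 \<noteq> a1" by blast
  obtain h1 k1 h2 k2 where hk: "a1 = (h1, k1)" "a2 = (h2, k2)" by (cases a1; cases a2) auto
  define n where "n = norm (h1, k1)"
  have n: "h1\<^sup>2 - D * k1\<^sup>2 = n" "h2\<^sup>2 - D * k2\<^sup>2 = n" "h1 mod n = h2 mod n" "k1 mod n = k2 mod n"
  proof -
    have same: "f (h2, k2) = f (h1, k1)" using a1(2) a2(2) hk by simp
    then show "h1\<^sup>2 - D * k1\<^sup>2 = n" "h2\<^sup>2 - D * k2\<^sup>2 = n" "h1 mod n = h2 mod n" "k1 mod n = k2 mod n"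
      unfolding f_def n_def prod.case norm_def prod.inject by (metis | simp)+
  qed
  have pos: "k1 > 0" "h1 > 0" "k2 > 0" "h2 > 0" "n \<noteq> 0"
    using A a1(1) a2(1) unfolding hk n_def by blast+
  have dvd: "n dvd h2 - h1" "n dvd k2 - k1" using n(3,4) by (auto simp: mod_eq_dvd_iff dvd_diff_commute)
  \<comment> \<open>With \<theta> the root of D, the quotient is \<open>X + Y * \<theta> = (h2 + k2
    * \<theta>) * (h1 - k1 * \<theta>) / n\<close>; congruence modulo \<open>n\<close> makes both
    coefficients integers.\<close>
  have "h1 * h2 - D * k1 * k2 = n + h1 * (h2 - h1) - D * k1 * (k2 - k1)"
    unfolding n(1)[symmetric] by (simp add: power2_eq_square algebra_simps)
  then have "n dvd h1 * h2 - D * k1 * k2" using dvd by simp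
  then obtain X where X: "h1 * h2 - D * k1 * k2 = n * X" by (elim dvdE)
  have "h1 * k2 - h2 * k1 = h1 * (k2 - k1) - k1 * (h2 - h1)" by (simp add: algebra_simps)
  then have "n dvd h1 * k2 - h2 * k1" using dvd by simp
  then obtain Y where Y: "h1 * k2 - h2 * k1 = n * Y" by (elim dvdE)
  have "n\<^sup>2 * (X\<^sup>2 - D * Y\<^sup>2) = (n * X)\<^sup>2 - D * (n * Y)\<^sup>2" by (simp add: power2_eq_square algebra_simps)
  also have "\<dots> = (h1\<^sup>2 - D * k1\<^sup>2) * (h2\<^sup>2 - D * k2\<^sup>2)"
    unfolding X[symmetric] Y[symmetric] by (simp add: power2_eq_square algebra_simps)
  also have "\<dots> = n\<^sup>2" unfolding n(1,2) by (simp add: power2_eq_square)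
  finally have "X\<^sup>2 - D * Y\<^sup>2 = 1" using pos(5) by simp
  moreover have "Y \<noteq> 0"
  proof
    assume "Y = 0"
    then have e: "h1 * k2 = h2 * k1" using Y by simp
    have "n * k2\<^sup>2 = (h1 * k2)\<^sup>2 - D * k1\<^sup>2 * k2\<^sup>2" unfolding n(1)[symmetric] by (simp add: power2_eq_square algebra_simps)
    also have "\<dots> = n * k1\<^sup>2" unfolding e n(2)[symmetric] by (simp add: power2_eq_square algebra_simps)
    finally have "k2 = k1" using pos by simp
    then show False using e pos a2(3) hk by simp
  qed
  ultimately show thesis using that by blast
qed

section \<open>Conjugation in the quadratic field\<close>

lemma real_subfield_rat_adjoin: "real_subfield (rat_adjoin e)" and e_in_rat_adjoin: "e \<in> rat_adjoin e"
  unfolding rat_adjoin_def real_subfield_def by blast+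

lemma
  shows rat_adjoin_diff: "y \<in> rat_adjoin e \<Longrightarrow> z \<in> rat_adjoin e \<Longrightarrow> y - z \<in> rat_adjoin e"
    and rat_adjoin_mult: "y \<in> rat_adjoin e \<Longrightarrow> z \<in> rat_adjoin e \<Longrightarrow> y * z \<in> rat_adjoin e"
    and rat_adjoin_inverse: "y \<in> rat_adjoin e \<Longrightarrow> inverse y \<in> rat_adjoin e"
    and rat_adjoin_1: "1 \<in> rat_adjoin e"
  using real_subfield_rat_adjoin[of e] unfolding real_subfield_def by blast+

lemma rat_adjoin_0: "0 \<in> rat_adjoin e"
  using rat_adjoin_diff[OF rat_adjoin_1 rat_adjoin_1] by simp

lemma rat_adjoin_add: "y \<in> rat_adjoin e \<Longrightarrow> z \<in> rat_adjoin e \<Longrightarrow> y + z \<in> rat_adjoin e"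
  using rat_adjoin_diff[of y e "0 - z"] rat_adjoin_diff[OF rat_adjoin_0, of z] by simp

lemma rat_adjoin_divide: "y \<in> rat_adjoin e \<Longrightarrow> z \<in> rat_adjoin e \<Longrightarrow> y / z \<in> rat_adjoin e"
  unfolding divide_inverse by (intro rat_adjoin_mult rat_adjoin_inverse)

lemma Rats_in_rat_adjoin:
  assumes "quadratic_irrational e" "r \<in> \<rat>" shows "r \<in> rat_adjoin e"
proof -
  have "r = r + 0 * e \<and> r \<in> \<rat> \<and> (0::real) \<in> \<rat>" using assms by simp
  then show ?thesis unfolding galois_conjugate_eq(1)[OF assms(1)] by blast
qed

lemma galois_conjugate_Rats:
  assumes "quadratic_irrational e" "r \<in> \<rat>" shows "galois_conjugate e r = r"
  using galois_conjugate_eq(2)[OF assms, of 0] by simp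

lemma
  assumes q: "quadratic_irrational e" and y: "y \<in> rat_adjoin e" and z: "z \<in> rat_adjoin e"
  shows galois_conjugate_add: "galois_conjugate e (y + z) = galois_conjugate e y + galois_conjugate e z"
    and galois_conjugate_mult: "galois_conjugate e (y * z) = galois_conjugate e y * galois_conjugate e z"
proof -
  obtain s t where e: "e \<notin> \<rat>" "s \<in> \<rat>" "t \<in> \<rat>" "e\<^sup>2 = s * e + t"
    using q unfolding quadratic_irrational_def by (metis quadratic_irrational_eq)
  define e' where "e' = algebraic_conjugate e"
  have e': "e' = s - e" unfolding e'_def by (rule algebraic_conjugate_eq[OF e])
  have e'2: "e' * e' = s * e' + t" using e(4) by (simp add: e' power2_eq_square algebra_simps)
  note G = galois_conjugate_eq(2)[OF q, folded e'_def]
  obtain a b c d where *: "y = a + b * e" "z = c + d * e" "a \<in> \<rat>" "b \<in> \<rat>" "c \<in> \<rat>" "d \<in> \<rat>"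
    using y z unfolding galois_conjugate_eq(1)[OF q] by blast
  have "y + z = (a + c) + (b + d) * e" by (simp add: * algebra_simps)
  then show "galois_conjugate e (y + z) = galois_conjugate e y + galois_conjugate e z"
    using G[of "a + c" "b + d"] G[of a b] G[of c d] * by (simp add: algebra_simps)
  have "y * z = a * c + (a * d + b * c) * e + b * d * e\<^sup>2" by (simp add: * power2_eq_square algebra_simps)
  then have "y * z = (a * c + b * d * t) + (a * d + b * c + b * d * s) * e"
    unfolding e(4) by (simp add: algebra_simps)
  then have "galois_conjugate e (y * z) = (a * c + b * d * t) + (a * d + b * c + b * d * s) * e'"
    using G[of "a * c + b * d * t" "a * d + b * c + b * d * s"] * e by simp
  also have "\<dots> = a * c + (a * d + b * c) * e' + b * d * (e' * e')" unfolding e'2 by (simp add: algebra_simps)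
  also have "\<dots> = (a + b * e') * (c + d * e')" by (simp add: algebra_simps)
  finally show "galois_conjugate e (y * z) = galois_conjugate e y * galois_conjugate e z"
    using G[of a b] G[of c d] * by simp
qed

lemma galois_conjugate_diff:
  assumes q: "quadratic_irrational e" and "y \<in> rat_adjoin e" "z \<in> rat_adjoin e"
  shows "galois_conjugate e (y - z) = galois_conjugate e y - galois_conjugate e z"
  using galois_conjugate_add[OF q rat_adjoin_diff[OF assms(2,3)] assms(3)] by simp

context iet3
begin

lemma val_in_rat_adjoin:
  assumes "quadratic_irrational e" shows "val P Q \<in> rat_adjoin e"
  unfolding val_eq by (intro rat_adjoin_add rat_adjoin_mult Rats_in_rat_adjoin[OF assms] e_in_rat_adjoin) auto

lemma galois_conjugate_val:
  assumes "quadratic_irrational e"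
  shows "galois_conjugate e (val P Q) = P * (1 - algebraic_conjugate e) - Q * algebraic_conjugate e"
  unfolding val_eq using galois_conjugate_eq(2)[OF assms, of "of_int P" "of_int (- P - Q)"] by (simp add: algebra_simps)

end

section \<open>Necessity of the three conditions\<close>

context iet3_orbit
begin

theorem sturm_of_self_coding:
  assumes s: "self_coding s" and nontriv: "\<exists>n. s n \<noteq> n"
  defines "e' \<equiv> algebraic_conjugate e"
  shows "sturm_number e" "x 0 \<in> rat_adjoin e" "l \<in> rat_adjoin e"
    "min e' (1 - e') \<le> galois_conjugate e (x 0) \<and> galois_conjugate e (x 0) \<le> max e' (1 - e')"
    "min e' (1 - e') \<le> galois_conjugate e l - galois_conjugate e (x 0) \<and>
      galois_conjugate e l - galois_conjugate e (x 0) \<le> max e' (1 - e')"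
proof -
  obtain \<kappa> :: real and a b c d :: int where nonneg: "a \<ge> 0" "b \<ge> 0" "c \<ge> 0" "d \<ge> 0"
    and ps: "\<And>n. p (s n) = a * p n + b * q n" and qs: "\<And>n. q (s n) = c * p n + d * q n"
    and \<kappa>1: "\<kappa> * (1 - e) = val a c" and \<kappa>2: "- \<kappa> * e = val b d"
    and xs: "\<And>n. x (s n) = x 0 + \<kappa> * (x n - x 0)"
    using self_coding_linear[OF s] by metis
  note contr = self_coding_contraction[OF s nontriv nonneg \<kappa>1 \<kappa>2 xs]
  have "e * val a c + (1 - e) * val b d = 0" unfolding \<kappa>1[symmetric] \<kappa>2[symmetric] by simp
  then have "(d - a) * e * (1 - e) + c * e\<^sup>2 - b * (1 - e)\<^sup>2 = 0"
    by (simp add: val_def power2_eq_square algebra_simps)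
  note quad = quadratic_conjugate_outside[OF irrational e_pos e_less_1 contr(1,2) this, folded e'_def]
  note Q = quad(1)
  show "sturm_number e"
    using Q quad(2) e_pos e_less_1 unfolding sturm_number_def e'_def by auto
  let ?K = "rat_adjoin e" and ?G = "galois_conjugate e"
  \<comment> \<open>The sign makes both coefficients positive in either case, \<sigma> times the
    conjugate of \<open>val P Q\<close> being \<open>E1 * P + E2 * Q\<close>.\<close>
  define \<sigma> :: real where "\<sigma> = (if e' < 0 then 1 else -1)"
  define E1 E2 where "E1 = \<sigma> * (1 - e')" and "E2 = - \<sigma> * e'"
  have E: "E1 > 0" "E2 > 0" using quad(2) by (auto simp: E1_def E2_def \<sigma>_def)
  define \<kappa>' where "\<kappa>' = a + c * E2 / E1"
  have k1: "a * E1 + c * E2 = \<kappa>' * E1" using E by (simp add: \<kappa>'_def field_simps)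
  have \<sigma>2: "\<sigma> * \<sigma> = 1" by (simp add: \<sigma>_def)
  \<comment> \<open>The quadratic equation of \<open>e\<close> says that \<open>(1 - e, - e)\<close>
    is an eigenvector; satisfied by \<open>e'\<close>, it says the same of \<open>(E1, E2)\<close>,
    with the eigenvalue \<kappa>'.\<close>
  have "(a * E1 + c * E2) * E2 - (b * E1 + d * E2) * E1
      = \<sigma> * \<sigma> * ((d - a) * e' * (1 - e') + c * e'\<^sup>2 - b * (1 - e')\<^sup>2)"
    by (simp add: E1_def E2_def power2_eq_square algebra_simps)
  also have "\<dots> = 0" using quad(3) by simp
  finally have "(b * E1 + d * E2) * E1 = \<kappa>' * E2 * E1" unfolding k1 by (simp add: algebra_simps)
  then have k2: "b * E1 + d * E2 = \<kappa>' * E2" using E by simp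
  \<comment> \<open>A positive diagonal entry suffices, because \<open>b\<close> and
    \<open>c\<close> are positive. If the diagonal vanishes, the square of \<kappa> equals
    \<open>c * b\<close>, which is at least 1 and contradicts the contraction.\<close>
  have \<kappa>'1: "\<kappa>' > 1"
  proof (cases "a \<ge> 1")
    case True
    have "c * E2 / E1 > 0" using E contr(2) by simp
    then show ?thesis using True unfolding \<kappa>'_def by linarith
  next
    case False
    then have a0: "a = 0" using nonneg by simp
    have "d \<ge> 1"
    proof (rule ccontr)
      assume "\<not> d \<ge> 1"
      then have d0: "d = 0" using nonneg by simp
      have 1: "\<kappa> * (1 - e) = - c * e" "\<kappa> * e = - b * (1 - e)" using \<kappa>1 \<kappa>2 a0 d0 by (auto simp: val_def)
      have "(\<kappa> * \<kappa>) * (e * (1 - e)) = (\<kappa> * (1 - e)) * (\<kappa> * e)" by (simp add: algebra_simps)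
      also have "\<dots> = (c * b) * (e * (1 - e))" unfolding 1 by (simp add: algebra_simps)
      finally have "\<kappa> * \<kappa> = of_int (c * b)" using e_pos e_less_1 by simp
      moreover have "c * b \<ge> 1" using contr by (metis int_one_le_iff_zero_less mult_pos_pos)
      then have "real_of_int (c * b) \<ge> 1" by linarith
      moreover have "\<kappa> * \<kappa> < 1"
        using contr(4) abs_square_less_1[of \<kappa>] by (simp add: power2_eq_square)
      ultimately show False by linarith
    qed
    then have "\<kappa>' * E2 \<ge> b * E1 + 1 * E2" unfolding k2[symmetric] using E by (intro add_left_mono mult_right_mono) auto
    moreover have "b * E1 > 0" using E contr(1) by simp
    ultimately have "\<kappa>' * E2 > 1 * E2" by linarith
    then show ?thesis using E(2) mult_less_cancel_right_pos by blast
  qed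
  have Fs: "E1 * p (s n) + E2 * q (s n) = \<kappa>' * (E1 * p n + E2 * q n)" for n
  proof -
    have "E1 * p (s n) + E2 * q (s n) = (a * E1 + c * E2) * p n + (b * E1 + d * E2) * q n"
      unfolding ps qs by (simp add: algebra_simps)
    then show ?thesis unfolding k1 k2 by (simp add: algebra_simps)
  qed
  have mult: "\<exists>P' Q'. \<kappa> * val P Q = val P' Q' \<and> E1 * P' + E2 * Q' = \<kappa>' * (E1 * P + E2 * Q)" for P Q
  proof (intro exI conjI)
    have "\<kappa> * val P Q = P * (\<kappa> * (1 - e)) + Q * (- \<kappa> * e)" by (simp add: val_def algebra_simps)
    also have "\<dots> = val (P * a + Q * b) (P * c + Q * d)" unfolding \<kappa>1 \<kappa>2 val_add val_mult ..
    finally show "\<kappa> * val P Q = val (P * a + Q * b) (P * c + Q * d)" .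
    have "E1 * (P * a + Q * b) + E2 * (P * c + Q * d) = P * (a * E1 + c * E2) + Q * (b * E1 + d * E2)"
      by (simp add: algebra_simps)
    then show "E1 * of_int (P * a + Q * b) + E2 * of_int (P * c + Q * d) = \<kappa>' * (E1 * P + E2 * Q)"
      unfolding k1 k2 by (simp add: algebra_simps)
  qed
  have \<kappa>M: "\<kappa> * y \<in> M" if "y \<in> M" for y using that mult unfolding M_def by blast
  have valK: "val P Q \<in> ?K" for P Q by (rule val_in_rat_adjoin[OF Q])
  define f where "f y = \<sigma> * ?G y" for y
  have fval: "f (val P Q) = E1 * P + E2 * Q" for P Q
    unfolding f_def galois_conjugate_val[OF Q] E1_def E2_def e'_def by (simp add: algebra_simps)
  have fdiff: "f (y - z) = f y - f z" if "y \<in> ?K" "z \<in> ?K" for y z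
    unfolding f_def galois_conjugate_diff[OF Q that] by (simp add: algebra_simps)
  have \<kappa>K: "\<kappa> \<in> ?K"
  proof -
    have "\<kappa> = val a c / val 1 0" using \<kappa>1 e_less_1 by (simp add: val_def[of 1] field_simps)
    then show ?thesis using rat_adjoin_divide[OF valK valK] by simp
  qed
  have G\<kappa>: "?G \<kappa> = \<kappa>'"
  proof -
    have "?G (\<kappa> * val 1 0) = ?G (val a c)" using \<kappa>1 by (simp add: val_def[of 1])
    then have "?G \<kappa> * ?G (val 1 0) = ?G (val a c)" unfolding galois_conjugate_mult[OF Q \<kappa>K valK] .
    then have "?G \<kappa> * f (val 1 0) = f (val a c)" unfolding f_def by (simp add: algebra_simps)
    then have "?G \<kappa> * E1 = \<kappa>' * E1" unfolding fval using k1 by (simp add: algebra_simps)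
    then show ?thesis using E by simp
  qed
  \<comment> \<open>Squaring once makes the ratio positive; the second squaring, \<nu>, fixes the
    classes of 0 and \<open>l\<close> modulo M. Both are prerequisites of
    \<open>self_coding_bounds\<close>, which is therefore applied to the fourth iterate
    \<open>s4\<close>.\<close>
  define \<mu> where "\<mu> = \<kappa>\<^sup>2"
  have \<mu>: "\<mu> > 0" "\<mu> < 1" using contr(3,4) by (auto simp: \<mu>_def abs_square_less_1)
  define s2 where "s2 = (\<lambda>n. s (s n))"
  have s2: "self_coding s2" unfolding s2_def by (rule self_coding_compose[OF s s])
  have xs2: "x (s2 n) = x 0 + \<mu> * (x n - x 0)" for n
    unfolding s2_def xs \<mu>_def by (simp add: power2_eq_square)
  have \<mu>M: "\<mu> * y \<in> M" if "y \<in> M" for y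
    using \<kappa>M[OF \<kappa>M[OF that]] by (simp add: \<mu>_def power2_eq_square mult.assoc)
  note inM = self_coding_square_in_M[OF s2 \<mu>(1) xs2 \<mu>M]
  have MK: "y \<in> ?K" if "y \<in> M" for y using that valK by (auto simp: M_def)
  define \<nu> where "\<nu> = \<mu>\<^sup>2"
  have \<nu>: "\<nu> > 0" "\<nu> < 1" using \<mu> by (auto simp: \<nu>_def abs_square_less_1)
  have \<nu>K: "\<nu> \<in> ?K" unfolding \<nu>_def \<mu>_def power2_eq_square by (intro rat_adjoin_mult \<kappa>K)
  have \<mu>K: "\<mu> \<in> ?K" unfolding \<mu>_def power2_eq_square by (intro rat_adjoin_mult \<kappa>K)
  have G\<nu>: "?G \<nu> = \<kappa>' ^ 4"
  proof -
    have "?G \<mu> = \<kappa>' * \<kappa>'" unfolding \<mu>_def power2_eq_square galois_conjugate_mult[OF Q \<kappa>K \<kappa>K] G\<kappa> ..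
    then have "?G \<nu> = (\<kappa>' * \<kappa>') * (\<kappa>' * \<kappa>')" unfolding \<nu>_def power2_eq_square[of \<mu>] galois_conjugate_mult[OF Q \<mu>K \<mu>K] by simp
    then show ?thesis by (simp add: power4_eq_xxxx)
  qed
  have oneK: "1 - \<nu> \<in> ?K" by (intro rat_adjoin_diff rat_adjoin_1 \<nu>K)
  have inK: "y \<in> ?K" if "(1 - \<nu>) * y \<in> M" for y
  proof -
    have "y = (1 - \<nu>) * y / (1 - \<nu>)" using \<nu> by simp
    then show ?thesis using rat_adjoin_divide[OF MK[OF that] oneK] by simp
  qed
  show x0K: "x 0 \<in> ?K" and lK: "l \<in> ?K" using inK inM unfolding \<nu>_def by auto
  define s4 where "s4 = (\<lambda>n. s2 (s2 n))"
  have s4: "self_coding s4" unfolding s4_def by (rule self_coding_compose[OF s2 s2])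
  have xs4: "x (s4 n) = x 0 + \<nu> * (x n - x 0)" for n
    unfolding s4_def xs2 \<nu>_def by (simp add: power2_eq_square)
  have Fs4: "E1 * p (s4 n) + E2 * q (s4 n) = \<kappa>' ^ 4 * (E1 * p n + E2 * q n)" for n
    unfolding s4_def s2_def Fs by (simp add: power4_eq_xxxx algebra_simps)
  have \<nu>M: "\<nu> * y \<in> M" if "y \<in> M" for y
    using \<mu>M[OF \<mu>M[OF that]] by (simp add: \<nu>_def power2_eq_square mult.assoc)
  have fmult: "f (z * y) = ?G z * f y" if "z \<in> ?K" "y \<in> ?K" for z y
    unfolding f_def galois_conjugate_mult[OF Q that] by simp
  have mult4: "\<exists>P' Q'. \<nu> * val P Q = val P' Q' \<and> E1 * P' + E2 * Q' = \<kappa>' ^ 4 * (E1 * P + E2 * Q)" for P Q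
  proof -
    obtain P' Q' where PQ: "\<nu> * val P Q = val P' Q'" using \<nu>M[OF val_in_M] unfolding M_def by blast
    have "E1 * P' + E2 * Q' = f (\<nu> * val P Q)" unfolding PQ fval ..
    also have "\<dots> = \<kappa>' ^ 4 * (E1 * P + E2 * Q)" unfolding fmult[OF \<nu>K valK] G\<nu> fval ..
    finally show ?thesis using PQ by blast
  qed
  have base: "\<exists>A B. (1 - \<nu>) * (x 0 - b) = val A B \<and> E1 * A + E2 * B = (1 - \<kappa>' ^ 4) * f (x 0 - b)"
    if "b \<in> ?K" "(1 - \<nu>) * b \<in> M" for b
  proof -
    have "(1 - \<nu>) * x 0 - (1 - \<nu>) * b \<in> M" using M_diff[OF _ that(2)] inM by (simp add: \<nu>_def)
    then obtain A B where AB: "(1 - \<nu>) * (x 0 - b) = val A B" by (auto simp: M_def right_diff_distrib)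
    have bK: "x 0 - b \<in> ?K" by (intro rat_adjoin_diff x0K that)
    have "E1 * A + E2 * B = f ((1 - \<nu>) * (x 0 - b))" unfolding AB fval ..
    also have "\<dots> = (1 - \<kappa>' ^ 4) * f (x 0 - b)"
      unfolding fmult[OF oneK bK] galois_conjugate_diff[OF Q rat_adjoin_1 \<nu>K] G\<nu>
      using galois_conjugate_Rats[OF Q, of 1] by simp
    finally show ?thesis using AB by blast
  qed
  have k4: "\<kappa>' ^ 4 > 1" using \<kappa>'1 by simp
  have "0 \<in> M" using val_in_M[of 0 0] by simp
  have b0: "- E2 \<le> f (x 0) \<and> f (x 0) \<le> E1"
    using self_coding_bounds[OF s4 \<nu>(1) k4 xs4 E Fs4 mult4, of 0 "- E2" E1] base[of 0] rat_adjoin_0 \<open>0 \<in> M\<close> by simp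
  have bl: "- E1 \<le> f (x 0 - l) \<and> f (x 0 - l) \<le> E2"
    using self_coding_bounds[OF s4 \<nu>(1) k4 xs4 E Fs4 mult4, of l "- E1" E2] base[of l] lK inM(2) unfolding \<nu>_def by blast
  show "min e' (1 - e') \<le> ?G (x 0) \<and> ?G (x 0) \<le> max e' (1 - e')"
    using b0 quad(2) unfolding f_def E1_def E2_def \<sigma>_def by (auto split: if_splits)
  show "min e' (1 - e') \<le> ?G l - ?G (x 0) \<and> ?G l - ?G (x 0) \<le> max e' (1 - e')"
    using bl quad(2) unfolding fdiff[OF x0K lK] unfolding f_def E1_def E2_def \<sigma>_def by (auto split: if_splits)
qed

end

section \<open>Units of the multiplier ring and denominators\<close>

context iet3
begin

lemma M_mult_int: "y \<in> M \<Longrightarrow> of_int k * y \<in> M"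
  unfolding M_def by clarify (metis val_mult)

lemma M_iff: "y \<in> M \<longleftrightarrow> (\<exists>i j. y = of_int i + of_int j * e)"
proof
  assume "y \<in> M"
  then obtain P Q where "y = val P Q" by (auto simp: M_def)
  then show "\<exists>i j. y = of_int i + of_int j * e" unfolding val_eq by blast
next
  assume "\<exists>i j. y = of_int i + of_int j * e"
  then obtain i j where "y = of_int i * 1 + of_int j * e" by auto
  then show "y \<in> M" using M_add[OF M_mult_int[OF one_in_M] M_mult_int[OF e_in_M]] by simp
qed

text \<open>The units are of the form \<open>1 + N * (i + j * w)\<close> with \<open>w\<^sup>2 = D\<close> and come from Pell's equation
  for \<open>D * (N * R)\<^sup>2\<close>, which makes them arbitrarily large.\<close>

lemma unit_exists:
  assumes q: "quadratic_irrational e" and N: "N > (0::int)"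
  obtains \<kappa> where "\<kappa> \<in> rat_adjoin e" "0 < \<kappa>" "\<kappa> < 1" "\<kappa> * galois_conjugate e \<kappa> = 1"
    "galois_conjugate e \<kappa> > of_int R"
    "\<And>y. y \<in> M \<Longrightarrow> \<kappa> * y \<in> M" "\<And>y. y \<in> M \<Longrightarrow> galois_conjugate e \<kappa> * y \<in> M"
    "\<And>y. of_int N * y \<in> M \<Longrightarrow> (1 - galois_conjugate e \<kappa>) * y \<in> M"
proof -
  obtain s t where e: "e \<notin> \<rat>" "s \<in> \<rat>" "t \<in> \<rat>" "e\<^sup>2 = s * e + t"
    using q unfolding quadratic_irrational_def by (metis quadratic_irrational_eq)
  obtain s1 s2 :: int where s: "s2 > 0" "s = s1 / s2" using e(2) by (auto elim: Rats_cases')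
  obtain t1 t2 :: int where t: "t2 > 0" "t = t1 / t2" using e(3) by (auto elim: Rats_cases')
  define W S T where "W = s2 * t2" and "S = s1 * t2" and "T = t1 * s2"
  have W: "W > 0" using s t by (simp add: W_def)
  have We: "of_int W * e\<^sup>2 = of_int S * e + of_int T"
    unfolding e(4) using s t by (simp add: W_def S_def T_def field_simps)
  have sW: "s = S / W" using s t by (simp add: W_def S_def)
  \<comment> \<open>A square root of the discriminant \<open>D\<close> of the integral equation of
    \<open>e\<close>. Conjugation only changes its sign, and multiplication by it preserves the
    module.\<close>
  define w where "w = 2 * of_int W * e - of_int S"
  define D where "D = S\<^sup>2 + 4 * W * T"
  have w2: "w * w = of_int D"
  proof -
    have "w * w = 4 * W * (W * e\<^sup>2) - 4 * W * S * e + S\<^sup>2"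
      by (simp add: w_def power2_eq_square algebra_simps)
    then show ?thesis unfolding We by (simp add: D_def power2_eq_square algebra_simps)
  qed
  have w_irr: "w \<notin> \<rat>"
  proof
    assume "w \<in> \<rat>"
    then have "(w + of_int S) / (2 * of_int W) \<in> \<rat>" by simp
    moreover have "(w + of_int S) / (2 * of_int W) = e" using W by (simp add: w_def)
    ultimately show False using e(1) by simp
  qed
  have "w \<noteq> 0" using w_irr by auto
  then have "of_int D > (0::real)" unfolding w2[symmetric] by (simp add: zero_less_mult_iff) linarith
  then have D: "D > 0" by simp
  have wM: "w * y \<in> M" if y: "y \<in> M" for y
  proof -
    obtain i j where y: "y = of_int i + of_int j * e" using y unfolding M_iff by blast
    have "w * y = 2 * W * i * e - S * i + 2 * j * (W * e\<^sup>2) - S * j * e"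
      by (simp add: y w_def power2_eq_square algebra_simps)
    also have "\<dots> = of_int (2 * T * j - S * i) + of_int (2 * W * i + S * j) * e"
      unfolding We by (simp add: algebra_simps)
    finally show ?thesis unfolding M_iff by blast
  qed
  have wK: "w \<in> rat_adjoin e"
    unfolding w_def by (intro rat_adjoin_diff rat_adjoin_mult e_in_rat_adjoin Rats_in_rat_adjoin[OF q]) auto
  have Gw: "galois_conjugate e w = - w"
  proof -
    have "galois_conjugate e (of_int (- S) + of_int (2 * W) * e) = of_int (- S) + of_int (2 * W) * algebraic_conjugate e"
      by (rule galois_conjugate_eq(2)[OF q]) (auto simp del: of_int_minus of_int_mult)
    moreover have "of_int (- S) + of_int (2 * W) * e = w" by (simp add: w_def)
    moreover have "of_int (- S) + of_int (2 * W) * (of_int S / of_int W - e) = - w"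
      using W by (simp add: w_def right_diff_distrib)
    ultimately show ?thesis unfolding algebraic_conjugate_eq[OF e] sW by simp
  qed
  define R' where "R' = \<bar>R\<bar> + 1"
  define V where "V = N * R'"
  have V: "V > 0" using N by (simp add: V_def R'_def)
  have "sqrt (of_int (D * V\<^sup>2)) = of_int V * \<bar>w\<bar>"
  proof (rule real_sqrt_unique)
    have "(of_int V * \<bar>w\<bar>)\<^sup>2 = (of_int V)\<^sup>2 * (w * w)" by (simp add: power2_eq_square)
    then show "(of_int V * \<bar>w\<bar>)\<^sup>2 = of_int (D * V\<^sup>2)" unfolding w2 by simp
  qed (use V in auto)
  moreover have "of_int V * \<bar>w\<bar> \<notin> \<rat>"
  proof
    assume "of_int V * \<bar>w\<bar> \<in> \<rat>"
    then have "of_int V * \<bar>w\<bar> / of_int V \<in> \<rat>" by (intro Rats_divide) auto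
    then show False using V w_irr by (simp add: abs_if split: if_splits)
  qed
  ultimately have irr: "sqrt (of_int (D * V\<^sup>2)) \<notin> \<rat>" by simp
  have "D * V\<^sup>2 > 0" using D V by simp
  from pell_solution[OF this irr] obtain X Y where XY: "X\<^sup>2 - D * V\<^sup>2 * Y\<^sup>2 = 1" "Y \<noteq> 0" by blast
  have "X \<noteq> 0"
  proof
    assume "X = 0"
    then have "- (D * (V * Y)\<^sup>2) = 1" using XY by (simp add: power_mult_distrib mult.assoc)
    moreover have "D * (V * Y)\<^sup>2 \<ge> 0" using D by simp
    ultimately show False by linarith
  qed
  \<comment> \<open>Up to the sign of \<open>b\<close>, \<open>a + b * w\<close> is the square of
    the Pell unit \<open>X + Y * V * w\<close>. Squaring is needed for the congruence of
    \<open>a\<close> to 1 modulo \<open>N\<close>. The sign of \<open>b\<close> makes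
    \<open>b * w\<close> negative, so that \<kappa> is the smaller of the two conjugates.\<close>
  define a where "a = 1 + 2 * D * V\<^sup>2 * Y\<^sup>2"
  define b where "b = (if w > 0 then - 2 * \<bar>X * Y\<bar> * V else 2 * \<bar>X * Y\<bar> * V)"
  have "w > 0 \<or> w < 0" using \<open>w \<noteq> 0\<close> by linarith
  then have bw: "of_int b * w < 0"
    using \<open>X \<noteq> 0\<close> XY(2) V by (auto simp: b_def mult_less_0_iff zero_less_mult_iff)
  have norm: "a\<^sup>2 - D * b\<^sup>2 = 1"
  proof -
    have "b\<^sup>2 = 4 * X\<^sup>2 * Y\<^sup>2 * V\<^sup>2" by (auto simp: b_def power_mult_distrib)
    then have "a\<^sup>2 - D * b\<^sup>2 = 1 + 4 * D * V\<^sup>2 * Y\<^sup>2 * (1 + D * V\<^sup>2 * Y\<^sup>2 - X\<^sup>2)"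
      by (simp add: a_def power2_eq_square algebra_simps)
    moreover have "1 + D * V\<^sup>2 * Y\<^sup>2 - X\<^sup>2 = 0" using XY(1) by simp
    ultimately show ?thesis by simp
  qed
  have aR: "a > R" "a \<ge> 1"
  proof -
    have "Y\<^sup>2 \<ge> 1" using XY(2) by (simp add: int_one_le_iff_zero_less)
    moreover have "D \<ge> 1" using D by simp
    moreover have "V\<^sup>2 \<ge> R'"
    proof -
      have "V \<ge> R'" using N mult_right_mono[of 1 N R'] by (simp add: V_def R'_def)
      moreover have "V\<^sup>2 \<ge> V" using V by (simp add: power2_eq_square)
      ultimately show ?thesis by simp
    qed
    ultimately have "1 * R' * 1 \<le> D * V\<^sup>2 * Y\<^sup>2" by (intro mult_mono) (auto simp: R'_def)
    moreover obtain Z where "Z = D * V\<^sup>2 * Y\<^sup>2" by blast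
    moreover from this have "a = 1 + 2 * Z" by (simp add: a_def)
    ultimately have "\<bar>R\<bar> + 1 \<le> Z" "a = 1 + 2 * Z" by (simp_all add: R'_def)
    then show "a > R" "a \<ge> 1" by linarith+
  qed
  define \<kappa> where "\<kappa> = of_int a + of_int b * w"
  have \<kappa>K: "\<kappa> \<in> rat_adjoin e"
    unfolding \<kappa>_def by (intro rat_adjoin_add rat_adjoin_mult wK Rats_in_rat_adjoin[OF q]) auto
  have G\<kappa>: "galois_conjugate e \<kappa> = of_int a - of_int b * w"
  proof -
    have K: "real_of_int a \<in> rat_adjoin e" "real_of_int b \<in> rat_adjoin e"
      by (rule Rats_in_rat_adjoin[OF q], simp)+
    show ?thesis
      unfolding \<kappa>_def galois_conjugate_add[OF q K(1) rat_adjoin_mult[OF K(2) wK]]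
        galois_conjugate_mult[OF q K(2) wK] Gw
      by (simp add: galois_conjugate_Rats[OF q])
  qed
  have prod: "\<kappa> * galois_conjugate e \<kappa> = 1"
  proof -
    have "\<kappa> * galois_conjugate e \<kappa> = (of_int a)\<^sup>2 - (w * w) * (of_int b)\<^sup>2"
      unfolding G\<kappa> unfolding \<kappa>_def by (simp add: power2_eq_square algebra_simps)
    also have "\<dots> = of_int (a\<^sup>2 - D * b\<^sup>2)" unfolding w2 by simp
    finally show ?thesis unfolding norm by simp
  qed
  have big: "galois_conjugate e \<kappa> > of_int a" unfolding G\<kappa> using bw by simp
  then have G1: "galois_conjugate e \<kappa> > 1" using aR by (smt (verit) of_int_1_le_iff)
  show thesis
  proof (rule that[OF \<kappa>K])
    show "0 < \<kappa>" using prod G1 by (smt (verit) mult_nonpos_nonneg)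
    show "\<kappa> < 1" using prod G1 \<open>0 < \<kappa>\<close> by (smt (verit) mult_le_cancel_left1 mult_cancel_left2)
    show "\<kappa> * galois_conjugate e \<kappa> = 1" by (rule prod)
    show "of_int R < galois_conjugate e \<kappa>" using big aR by (smt (verit) of_int_less_iff)
    show "\<kappa> * y \<in> M" if "y \<in> M" for y
    proof -
      have "\<kappa> * y = of_int a * y + of_int b * (w * y)" by (simp add: \<kappa>_def algebra_simps)
      then show ?thesis using M_add[OF M_mult_int[OF that] M_mult_int[OF wM[OF that]]] by simp
    qed
    show "galois_conjugate e \<kappa> * y \<in> M" if "y \<in> M" for y
    proof -
      have "galois_conjugate e \<kappa> * y = of_int a * y - of_int b * (w * y)" unfolding G\<kappa> by (simp add: algebra_simps)
      then show ?thesis using M_diff[OF M_mult_int[OF that] M_mult_int[OF wM[OF that]]] by simp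
    qed
    show "(1 - galois_conjugate e \<kappa>) * y \<in> M" if "of_int N * y \<in> M" for y
    proof -
      define b' where "b' = (if w > 0 then - 2 * \<bar>X * Y\<bar> * R' else 2 * \<bar>X * Y\<bar> * R')"
      define a' where "a' = - 2 * D * R' * V * Y\<^sup>2"
      have "b = N * b'" "1 - a = N * a'" by (auto simp: b_def b'_def V_def a_def a'_def power2_eq_square)
      then have real: "real_of_int b = of_int N * of_int b'" "1 - real_of_int a = of_int N * of_int a'"
        by (simp, metis of_int_1 of_int_diff of_int_mult)
      have "(1 - galois_conjugate e \<kappa>) * y = (1 - of_int a) * y + of_int b * (w * y)"
        unfolding G\<kappa> by (simp add: algebra_simps)
      also have "\<dots> = of_int a' * (of_int N * y) + of_int b' * (w * (of_int N * y))"
        unfolding real by simp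
      finally have "(1 - galois_conjugate e \<kappa>) * y = of_int a' * (of_int N * y) + of_int b' * (w * (of_int N * y))" .
      then show ?thesis using M_add[OF M_mult_int[OF that] M_mult_int[OF wM[OF that]]] by simp
    qed
  qed
qed

lemma common_denominator:
  assumes q: "quadratic_irrational e" and "y \<in> rat_adjoin e"
  obtains N :: int where "N > 0" "of_int N * y \<in> M"
proof -
  obtain r1 r2 where r: "y = r1 + r2 * e" "r1 \<in> \<rat>" "r2 \<in> \<rat>"
    using assms unfolding galois_conjugate_eq(1)[OF q] by blast
  obtain a b :: int where 1: "b > 0" "r1 = a / b" using r(2) by (auto elim: Rats_cases')
  obtain c d :: int where 2: "d > 0" "r2 = c / d" using r(3) by (auto elim: Rats_cases')
  have "of_int (b * d) * y = of_int (a * d) + of_int (c * b) * e"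
    using 1 2 by (simp add: r(1) field_simps)
  then have "of_int (b * d) * y \<in> M" unfolding M_iff by blast
  then show thesis using that[of "b * d"] 1 2 by simp
qed

end

section \<open>Sufficiency of the three conditions\<close>

context iet3_orbit
begin

text \<open>The lower bound on the block lengths is requested for the sake of primitivity: once
  \<open>N\<close> exceeds the recurrence time of the letters, each block contains them all.\<close>

theorem self_coding_of_sturm:
  fixes N :: int
  assumes sturm: "sturm_number e" and x0K: "x 0 \<in> rat_adjoin e" and lK: "l \<in> rat_adjoin e"
  defines "e' \<equiv> algebraic_conjugate e"
  assumes b0: "min e' (1 - e') \<le> galois_conjugate e (x 0) \<and> galois_conjugate e (x 0) \<le> max e' (1 - e')"
    and bl: "min e' (1 - e') \<le> galois_conjugate e l - galois_conjugate e (x 0) \<and>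
      galois_conjugate e l - galois_conjugate e (x 0) \<le> max e' (1 - e')"
  obtains s where "self_coding s" "\<And>n. s (n + 1) - s n > N"
proof -
  have Q: "quadratic_irrational e" using sturm by (simp add: sturm_number_def)
  let ?K = "rat_adjoin e" and ?G = "galois_conjugate e"
  have out: "e' < 0 \<or> 1 < e'"
  proof -
    obtain s t where e: "e \<notin> \<rat>" "s \<in> \<rat>" "t \<in> \<rat>" "e\<^sup>2 = s * e + t"
      using Q unfolding quadratic_irrational_def by (metis quadratic_irrational_eq)
    have "e' \<notin> \<rat>"
    proof
      assume "e' \<in> \<rat>"
      then have "s - e' \<in> \<rat>" using e(2) by simp
      then show False using e(1) unfolding e'_def algebraic_conjugate_eq[OF e] by simp
    qed
    then have "e' \<noteq> 0" "e' \<noteq> 1" by auto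
    then show ?thesis using sturm by (auto simp: sturm_number_def e'_def)
  qed
  define \<sigma> :: real where "\<sigma> = (if e' < 0 then 1 else -1)"
  define E1 E2 where "E1 = \<sigma> * (1 - e')" and "E2 = - \<sigma> * e'"
  have E: "E1 > 0" "E2 > 0" using out by (auto simp: E1_def E2_def \<sigma>_def)
  define f where "f y = \<sigma> * ?G y" for y
  have fval: "f (val P Q) = E1 * P + E2 * Q" for P Q
    unfolding f_def galois_conjugate_val[OF Q] E1_def E2_def e'_def by (simp add: algebra_simps)
  have fdiff: "f (y - z) = f y - f z" if "y \<in> ?K" "z \<in> ?K" for y z
    unfolding f_def galois_conjugate_diff[OF Q that] by (simp add: algebra_simps)
  have fmult: "f (z * y) = ?G z * f y" if "z \<in> ?K" "y \<in> ?K" for z y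
    unfolding f_def galois_conjugate_mult[OF Q that] by simp
  have valK: "val P Q \<in> ?K" for P Q by (rule val_in_rat_adjoin[OF Q])
  obtain N1 where N1: "N1 > 0" "of_int N1 * x 0 \<in> M" using common_denominator[OF Q x0K] .
  obtain N2 where N2: "N2 > 0" "of_int N2 * l \<in> M" using common_denominator[OF Q lK] .
  \<comment> \<open>A block raises the form by at least \<open>\<kappa>' * min E1 E2\<close>, while
    \<open>N\<close> letters raise it by at most \<open>N * (E1 + E2)\<close>.\<close>
  define R where "R = \<lceil>of_int (max N 0) * (E1 + E2) / min E1 E2\<rceil>"
  have "N1 * N2 > 0" using N1 N2 by simp
  then obtain \<kappa> where \<kappa>: "\<kappa> \<in> ?K" "0 < \<kappa>" "\<kappa> < 1" "\<kappa> * ?G \<kappa> = 1" "?G \<kappa> > of_int R"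
    and \<kappa>M: "\<And>y. y \<in> M \<Longrightarrow> \<kappa> * y \<in> M" "\<And>y. y \<in> M \<Longrightarrow> ?G \<kappa> * y \<in> M"
    and den: "\<And>y. of_int (N1 * N2) * y \<in> M \<Longrightarrow> (1 - ?G \<kappa>) * y \<in> M"
    using unit_exists[OF Q, of "N1 * N2" R] by metis
  define \<kappa>' where "\<kappa>' = ?G \<kappa>"
  have inv: "\<kappa> * \<kappa>' = 1" "1 / \<kappa> = \<kappa>'" using \<kappa>(2,4) by (auto simp: \<kappa>'_def field_simps)
  have \<kappa>'0: "\<kappa>' > 0" using inv(2) \<kappa>(2) by (metis divide_pos_pos zero_less_one)
  have \<kappa>'K: "\<kappa>' \<in> ?K" unfolding inv(2)[symmetric] by (intro rat_adjoin_divide rat_adjoin_1 \<kappa>)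
  have G\<kappa>': "?G \<kappa>' = \<kappa>"
  proof -
    have "\<kappa>' * ?G \<kappa>' = ?G (\<kappa> * \<kappa>')" unfolding galois_conjugate_mult[OF Q \<kappa>(1) \<kappa>'K] \<kappa>'_def[symmetric] ..
    also have "\<dots> = 1" unfolding inv by (simp add: galois_conjugate_Rats[OF Q])
    finally show ?thesis using inv \<kappa>'0 by (metis mult.commute mult_cancel_left less_irrefl)
  qed
  have den0: "(1 - \<kappa>') * x 0 \<in> M" "(1 - \<kappa>') * l \<in> M"
    using den[of "x 0"] den[of l] M_mult_int[OF N1(2), of N2] M_mult_int[OF N2(2), of N1]
    unfolding \<kappa>'_def by (auto simp: ac_simps)
  have mult: "\<exists>P' Q'. \<kappa> * val P Q = val P' Q' \<and> E1 * P' + E2 * Q' = \<kappa>' * (E1 * P + E2 * Q)" for P Q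
  proof -
    obtain P' Q' where PQ: "\<kappa> * val P Q = val P' Q'" using \<kappa>M(1)[OF val_in_M] unfolding M_def by blast
    have "E1 * P' + E2 * Q' = f (\<kappa> * val P Q)" unfolding PQ fval ..
    also have "\<dots> = \<kappa>' * (E1 * P + E2 * Q)" unfolding fmult[OF \<kappa>(1) valK] fval \<kappa>'_def ..
    finally show ?thesis using PQ by blast
  qed
  have div: "\<exists>P' Q'. val P Q = \<kappa> * val P' Q' \<and> E1 * P + E2 * Q = \<kappa>' * (E1 * P' + E2 * Q')" for P Q
  proof -
    obtain P' Q' where PQ: "\<kappa>' * val P Q = val P' Q'" using \<kappa>M(2)[OF val_in_M] unfolding M_def \<kappa>'_def by blast
    have "\<kappa> * val P' Q' = (\<kappa> * \<kappa>') * val P Q" unfolding PQ[symmetric] by simp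
    then have eq: "val P Q = \<kappa> * val P' Q'" unfolding inv by simp
    have "E1 * P + E2 * Q = f (\<kappa> * val P' Q')" unfolding eq[symmetric] fval ..
    also have "\<dots> = \<kappa>' * (E1 * P' + E2 * Q')" unfolding fmult[OF \<kappa>(1) valK] fval \<kappa>'_def ..
    finally show ?thesis using eq by blast
  qed
  have f0: "- E2 \<le> f (x 0)" "f (x 0) \<le> E1"
    using b0 out unfolding f_def E1_def E2_def \<sigma>_def by (auto split: if_splits)
  have fl: "- E1 \<le> f (x 0 - l)" "f (x 0 - l) \<le> E2"
    unfolding fdiff[OF x0K lK] using bl out unfolding f_def E1_def E2_def \<sigma>_def by (auto split: if_splits)
  have sing: "\<exists>A B. (1 - 1 / \<kappa>) * (x 0 - b) = val A B \<and> lo \<le> E1 * A + E2 * B \<and> E1 * A + E2 * B \<le> hi"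
    if b: "b = 0 \<and> lo = - E2 \<and> hi = E1 \<or> b = l \<and> lo = - E1 \<and> hi = E2" for b lo hi
  proof -
    have bd: "lo \<le> f (x 0 - b)" "f (x 0 - b) \<le> hi" "lo \<le> 0" "0 \<le> hi" using b f0 fl E by auto
    have "(1 - \<kappa>') * (x 0 - b) \<in> M"
      using b den0 M_diff[OF den0] by (auto simp: right_diff_distrib)
    then obtain A B where AB: "(1 - \<kappa>') * (x 0 - b) = val A B" by (auto simp: M_def)
    have bK: "x 0 - b \<in> ?K" using b x0K rat_adjoin_diff[OF x0K lK] by auto
    have oneK: "1 - \<kappa>' \<in> ?K" by (intro rat_adjoin_diff rat_adjoin_1 \<kappa>'K)
    have "E1 * A + E2 * B = f ((1 - \<kappa>') * (x 0 - b))" unfolding AB fval ..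
    also have "\<dots> = (1 - \<kappa>) * f (x 0 - b)"
      unfolding fmult[OF oneK bK] galois_conjugate_diff[OF Q rat_adjoin_1 \<kappa>'K] G\<kappa>'
      using galois_conjugate_Rats[OF Q, of 1] by simp
    finally have val: "E1 * A + E2 * B = (1 - \<kappa>) * f (x 0 - b)" .
    \<comment> \<open>The norm 1 turns \<open>1 - 1 / \<kappa>\<close> into
      \<open>1 - \<kappa>'\<close>, with conjugate \<open>1 - \<kappa>\<close> between 0 and 1. As
      \<open>lo\<close> and \<open>hi\<close> enclose 0, the shrunken value respects them even if
      \<open>f (x 0 - b)\<close> is a bound itself.\<close>
    have "lo \<le> (1 - \<kappa>) * lo" "(1 - \<kappa>) * hi \<le> hi"
      using bd \<kappa>(2,3) by (auto simp: algebra_simps mult_nonneg_nonpos)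
    moreover have "(1 - \<kappa>) * lo \<le> (1 - \<kappa>) * f (x 0 - b)" "(1 - \<kappa>) * f (x 0 - b) \<le> (1 - \<kappa>) * hi"
      using bd \<kappa>(3) by (auto intro: mult_left_mono)
    ultimately have "lo \<le> E1 * A + E2 * B" "E1 * A + E2 * B \<le> hi" unfolding val by linarith+
    then show ?thesis using AB unfolding inv(2) by blast
  qed
  obtain s where s: "self_coding s" "\<And>n. E1 * p (s n) + E2 * q (s n) = \<kappa>' * (E1 * p n + E2 * q n)"
    using renormalization[OF E \<kappa>(2,3) \<kappa>'0 mult div sing] by blast
  have "s (n + 1) - s n > N" for n
  proof (rule ccontr)
    assume "\<not> s (n + 1) - s n > N"
    then have len: "s (n + 1) - s n \<le> max N 0" by simp
    define dp dq where "dp = p (s (n + 1)) - p (s n)" and "dq = q (s (n + 1)) - q (s n)"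
    have le: "s n \<le> s (n + 1)" using self_coding_ge[OF s(1), of n "n + 1"] by simp
    have each: "step1 i \<le> 1" "step3 i \<le> 1" for i by (cases i; simp)+
    have upper: "p k - p m \<le> k - m \<and> q k - q m \<le> k - m" if "m \<le> k" for m k
      using that
    proof (induction k rule: int_ge_induct)
      case (step k)
      then show ?case using each[of "u k"] unfolding p_succ q_succ by linarith
    qed simp
    have "real_of_int dp \<le> of_int (max N 0)" "real_of_int dq \<le> of_int (max N 0)"
      using upper[OF le] len unfolding dp_def dq_def by linarith+
    then have "E1 * dp + E2 * dq \<le> E1 * of_int (max N 0) + E2 * of_int (max N 0)"
      using E by (intro add_mono mult_left_mono) auto
    moreover have "E1 * dp + E2 * dq = \<kappa>' * (E1 * step1 (u n) + E2 * step3 (u n))"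
      using s(2)[of n] s(2)[of "n + 1"] unfolding dp_def dq_def p_succ q_succ by (simp add: algebra_simps)
    moreover have "\<kappa>' * min E1 E2 \<le> \<kappa>' * (E1 * step1 (u n) + E2 * step3 (u n))"
      using E \<kappa>'0 by (intro mult_left_mono) (cases "u n"; auto)+
    ultimately have "\<kappa>' * min E1 E2 \<le> of_int (max N 0) * (E1 + E2)" by (simp add: algebra_simps)
    then have "\<kappa>' \<le> of_int (max N 0) * (E1 + E2) / min E1 E2" using E by (simp add: pos_le_divide_eq)
    also have "\<dots> \<le> of_int R" unfolding R_def by linarith
    finally show False using \<kappa>(5) unfolding \<kappa>'_def by simp
  qed
  then show thesis using that s(1) by blast
qed

end

section \<open>Substitutions\<close>

lemma substitution_Nil: "substitution \<phi> \<Longrightarrow> \<phi> [] = []"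
  unfolding substitution_def by (metis append_Nil self_append_conv)

lemma block_start_0: "substitution \<phi> \<Longrightarrow> block_start \<phi> u 0 = 0"
  by (simp add: block_start_def substitution_Nil)

lemma block_start_succ:
  assumes "substitution \<phi>"
  shows "block_start \<phi> u (n + 1) = block_start \<phi> u n + int (length (\<phi> [u n]))"
proof (cases "n \<ge> 0")
  case True
  then have "[0..n] = [0..n - 1] @ [n]" by (simp add: upto_rec2)
  then have "\<phi> (map u [0..n]) = \<phi> (map u [0..n - 1]) @ \<phi> [u n]"
    using assms by (simp add: substitution_def)
  then show ?thesis using True by (simp add: block_start_def)
next
  case False
  then have "[n..-1] = n # [n + 1..-1]" by (simp add: upto_rec1)
  then have "\<phi> (map u [n..-1]) = \<phi> [u n] @ \<phi> (map u [n + 1..-1])"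
    using assms by (metis append_Cons append_Nil list.simps(9) substitution_def)
  then show ?thesis using False substitution_Nil[OF assms] by (cases "n = -1") (auto simp: block_start_def)
qed

lemma substitution_length:
  assumes "substitution \<phi>" "\<And>a. length (\<phi> [a]) = 1"
  shows "length (\<phi> w) = length w"
proof (induction w)
  case Nil then show ?case using substitution_Nil[OF assms(1)] by simp
next
  case (Cons a w)
  have "\<phi> (a # w) = \<phi> [a] @ \<phi> w" using assms(1) unfolding substitution_def by (metis append_Cons append_Nil)
  then show ?case using Cons assms(2) by simp
qed

text \<open>Under an erasing letter the positive iterates from that letter are empty, and under a
  letter-to-letter map all iterates have length 1. Neither can contain the whole alphabet, and the
  exponent 0 fails since the alphabet has more than one letter.\<close>

lemma primitive_substitution_growth:
  fixes \<phi> :: "letter list \<Rightarrow> letter list"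
  assumes prim: "primitive_substitution \<phi>"
  shows "\<phi> [a] \<noteq> []" "\<exists>a. length (\<phi> [a]) \<noteq> 1"
proof -
  have sub: "substitution \<phi>" using prim by (simp add: primitive_substitution_def)
  obtain n where n: "\<And>a b. b \<in> set ((\<phi> ^^ n) [a])" using prim unfolding primitive_substitution_def by blast
  show "\<phi> [a] \<noteq> []"
  proof
    assume "\<phi> [a] = []"
    have "(\<phi> ^^ m) [] = []" for m by (induction m) (simp_all add: substitution_Nil[OF sub])
    then have "n > 0 \<Longrightarrow> (\<phi> ^^ n) [a] = []"
      using \<open>\<phi> [a] = []\<close> by (cases n) (simp_all del: funpow.simps add: funpow_Suc_right)
    then have "n = 0" using n[of a a] by (cases "n > 0") simp_all
    then show False using n[of L1 a] n[of L2 a] by simp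
  qed
  show "\<exists>a. length (\<phi> [a]) \<noteq> 1"
  proof (rule ccontr)
    assume "\<not> ?thesis"
    then have len: "length (\<phi> w) = length w" for w using substitution_length[OF sub] by blast
    have "length ((\<phi> ^^ m) w) = length w" for m w by (induction m) (simp_all add: len)
    then obtain b where "(\<phi> ^^ n) [L1] = [b]" by (metis length_0_conv length_Suc_conv length_Cons)
    then show False using n[of L1 L1] n[of L2 L1] by simp
  qed
qed

context iet3_orbit
begin

lemma self_coding_of_substitution:
  assumes prim: "primitive_substitution \<phi>" and inv: "invariant_under \<phi> u"
  shows "self_coding (block_start \<phi> u)" "\<exists>n. block_start \<phi> u n \<noteq> n"
proof -
  define s where "s = block_start \<phi> u"
  have sub: "substitution \<phi>" using prim by (simp add: primitive_substitution_def)
  have s0: "s 0 = 0" unfolding s_def by (rule block_start_0[OF sub])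
  have ss: "s (n + 1) = s n + int (length (\<phi> [u n]))" for n unfolding s_def by (rule block_start_succ[OF sub])
  have step: "s n < s (n + 1)" for n using primitive_substitution_growth(1)[OF prim, of "u n"] by (simp add: ss)
  have mono: "strict_mono s"
  proof (rule strict_monoI)
    show "s n < s k" if "n < k" for n k
      using that
    proof (induction k rule: int_gr_induct)
      case base show ?case by (rule step)
    next
      case (step k) then show ?case using \<open>\<And>n. s n < s (n + 1)\<close>[of k] by simp
    qed
  qed
  have letters: "u (s n + int j) = \<phi> [u n] ! j" if j: "j < length (\<phi> [u n])" for n j
  proof -
    obtain n' j' where *: "j' < length (\<phi> [u n'])" "s n + int j = s n' + int j'" "u (s n + int j) = \<phi> [u n'] ! j'"
      using inv unfolding invariant_under_def substitution_image_def s_def by blast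
    have "s n' < s (n + 1)" "s n < s (n' + 1)" using * j by (simp_all add: ss)
    \<comment> \<open>Invariance offers some block covering the position; as \<open>s\<close> is
      strictly increasing, overlapping blocks coincide.\<close>
    then have "n' = n" using strict_mono_less[OF mono] by force
    then show ?thesis using * by simp
  qed
  have "u (s n + i) = u (s k + i)" if nk: "u n = u k" and i: "0 \<le> i" "i < s (n + 1) - s n" for n k i
  proof -
    have j: "nat i < length (\<phi> [u n])" "i = int (nat i)" using i by (auto simp: ss)
    show ?thesis using letters[OF j(1)] letters[of "nat i" k] j nk by metis
  qed
  moreover have "s (n + 1) - s n = s (k + 1) - s k" if "u n = u k" for n k
    unfolding ss that by simp
  ultimately show "self_coding (block_start \<phi> u)"
    unfolding s_def[symmetric] self_coding_def using s0 mono by blast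
  obtain a where "length (\<phi> [a]) \<noteq> 1" using primitive_substitution_growth(2)[OF prim] by blast
  moreover obtain n where "u n = a" using letter_exists .
  ultimately have "s (n + 1) \<noteq> s n + 1" by (simp add: ss)
  then show "\<exists>n. block_start \<phi> u n \<noteq> n" unfolding s_def[symmetric] by metis
qed

text \<open>The image of a letter is read off the block at any one of its occurrences. Since every
  block already contains every letter, primitivity holds with exponent 1.\<close>

lemma substitution_of_self_coding:
  assumes s: "self_coding s" and all: "\<And>n i. \<exists>j. s n \<le> j \<and> j < s (n + 1) \<and> u j = i"
  shows "\<exists>\<phi>. primitive_substitution \<phi> \<and> invariant_under \<phi> u"
proof -
  define m where "m i = (SOME n. u n = i)" for i
  have m: "u (m i) = i" for i unfolding m_def by (rule someI_ex) (metis letter_exists)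
  define W where "W i = map u [s (m i)..s (m i + 1) - 1]" for i
  define \<phi> where "\<phi> w = concat (map W w)" for w
  have lt: "s n < s (n + 1)" for n using strict_monoD[OF self_codingD(2)[OF s], of n "n + 1"] by simp
  have len: "int (length (W (u n))) = s (n + 1) - s n" for n
    using self_codingD(3)[OF s m[of "u n"]] lt[of "m (u n)"] by (simp add: W_def)
  have nth: "W (u n) ! j = u (s n + int j)" if "j < length (W (u n))" for n j
  proof -
    have "int j < s (m (u n) + 1) - s (m (u n))" using that lt[of "m (u n)"] by (simp add: W_def)
    then have "u (s (m (u n)) + int j) = u (s n + int j)"
      using self_codingD(4)[OF s m[of "u n"], of "int j"] by simp
    moreover have "W (u n) ! j = u (s (m (u n)) + int j)"
      using that \<open>int j < s (m (u n) + 1) - s (m (u n))\<close> by (simp add: W_def nth_upto)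
    ultimately show ?thesis by simp
  qed
  have sub: "substitution \<phi>" by (simp add: substitution_def \<phi>_def)
  have \<phi>1: "\<phi> [i] = W i" for i by (simp add: \<phi>_def)
  have start: "block_start \<phi> u n = s n" for n
  proof (induction n rule: int_shift_induct)
    case zero show ?case using block_start_0[OF sub] self_codingD(1)[OF s] by simp
  next
    case (up n) then show ?case using block_start_succ[OF sub, of u n] len[of n] by (simp add: \<phi>1)
  next
    case (down n) then show ?case using block_start_succ[OF sub, of u n] len[of n] by (simp add: \<phi>1)
  qed
  have "invariant_under \<phi> u"
    unfolding invariant_under_def substitution_image_def start \<phi>1
  proof
    fix k
    obtain n where n: "s n \<le> k" "k < s (n + 1)" using strict_mono_int_bracket[OF self_codingD(2)[OF s]] .
    then have "nat (k - s n) < length (W (u n))" using len[of n] by linarith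
    then show "\<exists>n j. j < length (W (u n)) \<and> k = s n + int j \<and> u k = W (u n) ! j"
      using nth n by (intro exI[of _ n] exI[of _ "nat (k - s n)"]) simp
  qed
  moreover have "primitive_substitution \<phi>"
    unfolding primitive_substitution_def
  proof (intro conjI sub exI[of _ 1] allI)
    fix a b
    obtain n where n: "u n = a" using letter_exists .
    obtain j where j: "s n \<le> j" "j < s (n + 1)" "u j = b" using all by blast
    then have "nat (j - s n) < length (W (u n))" using len[of n] by linarith
    then have "W (u n) ! nat (j - s n) \<in> set (W (u n))" "W (u n) ! nat (j - s n) = b"
      using nth[of "nat (j - s n)" n] j by auto
    then show "b \<in> set ((\<phi> ^^ 1) [a])" by (simp add: \<phi>1 n)
  qed
  ultimately show ?thesis by blast
qed

end

section \<open>Return to the original lengths and words\<close>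

lemma iet3_of_nondegenerate:
  assumes a: "a1 > 0" "a2 > 0" "a3 > 0" and nondeg: "nondegenerate_3iet a1 a2 a3"
  shows "iet3 ((a1 + a2) / (a1 + 2 * a2 + a3)) ((a1 + a2 + a3) / (a1 + 2 * a2 + a3))"
proof
  define \<sigma> where "\<sigma> = a1 + 2 * a2 + a3"
  have \<sigma>: "\<sigma> > 0" "\<sigma> = (a1 + a2) + (a2 + a3)" using a by (auto simp: \<sigma>_def)
  have ind: "p = 0 \<and> q = 0" if "p \<in> \<rat>" "q \<in> \<rat>" "p * (a1 + a2) + q * (a2 + a3) = 0" for p q
    using nondeg that unfolding nondegenerate_3iet_def by blast
  show "0 < (a1 + a2) / (a1 + 2 * a2 + a3)" "(a1 + a2) / (a1 + 2 * a2 + a3) < 1"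
    "(a1 + a2 + a3) / (a1 + 2 * a2 + a3) < 1"
    using a by (auto simp: field_simps)
  show "(a1 + a2) / (a1 + 2 * a2 + a3) < (a1 + a2 + a3) / (a1 + 2 * a2 + a3)"
    using a by (intro divide_strict_right_mono) auto
  have "1 - (a1 + a2) / (a1 + 2 * a2 + a3) = (a2 + a3) / (a1 + 2 * a2 + a3)"
    using a by (simp add: field_simps)
  also have "\<dots> < (a1 + a2 + a3) / (a1 + 2 * a2 + a3)"
    using a by (intro divide_strict_right_mono) auto
  finally show "1 - (a1 + a2) / (a1 + 2 * a2 + a3) < (a1 + a2 + a3) / (a1 + 2 * a2 + a3)" .
  show "(a1 + a2) / (a1 + 2 * a2 + a3) \<notin> \<rat>"
    unfolding \<sigma>_def[symmetric]
  proof
    define r where "r = (a1 + a2) / \<sigma>"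
    assume "(a1 + a2) / \<sigma> \<in> \<rat>"
    then have r: "r \<in> \<rat>" by (simp add: r_def)
    have "a1 + a2 = r * \<sigma>" using \<sigma>(1) by (simp add: r_def)
    moreover have "(1 - r) * (a1 + a2) + (- r) * (a2 + a3) = (a1 + a2) - r * \<sigma>"
      unfolding \<sigma>(2) by (simp add: algebra_simps)
    ultimately have "(1 - r) * (a1 + a2) + (- r) * (a2 + a3) = 0" by simp
    then have "1 - r = 0 \<and> - r = 0" using r by (intro ind) auto
    then show False by linarith
  qed
  fix i j :: int
  show "(a1 + a2 + a3) / (a1 + 2 * a2 + a3) \<noteq> of_int i + of_int j * ((a1 + a2) / (a1 + 2 * a2 + a3))"
    unfolding \<sigma>_def[symmetric]
  proof
    assume "(a1 + a2 + a3) / \<sigma> = of_int i + of_int j * ((a1 + a2) / \<sigma>)"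
    then have "a1 + a2 + a3 = of_int i * \<sigma> + of_int j * (a1 + a2)" using \<sigma>(1) by (simp add: field_simps)
    then have "a1 + a2 + a3 = (a1 + a2) * of_int (i + j) + (a2 + a3) * of_int i"
      unfolding \<sigma>(2) by (simp add: algebra_simps)
    then show False using nondeg unfolding nondegenerate_3iet_def by blast
  qed
qed

theorem theorem6p3:
  fixes \<alpha>1 \<alpha>2 \<alpha>3 x0 \<epsilon> l c :: real and u :: "int \<Rightarrow> letter"
  assumes "\<alpha>1 > 0" and "\<alpha>2 > 0" and "\<alpha>3 > 0"
    and "x0 \<in> {0..<\<alpha>1 + \<alpha>2 + \<alpha>3}"
    and "codes_3iet_orbit \<alpha>1 \<alpha>2 \<alpha>3 x0 u"
    and "nondegenerate_3iet \<alpha>1 \<alpha>2 \<alpha>3"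
    and "\<epsilon> = (\<alpha>1 + \<alpha>2) / (\<alpha>1 + 2 * \<alpha>2 + \<alpha>3)"
    and "l = (\<alpha>1 + \<alpha>2 + \<alpha>3) / (\<alpha>1 + 2 * \<alpha>2 + \<alpha>3)"
    and "c = - x0 / (\<alpha>1 + 2 * \<alpha>2 + \<alpha>3)"
  shows "(\<exists>\<phi>. primitive_substitution \<phi> \<and> invariant_under \<phi> u) \<longleftrightarrow>
    sturm_number \<epsilon> \<and>
    (c \<in> rat_adjoin \<epsilon> \<and> l \<in> rat_adjoin \<epsilon>) \<and>
    (let \<epsilon>' = galois_conjugate \<epsilon> \<epsilon>;
         c' = galois_conjugate \<epsilon> c;
         l' = galois_conjugate \<epsilon> l
     in min \<epsilon>' (1 - \<epsilon>') \<le> - c' \<and> - c' \<le> max \<epsilon>' (1 - \<epsilon>') \<and>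
        min \<epsilon>' (1 - \<epsilon>') \<le> c' + l' \<and> c' + l' \<le> max \<epsilon>' (1 - \<epsilon>'))"
proof -
  interpret iet: iet3 \<epsilon> l
    unfolding assms(7,8) by (rule iet3_of_nondegenerate[OF assms(1-3,6)])
  obtain x p q where orb: "iet3_orbit \<epsilon> l x u p q" and "x 0 = x0 / (\<alpha>1 + 2 * \<alpha>2 + \<alpha>3)"
    using iet.orbit_of_coding[OF assms(1-5,7,8)] .
  then have c: "c = 0 - x 0" "x 0 = 0 - c" using assms(9) by simp_all
  interpret iet3_orbit \<epsilon> l x u p q by (rule orb)
  have mem: "c \<in> rat_adjoin \<epsilon> \<longleftrightarrow> x 0 \<in> rat_adjoin \<epsilon>"
    using rat_adjoin_diff[OF rat_adjoin_0] c by metis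
  have conj: "galois_conjugate \<epsilon> \<epsilon> = algebraic_conjugate \<epsilon>" "galois_conjugate \<epsilon> c = - galois_conjugate \<epsilon> (x 0)"
    if q: "quadratic_irrational \<epsilon>" and "x 0 \<in> rat_adjoin \<epsilon>"
    using galois_conjugate_eq(3)[OF q] galois_conjugate_diff[OF q rat_adjoin_0 that(2)] galois_conjugate_Rats[OF q, of 0]
    unfolding c(1) by simp_all
  show ?thesis
  proof
    assume "\<exists>\<phi>. primitive_substitution \<phi> \<and> invariant_under \<phi> u"
    then obtain \<phi> where "primitive_substitution \<phi>" "invariant_under \<phi> u" by blast
    note St = sturm_of_self_coding[OF self_coding_of_substitution[OF this]]
    then have "quadratic_irrational \<epsilon>" by (simp add: sturm_number_def)
    then show "sturm_number \<epsilon> \<and> (c \<in> rat_adjoin \<epsilon> \<and> l \<in> rat_adjoin \<epsilon>) \<and>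
      (let \<epsilon>' = galois_conjugate \<epsilon> \<epsilon>; c' = galois_conjugate \<epsilon> c; l' = galois_conjugate \<epsilon> l
       in min \<epsilon>' (1 - \<epsilon>') \<le> - c' \<and> - c' \<le> max \<epsilon>' (1 - \<epsilon>') \<and>
          min \<epsilon>' (1 - \<epsilon>') \<le> c' + l' \<and> c' + l' \<le> max \<epsilon>' (1 - \<epsilon>'))"
      using St mem conj by (simp add: Let_def)
  next
    assume R: "sturm_number \<epsilon> \<and> (c \<in> rat_adjoin \<epsilon> \<and> l \<in> rat_adjoin \<epsilon>) \<and>
      (let \<epsilon>' = galois_conjugate \<epsilon> \<epsilon>; c' = galois_conjugate \<epsilon> c; l' = galois_conjugate \<epsilon> l
       in min \<epsilon>' (1 - \<epsilon>') \<le> - c' \<and> - c' \<le> max \<epsilon>' (1 - \<epsilon>') \<and>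
          min \<epsilon>' (1 - \<epsilon>') \<le> c' + l' \<and> c' + l' \<le> max \<epsilon>' (1 - \<epsilon>'))"
    then have mems: "sturm_number \<epsilon>" "x 0 \<in> rat_adjoin \<epsilon>" "l \<in> rat_adjoin \<epsilon>" using mem by blast+
    then have "quadratic_irrational \<epsilon>" by (simp add: sturm_number_def)
    note conj = conj[OF this mems(2)]
    obtain N where N: "\<And>n i. \<exists>j\<le>N. u (n + int j) = i" using recurrent_letters by blast
    obtain s where s: "self_coding s" "\<And>n. s (n + 1) - s n > int N"
      using self_coding_of_sturm[OF mems, of "int N"] R unfolding Let_def conj by auto
    show "\<exists>\<phi>. primitive_substitution \<phi> \<and> invariant_under \<phi> u"
    proof (rule substitution_of_self_coding[OF s(1)])
      fix n i
      obtain j where "j \<le> N" "u (s n + int j) = i" using N by blast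
      then show "\<exists>j. s n \<le> j \<and> j < s (n + 1) \<and> u j = i"
        using s(2)[of n] by (intro exI[of _ "s n + int j"]) simp
    qed
  qed
qed

end
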